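(* Let $\mathcal X\subset\mathbb R^d$ be compact and convex, and let $f_1,\dots,f_n:\mathcal X\to\mathbb R$ be convex and differentiable. Assume that $F=\sum_{i=1}^n f_i$ is strongly convex on $\mathcal X$, that it has a unique minimizer $x^\star$ over $\mathcal X$, with optimal value $F^\star=F(x^\star)$, and that each $\nabla f_i$ is locally continuously differentiable around $x^\star$. Let $\mathcal G$ be a connected simple undirected graph on $[n]=\{1,\dots,n\}$ with graph Laplacian $\mathcal L$. Let $\phi:\mathcal X\to\mathbb R$ be closed, differentiable and $\mu_\phi$-strongly convex ($\mu_\phi>0$), with Hessian $\nabla^2\phi$ locally continuously differentiable around $x^\star$. Use the notation $\mathbf L,\mathbf S,\mathbf R,\nabla f(\cdot),\nabla\phi^\star(\cdot),\nabla^2\phi(\cdot),\mathbf x^\star,\mathbf y^\star,\mathbf z^\star$ given in the context. Then: (i) The origin $(\tilde{\mathbf x},\mathbf W_2)=(0,0)$ is a locally exponentially stable equilibrium of the system $$\dot{\tilde{\mathbf x}}=-\nabla^2\phi(\tilde{\mathbf x}+\mathbf x^\star)^{-1}\big(\nabla f(\tilde{\mathbf x}+\mathbf x^\star)-\nabla f(\mathbf x^\star)+\mathbf L\tilde{\mathbf x}+\mathbf S\mathbf R\mathbf W_2\big),\qquad \dot{\mathbf W}_2=\mathbf R^\top\mathbf S\tilde{\mathbf x},$$ with state $\tilde{\mathbf x}\in\mathbb R^{nd}$, $\mathbf W_2\in\mathbb R^{(n-1)d}$. (ii) The point $(\mathbf x^\star,\mathbf y^\star,\mathbf z^\star)$ (the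 origin, in the centered variables $\mathbf x-\mathbf x^\star$, $\mathbf y-\mathbf y^\star$, $\mathbf z-\mathbf z^\star$) is a locally exponentially stable equilibrium of the distributed mirror descent dynamics with integral feedback $$\dot{\mathbf z}=-(\nabla f(\mathbf x)+\mathbf L\mathbf x+\mathbf y),\qquad \dot{\mathbf y}=\mathbf L\mathbf x,\qquad \mathbf x=\nabla\phi^\star(\mathbf z),$$ where $\mathbf y=\mathrm{col}\{y_1,\dots,y_n\}\in\mathbb R^{nd}$ ranges over the states with $\sum_{i=1}^n y_i=0$, an invariant set containing every trajectory of the algorithm, which is initialized at $\mathbf y(0)=0$.
   Context: Graph Laplacian: $[\mathcal L]_{ii}$ is the degree of vertex $i$, $[\mathcal L]_{ij}=-1$ if $\{i,j\}$ is an edge, and $[\mathcal L]_{ij}=0$ otherwise. It is symmetric positive semidefinite, and by connectivity its null space is spanned by the all-ones vector $\mathbf 1_n$. Matrices: $\mathbf L=\mathcal L\otimes I_d\in\mathbb R^{nd\times nd}$; $\mathbf S=\mathbf L^{1/2}$ is its symmetric positive semidefinite square root. Let $\mathcal L=Q\Lambda Q^\top$ with $Q$ orthogonal and $\Lambda=\mathrm{diag}\{0,\lambda_1,\dots,\lambda_{n-1}\}$, where $Q=[r,R]$, $r=\frac1{\sqrt n}\mathbf 1_n$, $R\in\mathbb R^{n\times(n-1)}$. Set $\mathbf R=R\otimes I_d$. Stacked notation: for $\mathbf x=\mathrm{col}\{x_1,\dots,x_n\}$ (vertical stacking of $x_i\in\mathcal X$) put $\nabla f(\mathbf x)=\mathrm{col}\{\nabla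 f_1(x_1),\dots,\nabla f_n(x_n)\}$, and let $\nabla^2\phi(\mathbf x)$ be the $nd\times nd$ block-diagonal matrix with diagonal blocks $\nabla^2\phi(x_1),\dots,\nabla^2\phi(x_n)$. For $\mathbf z=\mathrm{col}\{z_1,\dots,z_n\}$ with $z_i\in\mathbb R^d$ put $\nabla\phi^\star(\mathbf z)=\mathrm{col}\{\nabla\phi^\star(z_1),\dots,\nabla\phi^\star(z_n)\}$, where $\phi^\star(z)=\sup_{x\in\mathcal X}\{\langle x,z\rangle-\phi(x)\}$ is the convex conjugate of $\phi$. A function is closed if its epigraph is closed. Equilibrium: $\mathbf x^\star=\mathbf 1_n\otimes x^\star$, $\mathbf y^\star=-\nabla f(\mathbf x^\star)$, $\mathbf z^\star=\mathbf 1_n\otimes\nabla\phi(x^\star)$. Locally exponentially stable: an equilibrium $p$ of an autonomous system is locally exponentially stable if there exist $\delta,c,\kappa>0$ such that every solution $s(t)$ with $\|s(0)-p\|\le\delta$ exists for all $t\ge0$ and satisfies $\|s(t)-p\|\le c\,e^{-\kappa t}\|s(0)-p\|$ for all $t\ge 0$.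
   Formalization: "Locally continuously differentiable around x*" is read on an open neighbourhood of x* contained in X, so x* is interior to X; for x* on the boundary, (i) is not defined near the origin and (ii) fails (e.g. X=[0,1], f=φ=x²/2, n=1). *)

theory Defs
  imports "HOL-Analysis.Analysis"
begin

section \<open>Convex functions, gradients, Hessians\<close>

definition strongly_convex_on :: "real \<Rightarrow> 'a::real_inner set \<Rightarrow> ('a \<Rightarrow> real) \<Rightarrow> bool" where
  "strongly_convex_on \<mu> S f \<longleftrightarrow> 0 < \<mu> \<and> convex S \<and>
     (\<forall>x\<in>S. \<forall>y\<in>S. \<forall>t\<in>{0..1}.
        f ((1 - t) *\<^sub>R x + t *\<^sub>R y)
          \<le> (1 - t) * f x + t * f y - \<mu> / 2 * t * (1 - t) * (norm (x - y))\<^sup>2)"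

text \<open>Objective functions live on a set S only, so the derivative is taken relative to S; at interior
  points of S this is the ordinary gradient.  For a convex S with nonempty interior the relative
  gradient is unique also at boundary points.\<close>

definition gradient :: "'a::real_inner set \<Rightarrow> ('a \<Rightarrow> real) \<Rightarrow> 'a \<Rightarrow> 'a" where
  "gradient S f x = (THE g. (f has_derivative (\<lambda>h. h \<bullet> g)) (at x within S))"

definition hessian :: "(real^'d) set \<Rightarrow> (real^'d \<Rightarrow> real) \<Rightarrow> real^'d \<Rightarrow> real^'d^'d" where
  "hessian S f x = jacobian (gradient S f) (at x within S)"

text \<open>The neighbourhood is required to lie inside the domain S, so the point is interior to S.\<close>

definition C1_around ::
    "'a::real_normed_vector set \<Rightarrow> ('a \<Rightarrow> 'b::real_normed_vector) \<Rightarrow> 'a \<Rightarrow> bool" where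
  "C1_around S g x \<longleftrightarrow> (\<exists>U. open U \<and> x \<in> U \<and> U \<subseteq> S \<and>
     (\<exists>g'. (\<forall>u\<in>U. (g has_derivative blinfun_apply (g' u)) (at u)) \<and> continuous_on U g'))"

definition conjugate :: "'a::real_inner set \<Rightarrow> ('a \<Rightarrow> real) \<Rightarrow> 'a \<Rightarrow> real" where
  "conjugate S \<phi> z = (SUP x\<in>S. x \<bullet> z - \<phi> x)"


section \<open>Graphs\<close>

text \<open>The vertex set is the whole finite type; edges are two-element sets of vertices.\<close>

definition simple_graph :: "'n set set \<Rightarrow> bool" where
  "simple_graph E \<longleftrightarrow> (\<forall>e\<in>E. card e = 2)"

definition connected_graph :: "'n set set \<Rightarrow> bool" where
  "connected_graph E \<longleftrightarrow> (\<forall>i j. (\<lambda>u v. {u, v} \<in> E)\<^sup>*\<^sup>* i j)"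

definition laplacian :: "'n::finite set set \<Rightarrow> real^'n^'n" where
  "laplacian E = (\<chi> i j. if i = j then real (card {e \<in> E. i \<in> e})
                         else if {i, j} \<in> E then - 1 else 0)"


section \<open>Stacked vectors and block matrices\<close>

text \<open>A vector in R^(nd) is indexed by pairs (i, a): agent i, coordinate a.\<close>

definition col :: "('n \<Rightarrow> real^'d) \<Rightarrow> real^('n::finite \<times> 'd::finite)" where
  "col v = (\<chi> p. v (fst p) $ snd p)"

definition block :: "real^('n::finite \<times> 'd::finite) \<Rightarrow> 'n \<Rightarrow> real^'d" where
  "block x i = (\<chi> a. x $ (i, a))"

definition block_diag :: "('n \<Rightarrow> real^'d^'d) \<Rightarrow> real^('n::finite \<times> 'd::finite)^('n \<times> 'd)" where
  "block_diag B = (\<chi> p q. if fst p = fst q then B (fst p) $ snd p $ snd q else 0)"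

definition kron ::
    "real^'m^'n \<Rightarrow> real^'l^'k \<Rightarrow> real^('m::finite \<times> 'l::finite)^('n::finite \<times> 'k::finite)" where
  "kron A B = (\<chi> p q. A $ fst p $ fst q * B $ snd p $ snd q)"

definition is_psd_sqrt :: "real^'k^'k \<Rightarrow> real^'k^'k \<Rightarrow> bool" where
  "is_psd_sqrt S A \<longleftrightarrow> transpose S = S \<and> (\<forall>v. 0 \<le> v \<bullet> (S *v v)) \<and> S ** S = A"

text \<open>Orthogonal diagonalisation in which the normalised all-ones vector r is the eigenvector of the
  eigenvalue 0.  The n columns of Q are indexed by the vertex type, with k0 the index of the column
  r, so that the n - 1 columns of the remaining part are those with index different from k0.\<close>

definition laplacian_eigenbasis ::
    "'n::finite set set \<Rightarrow> 'n \<Rightarrow> real^'n^'n \<Rightarrow> ('n \<Rightarrow> real) \<Rightarrow> bool" where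
  "laplacian_eigenbasis E k0 Q lam \<longleftrightarrow> orthogonal_matrix Q
     \<and> laplacian E = Q ** (\<chi> i j. if i = j then lam i else 0) ** transpose Q
     \<and> lam k0 = 0 \<and> column k0 Q = (\<chi> i. 1 / sqrt (real CARD('n)))"

text \<open>The n by (n - 1) matrix R, padded by a zero column at index k0.  Accordingly R^((n-1)d) is the
  subspace of the vectors in R^(nd) whose block k0 vanishes.  Types are nonempty, so an index type
  with n - 1 elements would exclude the case n = 1.\<close>

definition drop_column :: "'n \<Rightarrow> real^'n^'m \<Rightarrow> real^'n^'m" where
  "drop_column k0 Q = (\<chi> i k. if k = k0 then 0 else Q $ i $ k)"

definition stacked_gradient ::
    "(real^'d) set \<Rightarrow> ('n \<Rightarrow> real^'d \<Rightarrow> real)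
      \<Rightarrow> real^('n::finite \<times> 'd::finite) \<Rightarrow> real^('n \<times> 'd)" where
  "stacked_gradient S f x = col (\<lambda>i. gradient S (f i) (block x i))"

definition stacked_hessian ::
    "(real^'d) set \<Rightarrow> (real^'d \<Rightarrow> real)
      \<Rightarrow> real^('n::finite \<times> 'd::finite) \<Rightarrow> real^('n \<times> 'd)^('n \<times> 'd)" where
  "stacked_hessian S \<phi> x = block_diag (\<lambda>i. hessian S \<phi> (block x i))"

definition mirror_map ::
    "(real^'d) set \<Rightarrow> (real^'d \<Rightarrow> real)
      \<Rightarrow> real^('n::finite \<times> 'd::finite) \<Rightarrow> real^('n \<times> 'd)" where
  "mirror_map S \<phi> z = col (\<lambda>i. gradient UNIV (conjugate S \<phi>) (block z i))"


section \<open>Local exponential stability\<close>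

definition time_interval :: "real set \<Rightarrow> bool" where
  "time_interval J \<longleftrightarrow> is_interval J \<and> 0 \<in> J \<and> J \<subseteq> {0..}"

text \<open>A system is given by the relation ``s is a solution on the time interval J'', which covers
  differential-algebraic systems; the set M consists of the admissible initial states.  That every
  solution exists for all times means that a global solution starts at each admissible state near
  p and that each solution on a smaller interval extends to a global one.\<close>

definition locally_exp_stable ::
    "(real set \<Rightarrow> (real \<Rightarrow> 'a::real_normed_vector) \<Rightarrow> bool) \<Rightarrow> 'a set \<Rightarrow> 'a \<Rightarrow> bool" where
  "locally_exp_stable sol M p \<longleftrightarrow> p \<in> M \<and> sol {0..} (\<lambda>_. p) \<and>
     (\<exists>\<delta>>0. \<exists>c>0. \<exists>\<kappa>>0. \<forall>s0\<in>M. norm (s0 - p) \<le> \<delta> \<longrightarrow>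
        (\<exists>s. sol {0..} s \<and> s 0 = s0) \<and>
        (\<forall>J s. time_interval J \<and> sol J s \<and> s 0 = s0 \<longrightarrow>
           (\<exists>s'. sol {0..} s' \<and> (\<forall>t\<in>J. s' t = s t)) \<and>
           (\<forall>t\<in>J. norm (s t - p) \<le> c * exp (- \<kappa> * t) * norm (s0 - p))))"


section \<open>The two systems\<close>

definition centered_states ::
    "'n \<Rightarrow> ((real^('n::finite \<times> 'd::finite)) \<times> (real^('n \<times> 'd))) set" where
  "centered_states k0 = {(x, w). block w k0 = 0}"

definition centered_solution ::
    "(real^'d) set \<Rightarrow> ('n \<Rightarrow> real^'d \<Rightarrow> real) \<Rightarrow> (real^'d \<Rightarrow> real) \<Rightarrow> real^('n \<times> 'd)
      \<Rightarrow> real^('n \<times> 'd)^('n \<times> 'd) \<Rightarrow> real^('n \<times> 'd)^('n \<times> 'd) \<Rightarrow> real^('n \<times> 'd)^('n \<times> 'd)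
      \<Rightarrow> 'n \<Rightarrow> real set
      \<Rightarrow> (real \<Rightarrow> (real^('n::finite \<times> 'd::finite)) \<times> (real^('n \<times> 'd))) \<Rightarrow> bool" where
  "centered_solution X f \<phi> xs L S R k0 J s \<longleftrightarrow>
     (\<exists>x w. s = (\<lambda>t. (x t, w t)) \<and> (\<forall>t\<in>J. (x t, w t) \<in> centered_states k0 \<and>
        (x has_vector_derivative
           - (matrix_inv (stacked_hessian X \<phi> (x t + xs)) *v
               (stacked_gradient X f (x t + xs) - stacked_gradient X f xs
                + L *v x t + S *v (R *v w t)))) (at t within J) \<and>
        (w has_vector_derivative transpose R *v (S *v x t)) (at t within J)))"

definition mirror_descent_solution ::
    "(real^'d) set \<Rightarrow> ('n \<Rightarrow> real^'d \<Rightarrow> real) \<Rightarrow> (real^'d \<Rightarrow> real) \<Rightarrow> real^('n \<times> 'd)^('n \<times> 'd)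
      \<Rightarrow> real set
      \<Rightarrow> (real \<Rightarrow> (real^('n::finite \<times> 'd::finite)) \<times> (real^('n \<times> 'd)) \<times> (real^('n \<times> 'd))) \<Rightarrow> bool" where
  "mirror_descent_solution X f \<phi> L J s \<longleftrightarrow>
     (\<exists>x y z. s = (\<lambda>t. (x t, y t, z t)) \<and> (\<forall>t\<in>J. x t = mirror_map X \<phi> (z t) \<and>
        (z has_vector_derivative - (stacked_gradient X f (x t) + L *v x t + y t)) (at t within J) \<and>
        (y has_vector_derivative L *v x t) (at t within J)))"

definition mirror_descent_states ::
    "(real^'d) set \<Rightarrow> (real^'d \<Rightarrow> real)
      \<Rightarrow> ((real^('n::finite \<times> 'd::finite)) \<times> (real^('n \<times> 'd)) \<times> (real^('n \<times> 'd))) set" where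
  "mirror_descent_states X \<phi> = {(x, y, z). x = mirror_map X \<phi> z \<and> (\<Sum>i\<in>UNIV. block y i) = 0}"

end

theory Submission
  imports Defs
begin

text \<open>Both systems linearise to a saddle point system M x' = - (H x + B w), w' = C x, where M is the
  stacked Hessian of the mirror function and H is the stacked Hessian of the objectives plus the
  Laplacian.  H is positive definite: the Laplacian only vanishes on consensus vectors, and there H is
  the Hessian of the strongly convex sum F.  The energy 1/2 (x, M x) + 1/2 (w, T w), with T chosen such
  that B and T C are adjoint, decreases only in x; adding a small multiple of (B w, M x) gives a
  quadratic Lyapunov function that decreases exponentially in x and w, and it survives small nonlinear
  perturbations.  In the mirror descent system the state z replaces x; near the equilibrium the
  gradient of the conjugate is the inverse of the gradient of the mirror function, so that the
  linearisations are conjugate by M.\<close>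

section \<open>Lyapunov stability of locally Lipschitz systems\<close>

text \<open>Three obstacles shape the proof. The fields are under control only near the equilibrium:
  further out \<open>matrix_inv\<close> and the relative gradients carry no information. Solutions
  for all times are therefore taken from a globally Lipschitz field that agrees with the true one on
  a ball, and uniqueness identifies them with solutions given on smaller intervals. Next, the
  gradient of the conjugate is handled as an inverse map: it is Lipschitz, but its derivative is
  computed at one point only. Hence the stability criterion asks for a Lipschitz bound on a ball and
  a derivative at the equilibrium. Finally the Laplacian is singular, so the second state variable
  has to be confined to an invariant subspace \<open>K\<close>. In the centred system
  \<open>K\<close> consists of the vectors with vanishing block \<open>k0\<close>, on which B = S R
  is injective; there C is the adjoint of B and T is the identity. In the mirror descent system
  \<open>K\<close> consists of the vectors with block sum 0, B is the identity, C = L, and T inverts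
  L on \<open>K\<close>.\<close>

lemma interval_subset_atLeastAtMost:
  fixes J :: "real set"
  assumes "time_interval J" "t \<in> J"
  shows "{0..t} \<subseteq> J"
proof
  fix u assume "u \<in> {0..t}"
  then show "u \<in> J"
    using assms mem_is_interval_1_I[of J 0 t u] by (simp add: time_interval_def)
qed

text \<open>Gronwall in differential form: the hypothesis makes the derivative of
  \<open>exp (- k * u) * V u\<close> nonpositive. The sign of \<open>k\<close> is free: a negative
  value gives the decay of a Lyapunov function, a nonnegative one gives uniqueness.\<close>

lemma differential_inequality_exp:
  fixes V :: "real \<Rightarrow> real"
  assumes J: "time_interval J"
    and V: "\<And>t. t \<in> J \<Longrightarrow> (V has_real_derivative V' t) (at t within J)"
    and le: "\<And>t. t \<in> J \<Longrightarrow> V' t \<le> k * V t"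
    and t: "t \<in> J"
  shows "V t \<le> exp (k * t) * V 0"
proof -
  have sub: "{0..t} \<subseteq> J" by (rule interval_subset_atLeastAtMost[OF J t])
  have t0: "0 \<le> t" using J t by (auto simp: time_interval_def)
  define g where "g = (\<lambda>u. exp (- k * u) * V u)"
  have "(g has_derivative (\<lambda>h. (exp (- k * u) * (V' u - k * V u)) * h)) (at u within {0..t})"
    if "0 \<le> u" "u \<le> t" for u
  proof -
    have "(V has_real_derivative V' u) (at u within {0..t})"
      using that sub by (intro DERIV_subset[OF V sub]) auto
    moreover have "((\<lambda>u. exp (- k * u)) has_real_derivative exp (- k * u) * (- k)) (at u within {0..t})"
      by (auto intro!: derivative_eq_intros)
    ultimately have "(g has_real_derivative exp (- k * u) * (- k) * V u + V' u * exp (- k * u))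
        (at u within {0..t})"
      unfolding g_def by (intro DERIV_mult)
    moreover have "exp (- k * u) * (- k) * V u + V' u * exp (- k * u) = exp (- k * u) * (V' u - k * V u)"
      by (simp add: algebra_simps)
    ultimately have "(g has_real_derivative exp (- k * u) * (V' u - k * V u)) (at u within {0..t})"
      by simp
    then show ?thesis by (simp add: has_field_derivative_def)
  qed
  from mvt_very_simple[OF t0 this]
  obtain u where u: "u \<in> {0..t}" "g t - g 0 = (exp (- k * u) * (V' u - k * V u)) * (t - 0)"
    by blast
  have "V' u - k * V u \<le> 0" using le[of u] u sub by auto
  then have "(exp (- k * u) * (V' u - k * V u)) * (t - 0) \<le> 0"
    using t0 by (intro mult_nonpos_nonneg mult_nonneg_nonpos) auto
  then have "g t \<le> g 0" using u by simp
  then have "exp (k * t) * (exp (- k * t) * V t) \<le> exp (k * t) * V 0"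
    by (simp add: g_def)
  moreover have "exp (k * t) * (exp (- k * t) * V t) = V t"
    by (simp add: exp_minus field_simps)
  ultimately show ?thesis by (simp only:)
qed

lemma has_vector_derivative_inner_self:
  fixes P :: "'a::real_inner \<Rightarrow> 'a"
  assumes P: "bounded_linear P" "\<And>u v. P u \<bullet> v = u \<bullet> P v"
    and s: "(s has_vector_derivative s') (at t within J)"
  shows "((\<lambda>t. s t \<bullet> P (s t)) has_real_derivative 2 * (P (s t) \<bullet> s')) (at t within J)"
proof -
  have "((\<lambda>t. P (s t)) has_vector_derivative P s') (at t within J)"
    by (rule bounded_linear.has_vector_derivative[OF P(1) s])
  then have "((\<lambda>t. s t \<bullet> P (s t)) has_derivative
      (\<lambda>h. s t \<bullet> (h *\<^sub>R P s') + (h *\<^sub>R s') \<bullet> P (s t))) (at t within J)"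
    using s unfolding has_vector_derivative_def
    by (intro derivative_intros) auto
  moreover have "s t \<bullet> (h *\<^sub>R P s') + (h *\<^sub>R s') \<bullet> P (s t) = 2 * (P (s t) \<bullet> s') * h" for h
    using P(2)[of "s t" s'] by (simp add: inner_commute)
  ultimately show ?thesis by (simp only: has_field_derivative_def)
qed

text \<open>The integral equation is solved on the whole half-line at once. The unknown is
  \<open>u t = exp (- 2 * l * t) *\<^sub>R s t\<close>; in this exponentially weighted supremum norm
  the integral operator contracts with factor 1/2, so no local solutions have to be glued. The bound
  on \<open>G\<close> keeps the weighted functions bounded.\<close>

lemma global_solution_lipschitz:
  fixes G :: "'a::euclidean_space \<Rightarrow> 'a"
  assumes l: "0 < l" and lip: "\<And>u v. norm (G u - G v) \<le> l * norm (u - v)"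
    and B: "\<And>u. norm (G u) \<le> B"
  obtains s where "s 0 = s0"
    "\<And>t. t \<ge> 0 \<Longrightarrow> (s has_vector_derivative G (s t)) (at t within {0..})"
proof -
  have contG: "continuous_on UNIV G"
    by (rule lipschitz_on_continuous_on[of l])
      (use l lip in \<open>auto intro!: lipschitz_onI simp: dist_norm\<close>)
  define g where "g = (\<lambda>(u :: real \<Rightarrow>\<^sub>C 'a) \<tau>. G (exp (2 * l * \<tau>) *\<^sub>R u \<tau>))"
  \<comment> \<open>Bounded continuous functions are typed on the whole real line;
    \<open>max 0 t\<close> extends the operator to negative times by its value at 0.\<close>
  define T where "T = (\<lambda>(u :: real \<Rightarrow>\<^sub>C 'a) t. exp (- 2 * l * max 0 t) *\<^sub>R
      (s0 + integral {0..max 0 t} (g u)))"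
  have contg: "continuous_on A (g u)" for u A
    unfolding g_def
    by (rule continuous_on_compose2[OF contG]) (auto intro!: continuous_intros)
  have intg: "g u integrable_on {a..b}" for u a b
    by (rule integrable_continuous_real[OF contg])
  have contI: "continuous_on UNIV (\<lambda>t. integral {0..max 0 t} (g u))" for u
  proof -
    have "continuous (at t) (\<lambda>t. integral {0..max 0 t} (g u))" for t :: real
    proof -
      have "continuous_on {0..\<bar>t\<bar> + 1} (\<lambda>x. integral {0..x} (g u))"
        by (rule indefinite_integral_continuous_1[OF intg])
      then have "continuous_on {- \<bar>t\<bar> - 1 .. \<bar>t\<bar> + 1} (\<lambda>t. integral {0..max 0 t} (g u))"
        by (rule continuous_on_compose2) (auto intro!: continuous_intros)
      then show ?thesis
        by (rule continuous_on_interior) (auto simp: interior_atLeastAtMost_real)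
    qed
    then show ?thesis by (simp add: continuous_on_eq_continuous_at)
  qed
  have T_bcontfun: "T u \<in> bcontfun" for u
  proof (rule bcontfun_normI)
    show "continuous_on UNIV (T u)"
      unfolding T_def by (intro continuous_intros contI)
    fix t :: real
    define p where "p = max 0 t"
    have p0: "0 \<le> p" unfolding p_def by (rule max.cobounded1)
    have "norm (integral {0..p} (g u)) \<le> B * (p - 0)"
      by (rule integral_bound[OF p0 contg]) (auto simp: g_def B)
    then have "norm (s0 + integral {0..p} (g u)) \<le> norm s0 + B * p"
      using norm_triangle_ineq[of s0] by (smt (verit))
    then have "norm (T u t) \<le> exp (- 2 * l * p) * (norm s0 + B * p)"
      by (simp add: T_def p_def)
    also have "\<dots> = exp (- 2 * l * p) * norm s0 + B * (exp (- 2 * l * p) * p)"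
      by (simp add: algebra_simps)
    also have "\<dots> \<le> 1 * norm s0 + B * (1 / (2 * l))"
    proof (intro add_mono mult_mono mult_left_mono)
      have "2 * l * p \<le> exp (2 * l * p)" using exp_ge_add_one_self[of "2 * l * p"] by linarith
      then show "exp (- 2 * l * p) * p \<le> 1 / (2 * l)"
        using l by (simp add: exp_minus field_simps)
      show "0 \<le> B" using B[of 0] norm_ge_zero[of "G 0"] by linarith
    qed (use l p0 in auto)
    finally show "norm (T u t) \<le> norm s0 + B * (1 / (2 * l))" by simp
  qed
  define \<Phi> where "\<Phi> = (\<lambda>u. Bcontfun (T u))"
  have \<Phi>: "apply_bcontfun (\<Phi> u) = T u" for u
    by (simp add: \<Phi>_def Bcontfun_inverse T_bcontfun)
  have contr: "dist (\<Phi> u) (\<Phi> v) \<le> 1/2 * dist u v" for u v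
  proof (rule dist_bound)
    fix t :: real
    define p where "p = max 0 t"
    have p0: "0 \<le> p" unfolding p_def by (rule max.cobounded1)
    define D where "D = dist u v"
    have D0: "0 \<le> D" by (simp add: D_def)
    \<comment> \<open>The weight has twice the rate \<open>l\<close>, so integration cancels
      \<open>l\<close> and leaves \<open>exp (2 * l * p) / 2\<close>: this is the origin of the
      contraction factor 1/2.\<close>
    have FTC: "((\<lambda>\<tau>. l * exp (2 * l * \<tau>) * D) has_integral
        (exp (2 * l * p) * D / 2 - exp (2 * l * 0) * D / 2)) {0..p}"
      by (rule fundamental_theorem_of_calculus[OF p0])
        (auto intro!: derivative_eq_intros simp: has_real_derivative_iff_has_vector_derivative[symmetric])
    have "norm (integral {0..p} (g u) - integral {0..p} (g v)) =
        norm (integral {0..p} (\<lambda>\<tau>. g u \<tau> - g v \<tau>))"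
      by (simp add: integral_diff[OF intg intg])
    also have "\<dots> \<le> integral {0..p} (\<lambda>\<tau>. l * exp (2 * l * \<tau>) * D)"
    proof (rule integral_norm_bound_integral)
      show "(\<lambda>\<tau>. g u \<tau> - g v \<tau>) integrable_on {0..p}" by (intro integrable_diff intg)
      show "(\<lambda>\<tau>. l * exp (2 * l * \<tau>) * D) integrable_on {0..p}" using FTC by blast
      fix \<tau> assume "\<tau> \<in> {0..p}"
      have "norm (g u \<tau> - g v \<tau>) \<le> l * norm (exp (2 * l * \<tau>) *\<^sub>R u \<tau> - exp (2 * l * \<tau>) *\<^sub>R v \<tau>)"
        unfolding g_def by (rule lip)
      also have "\<dots> = l * exp (2 * l * \<tau>) * dist (u \<tau>) (v \<tau>)"
        by (simp add: scaleR_diff_right[symmetric] dist_norm)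
      also have "\<dots> \<le> l * exp (2 * l * \<tau>) * D"
        using l unfolding D_def by (intro mult_left_mono dist_bounded) auto
      finally show "norm (g u \<tau> - g v \<tau>) \<le> l * exp (2 * l * \<tau>) * D" .
    qed
    also have "\<dots> = exp (2 * l * p) * D / 2 - D / 2"
      using integral_unique[OF FTC] by simp
    also have "\<dots> \<le> exp (2 * l * p) * D / 2" using D0 by simp
    finally have le: "norm (integral {0..p} (g u) - integral {0..p} (g v)) \<le> exp (2 * l * p) * D / 2" .
    have "dist (T u t) (T v t) =
        exp (- 2 * l * p) * norm (integral {0..p} (g u) - integral {0..p} (g v))"
      by (simp add: T_def p_def dist_norm scaleR_diff_right[symmetric])
    also have "\<dots> \<le> exp (- 2 * l * p) * (exp (2 * l * p) * D / 2)"
      by (intro mult_left_mono le) auto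
    also have "\<dots> = 1/2 * D" by (simp add: exp_minus)
    finally show "dist (\<Phi> u t) (\<Phi> v t) \<le> 1/2 * dist u v"
      unfolding \<Phi> D_def .
  qed
  obtain u where u: "\<Phi> u = u"
    using banach_fix_type[of "1/2" \<Phi>] contr by auto
  define s where "s = (\<lambda>t. s0 + integral {0..t} (g u))"
  have su: "exp (2 * l * t) *\<^sub>R u t = s t" if "t \<ge> 0" for t
  proof -
    have "u t = T u t" using u \<Phi>[of u] by simp
    then show ?thesis using that by (simp add: T_def s_def exp_minus)
  qed
  show thesis
  proof (rule that)
    show "s 0 = s0" by (simp add: s_def)
    fix t :: real assume t: "t \<ge> 0"
    have "((\<lambda>x. integral {0..x} (g u)) has_vector_derivative g u t) (at t within {0..t+1})"
      by (rule integral_has_vector_derivative[OF contg]) (use t in auto)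
    then have "(s has_vector_derivative g u t) (at t within {0..t+1})"
      unfolding s_def by (auto intro!: derivative_eq_intros)
    moreover have "at t within {0..t+1} = at t within {0..}"
      by (rule at_within_nhd[of t "{..<t+1}"]) (use t in auto)
    moreover have "g u t = G (s t)" by (simp add: g_def su[OF t])
    ultimately show "(s has_vector_derivative G (s t)) (at t within {0..})" by simp
  qed
qed

text \<open>Every linear functional that vanishes on \<open>K\<close> has derivative 0 along
  \<open>s\<close> and hence stays 0; the double orthogonal complement gives back
  \<open>K\<close>.\<close>

lemma solution_in_subspace:
  fixes s :: "real \<Rightarrow> 'a::euclidean_space"
  assumes J: "time_interval J" and K: "subspace K" and s0: "s 0 \<in> K"
    and s: "\<And>t. t \<in> J \<Longrightarrow> (s has_vector_derivative s' t) (at t within J)"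
    and s'K: "\<And>t. t \<in> J \<Longrightarrow> s' t \<in> K"
    and t: "t \<in> J"
  shows "s t \<in> K"
proof -
  have "s t \<bullet> v = 0" if v: "v \<in> orthogonal_comp K" for v
  proof -
    have orth: "x \<bullet> v = 0" if "x \<in> K" for x
      using v that by (auto simp: orthogonal_comp_def orthogonal_def inner_commute)
    have "((\<lambda>t. s t \<bullet> v) has_derivative (\<lambda>h. 0)) (at t within J)" if "t \<in> J" for t
    proof -
      have "((\<lambda>t. s t \<bullet> v) has_derivative (\<lambda>h. (h *\<^sub>R s' t) \<bullet> v)) (at t within J)"
        using s[OF that] unfolding has_vector_derivative_def
        by (rule has_derivative_inner_left)
      then show ?thesis using orth[OF s'K[OF that]] by simp
    qed
    moreover have "convex J" using J by (simp add: time_interval_def is_interval_convex)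
    ultimately have "\<exists>c. \<forall>t\<in>J. s t \<bullet> v = c"
      by (intro has_derivative_zero_constant)
    then obtain c where c: "\<And>t. t \<in> J \<Longrightarrow> s t \<bullet> v = c" by blast
    have "0 \<in> J" using J by (simp add: time_interval_def)
    then show ?thesis using c[of 0] c[OF t] orth[OF s0] by simp
  qed
  then have "s t \<in> orthogonal_comp (orthogonal_comp K)"
    by (auto simp: orthogonal_comp_def orthogonal_def inner_commute)
  then show ?thesis by (simp add: orthogonal_comp_self[OF K])
qed

text \<open>The decrease is known only inside the ball of radius \<open>r\<close>, so confinement
  and decay depend on each other. The decay estimate at a time is proved under confinement up to
  that time; at a first exit time it would give a norm below \<open>r\<close>. The factor
  \<open>sqrt (c2 / c1)\<close> is the cost of passing from the norm to the quadratic form and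
  back.\<close>

lemma quadratic_lyapunov_decay:
  fixes s :: "real \<Rightarrow> 'a::real_inner"
  assumes J: "time_interval J"
    and P: "bounded_linear P" "\<And>u v. P u \<bullet> v = u \<bullet> P v"
    and c1: "0 < c1" "\<And>v. v \<in> K \<Longrightarrow> c1 * (norm v)\<^sup>2 \<le> v \<bullet> P v"
    and c2: "0 < c2" "\<And>v. v \<bullet> P v \<le> c2 * (norm v)\<^sup>2"
    and a: "0 < a" and r: "0 < r"
    and K: "\<And>t. t \<in> J \<Longrightarrow> s t \<in> K"
    and s: "\<And>t. t \<in> J \<Longrightarrow> (s has_vector_derivative s' t) (at t within J)"
    and dec: "\<And>t. t \<in> J \<Longrightarrow> norm (s t) \<le> r \<Longrightarrow> P (s t) \<bullet> s' t \<le> - a * (norm (s t))\<^sup>2"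
    and small: "sqrt (c2 / c1) * norm (s 0) < r" "norm (s 0) < r"
    and t: "t \<in> J"
  shows "norm (s t) \<le> r" "norm (s t) \<le> sqrt (c2 / c1) * exp (- (a / c2) * t) * norm (s 0)"
proof -
  have J0: "0 \<in> J" "J \<subseteq> {0..}" using J by (auto simp: time_interval_def)
  have *: "norm (s u) \<le> sqrt (c2 / c1) * exp (- (a / c2) * u) * norm (s 0)"
    if u: "u \<in> J" and in_ball: "\<And>\<tau>. \<tau> \<in> {0..u} \<Longrightarrow> norm (s \<tau>) \<le> r" for u
  proof -
    have u0: "0 \<le> u" using u J0 by auto
    have sub: "{0..u} \<subseteq> J" by (rule interval_subset_atLeastAtMost[OF J u])
    define V where "V = (\<lambda>\<tau>. s \<tau> \<bullet> P (s \<tau>))"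
    \<comment> \<open>The derivative of \<open>V\<close> is at most
      \<open>- 2 * a * (norm s)\<^sup>2\<close>, which gives the rate \<open>2 * a / c2\<close>; the
      square root taken at the end halves it.\<close>
    have "V u \<le> exp (- (2 * a / c2) * u) * V 0"
    proof (rule differential_inequality_exp[where V = V and J = "{0..u}"])
      show "time_interval {0..u}" using u0 by (auto simp: time_interval_def is_interval_cc)
      fix \<tau> assume \<tau>: "\<tau> \<in> {0..u}"
      have "(s has_vector_derivative s' \<tau>) (at \<tau> within {0..u})"
        using has_vector_derivative_within_subset[OF s sub] \<tau> sub by blast
      then show "(V has_real_derivative 2 * (P (s \<tau>) \<bullet> s' \<tau>)) (at \<tau> within {0..u})"
        unfolding V_def by (rule has_vector_derivative_inner_self[OF P])
      have "2 * (P (s \<tau>) \<bullet> s' \<tau>) \<le> - 2 * a * (norm (s \<tau>))\<^sup>2"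
        using dec[of \<tau>] \<tau> sub in_ball[OF \<tau>] by auto
      also have "\<dots> \<le> - (2 * a / c2) * V \<tau>"
        using c2(2)[of "s \<tau>"] c2(1) a unfolding V_def by (simp add: field_simps)
      finally show "2 * (P (s \<tau>) \<bullet> s' \<tau>) \<le> - (2 * a / c2) * V \<tau>" .
    qed (use u0 in auto)
    also have "\<dots> \<le> exp (- (2 * a / c2) * u) * (c2 * (norm (s 0))\<^sup>2)"
      unfolding V_def by (intro mult_left_mono c2(2)) simp
    finally have "c1 * (norm (s u))\<^sup>2 \<le> exp (- (2 * a / c2) * u) * (c2 * (norm (s 0))\<^sup>2)"
      using c1(2)[OF K[OF u]] unfolding V_def by (rule order_trans[rotated])
    then have "c1 * (norm (s u))\<^sup>2 / c1 \<le> exp (- (2 * a / c2) * u) * (c2 * (norm (s 0))\<^sup>2) / c1"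
      using c1(1) by (intro divide_right_mono) auto
    then have "(norm (s u))\<^sup>2 \<le> (c2 / c1) * exp (- (2 * a / c2) * u) * (norm (s 0))\<^sup>2"
      using c1(1) by (simp add: mult.commute mult.left_commute)
    also have "exp (- (2 * a / c2) * u) = (exp (- (a / c2) * u))\<^sup>2"
      unfolding exp_double[symmetric] by simp
    also have "c2 / c1 = (sqrt (c2 / c1))\<^sup>2"
      using c1(1) c2(1) by (subst real_sqrt_pow2) auto
    finally have "(norm (s u))\<^sup>2 \<le> (sqrt (c2 / c1) * exp (- (a / c2) * u) * norm (s 0))\<^sup>2"
      by (simp only: power_mult_distrib)
    then show ?thesis
      by (rule power2_le_imp_le) (use c1(1) c2(1) in auto)
  qed
  have lt: "norm (s u) < r" if u: "u \<in> J" for u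
  proof (rule ccontr)
    assume "\<not> norm (s u) < r"
    have u0: "0 \<le> u" using u J0 by auto
    have sub: "{0..u} \<subseteq> J" by (rule interval_subset_atLeastAtMost[OF J u])
    have cont: "continuous_on {0..u} s"
      using has_vector_derivative_continuous[OF s] sub
      by (meson continuous_on_eq_continuous_within continuous_on_subset)
    \<comment> \<open>The times outside the open ball form a closed set, so the first exit time
      \<open>t1\<close> belongs to it. Before \<open>t1\<close> the norm is below \<open>r\<close>,
      hence at most \<open>r\<close> at \<open>t1\<close> by continuity, and the conditional
      estimate holds at \<open>t1\<close> itself.\<close>
    define A where "A = {\<tau> \<in> {0..u}. r \<le> norm (s \<tau>)}"
    have A: "closed A" "A \<noteq> {}" "bdd_below A"
    proof -
      show "closed A"
        unfolding A_def by (intro continuous_on_closed_Collect_le continuous_intros cont)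
      show "A \<noteq> {}" using \<open>\<not> norm (s u) < r\<close> u0 by (auto simp: A_def)
      show "bdd_below A" by (auto simp: A_def intro!: bdd_belowI[of _ 0])
    qed
    define t1 where "t1 = Inf A"
    have t1: "t1 \<in> A" unfolding t1_def by (rule closed_contains_Inf) (use A in auto)
    then have t1u: "0 \<le> t1" "t1 \<le> u" "r \<le> norm (s t1)" by (auto simp: A_def)
    have before: "norm (s \<tau>) < r" if "0 \<le> \<tau>" "\<tau> < t1" for \<tau>
      using that t1u cInf_lower[OF _ A(3), of \<tau>] by (force simp: A_def t1_def)
    have "norm (s t1) \<le> r"
    proof (cases "t1 = 0")
      case True then show ?thesis using small by simp
    next
      case False
      then have t1p: "0 < t1" using t1u by simp
      have "continuous_on (closure {0<..<t1}) (\<lambda>\<tau>. norm (s \<tau>))"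
        using t1u t1p by (intro continuous_intros continuous_on_subset[OF cont]) auto
      then show ?thesis
        by (rule continuous_le_on_closure) (use t1p before in \<open>auto intro: less_imp_le\<close>)
    qed
    moreover have "norm (s \<tau>) \<le> r" if "\<tau> \<in> {0..t1}" for \<tau>
      using that before[of \<tau>] \<open>norm (s t1) \<le> r\<close> by (cases "\<tau> = t1") auto
    ultimately have "norm (s t1) \<le> sqrt (c2 / c1) * exp (- (a / c2) * t1) * norm (s 0)"
      using t1u sub by (intro *) auto
    also have "\<dots> \<le> sqrt (c2 / c1) * 1 * norm (s 0)"
      using t1u a c1(1) c2(1) by (intro mult_right_mono mult_left_mono) auto
    also have "\<dots> < r" using small by simp
    finally show False using t1u by simp
  qed
  show "norm (s t) \<le> r" using lt[OF t] by simp
  show "norm (s t) \<le> sqrt (c2 / c1) * exp (- (a / c2) * t) * norm (s 0)"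
    using lt interval_subset_atLeastAtMost[OF J t] by (intro *[OF t]) (meson less_imp_le subsetD)
qed

text \<open>The squared distance of the two solutions starts at 0 and grows at most with rate
  \<open>2 * l\<close>. Both solutions have to stay in the set where the Lipschitz bound is
  known.\<close>

lemma solution_unique_lipschitz:
  fixes s1 s2 :: "real \<Rightarrow> 'a::real_inner"
  assumes J: "time_interval J" and lip: "l-lipschitz_on B F"
    and s1: "\<And>t. t \<in> J \<Longrightarrow> s1 t \<in> B" "\<And>t. t \<in> J \<Longrightarrow> (s1 has_vector_derivative F (s1 t)) (at t within J)"
    and s2: "\<And>t. t \<in> J \<Longrightarrow> s2 t \<in> B" "\<And>t. t \<in> J \<Longrightarrow> (s2 has_vector_derivative F (s2 t)) (at t within J)"
    and eq: "s1 0 = s2 0" and t: "t \<in> J"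
  shows "s1 t = s2 t"
proof -
  define e where "e = (\<lambda>t. s1 t - s2 t)"
  have "e t \<bullet> e t \<le> exp (2 * l * t) * (e 0 \<bullet> e 0)"
  proof (rule differential_inequality_exp[where V = "\<lambda>u. e u \<bullet> e u" and J = J
        and V' = "\<lambda>u. 2 * (e u \<bullet> (F (s1 u) - F (s2 u)))"])
    fix u assume u: "u \<in> J"
    have "(e has_vector_derivative F (s1 u) - F (s2 u)) (at u within J)"
      unfolding e_def by (rule has_vector_derivative_diff[OF s1(2)[OF u] s2(2)[OF u]])
    then show "((\<lambda>u. e u \<bullet> e u) has_real_derivative 2 * (e u \<bullet> (F (s1 u) - F (s2 u)))) (at u within J)"
      by (rule has_vector_derivative_inner_self[where P = "\<lambda>x. x" and s = e, OF bounded_linear_ident refl])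
    have "e u \<bullet> (F (s1 u) - F (s2 u)) \<le> norm (e u) * norm (F (s1 u) - F (s2 u))"
      by (rule norm_cauchy_schwarz)
    also have "\<dots> \<le> norm (e u) * (l * norm (e u))"
      using lipschitz_on_normD[OF lip s1(1)[OF u] s2(1)[OF u]]
      by (intro mult_left_mono) (auto simp: e_def)
    also have "\<dots> = l * (e u \<bullet> e u)"
      unfolding dot_square_norm power2_eq_square by (rule mult.left_commute)
    finally show "2 * (e u \<bullet> (F (s1 u) - F (s2 u))) \<le> 2 * l * (e u \<bullet> e u)"
      by linarith
  qed (use J t in auto)
  then have "e t \<bullet> e t \<le> 0" by (simp add: e_def eq)
  then have "e t = 0" by (metis inner_eq_zero_iff inner_ge_zero order_antisym)
  then show ?thesis by (simp add: e_def)
qed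


text \<open>Nothing is known of \<open>F\<close> outside \<open>K \<inter> cball 0 r\<close>.
  Precomposition with the nearest point projection onto this closed convex set gives a field that is
  Lipschitz, bounded and \<open>K\<close>-valued everywhere, hence has global solutions; those that
  start close to 0 never reach the region where it differs from \<open>F\<close>.\<close>

theorem locally_exp_stable_quadratic_lyapunov:
  fixes F P :: "'a::euclidean_space \<Rightarrow> 'a"
  assumes K: "subspace K" and P: "linear P" "\<And>u v. P u \<bullet> v = u \<bullet> P v"
    and c1: "0 < c1" "\<And>v. v \<in> K \<Longrightarrow> c1 * (norm v)\<^sup>2 \<le> v \<bullet> P v"
    and r: "0 < r" and lip: "l-lipschitz_on (K \<inter> cball 0 r) F"
    and FK: "\<And>v. v \<in> K \<inter> cball 0 r \<Longrightarrow> F v \<in> K" and F0: "F 0 = 0"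
    and a: "0 < a" and dec: "\<And>v. v \<in> K \<inter> cball 0 r \<Longrightarrow> P v \<bullet> F v \<le> - a * (norm v)\<^sup>2"
  shows "locally_exp_stable
    (\<lambda>J v. \<forall>t\<in>J. v t \<in> K \<and> (v has_vector_derivative F (v t)) (at t within J)) K 0"
proof -
  let ?B = "K \<inter> cball 0 r"
  have bl: "bounded_linear P" using P(1) by (simp add: linear_linear)
  define c2 where "c2 = onorm P + 1"
  have c2: "0 < c2" "\<And>v. v \<bullet> P v \<le> c2 * (norm v)\<^sup>2"
  proof -
    show "0 < c2" using onorm_pos_le[OF bl] by (simp add: c2_def)
    fix v
    have "v \<bullet> P v \<le> norm v * norm (P v)" by (rule norm_cauchy_schwarz)
    also have "\<dots> \<le> norm v * (onorm P * norm v)" by (intro mult_left_mono onorm[OF bl]) auto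
    also have "\<dots> \<le> c2 * (norm v)\<^sup>2" by (simp add: c2_def power2_eq_square algebra_simps)
    finally show "v \<bullet> P v \<le> c2 * (norm v)\<^sup>2" .
  qed
  have "0 \<in> ?B" using K r by (simp add: subspace_0)
  then have B: "convex ?B" "closed ?B" "?B \<noteq> {}"
    using K by (blast intro: convex_Int closed_Int subspace_imp_convex closed_subspace convex_cball closed_cball)+
  define \<pi> where "\<pi> = closest_point ?B"
  have \<pi>B: "\<pi> v \<in> ?B" for v unfolding \<pi>_def by (rule closest_point_in_set) (use B in auto)
  have \<pi>id: "\<pi> v = v" if "v \<in> ?B" for v unfolding \<pi>_def by (rule closest_point_self[OF that])
  define G where "G = (\<lambda>v. F (\<pi> v))"
  \<comment> \<open>The choice gives
    \<open>r = 2 * (sqrt (c2 / c1) * \<delta>) + 2 * \<delta>\<close>, so that both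
    \<open>\<delta>\<close> and \<open>sqrt (c2 / c1) * \<delta>\<close> are strictly below
    \<open>r\<close>.\<close>
  define \<delta> where "\<delta> = r / (2 * (sqrt (c2 / c1) + 1))"
  have sq: "0 < sqrt (c2 / c1)" using c1 c2 by simp
  have \<delta>: "0 < \<delta>" "sqrt (c2 / c1) * \<delta> < r" "\<delta> < r"
  proof -
    show \<delta>0: "0 < \<delta>" unfolding \<delta>_def using r sq by (intro divide_pos_pos mult_pos_pos add_pos_pos) auto
    have "0 < 2 * (sqrt (c2 / c1) + 1)" using sq by (intro mult_pos_pos add_pos_pos) auto
    then have "2 * (sqrt (c2 / c1) + 1) \<noteq> 0" by (rule less_imp_neq[THEN not_sym])
    then have "r = \<delta> * (2 * (sqrt (c2 / c1) + 1))"
      unfolding \<delta>_def by (rule nonzero_divide_eq_eq[THEN iffD1, OF _ refl])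
    also have "\<dots> = 2 * (sqrt (c2 / c1) * \<delta>) + 2 * \<delta>" by (simp add: distrib_left)
    finally have "r = 2 * (sqrt (c2 / c1) * \<delta>) + 2 * \<delta>" .
    moreover have "0 < sqrt (c2 / c1) * \<delta>" using sq \<delta>0 by (rule mult_pos_pos)
    ultimately show "sqrt (c2 / c1) * \<delta> < r" "\<delta> < r" using \<delta>0 by linarith+
  qed
  have small: "sqrt (c2 / c1) * norm v < r" "norm v < r" if "norm v \<le> \<delta>" for v :: 'a
    using \<delta> that sq by (auto intro: order_le_less_trans[OF mult_left_mono[of _ \<delta>]])
  have ex: "\<exists>s. (\<forall>t\<in>{0..}. s t \<in> ?B \<and> (s has_vector_derivative F (s t)) (at t within {0..})) \<and> s 0 = s0"
    if s0: "s0 \<in> K" "norm s0 \<le> \<delta>" for s0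
  proof -
    \<comment> \<open>The constant \<open>l\<close> may be 0, but the weighted norm behind the
      existence result needs a positive one.\<close>
    have l1: "0 < l + 1" using lipschitz_on_nonneg[OF lip] by linarith
    have lipG: "norm (G u - G v) \<le> (l + 1) * norm (u - v)" for u v
    proof -
      have "norm (G u - G v) \<le> l * norm (\<pi> u - \<pi> v)"
        unfolding G_def by (rule lipschitz_on_normD[OF lip \<pi>B \<pi>B])
      also have "\<dots> \<le> (l + 1) * norm (u - v)"
        using closest_point_lipschitz[OF B, of u v] lipschitz_on_nonneg[OF lip]
        by (intro mult_mono) (auto simp: \<pi>_def dist_norm)
      finally show ?thesis .
    qed
    have BG: "norm (G u) \<le> l * r" for u
    proof -
      have "norm (F (\<pi> u) - F 0) \<le> l * norm (\<pi> u - 0)"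
        using r K by (intro lipschitz_on_normD[OF lip \<pi>B]) (auto simp: subspace_0)
      also have "\<dots> \<le> l * r"
        using \<pi>B[of u] lipschitz_on_nonneg[OF lip] by (intro mult_left_mono) auto
      finally show ?thesis by (simp add: G_def F0)
    qed
    obtain s where s: "s 0 = s0"
      "\<And>t. t \<ge> 0 \<Longrightarrow> (s has_vector_derivative G (s t)) (at t within {0..})"
      by (rule global_solution_lipschitz[OF l1 lipG BG, of s0]) (rule that)
    have TI: "time_interval {0..}" by (auto simp: time_interval_def is_interval_ci)
    have sK: "s t \<in> K" if "t \<ge> 0" for t
      by (rule solution_in_subspace[OF TI K, where s' = "\<lambda>t. G (s t)"])
        (use s s0 that FK[OF \<pi>B] in \<open>auto simp: G_def\<close>)
    have "norm (s t) \<le> r" if "t \<ge> 0" for t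
    proof (rule quadratic_lyapunov_decay(1)[OF TI bl P(2) c1 c2 a r, where s' = "\<lambda>t. G (s t)"])
      fix t :: real assume t: "t \<in> {0..}" and n: "norm (s t) \<le> r"
      have "s t \<in> ?B" using sK[of t] t n by auto
      then show "P (s t) \<bullet> G (s t) \<le> - a * (norm (s t))\<^sup>2"
        using dec[of "s t"] by (simp add: G_def \<pi>id)
    qed (use sK s small[OF s0(2)] that in auto)
    then have "s t \<in> ?B" if "t \<ge> 0" for t using sK that by auto
    then show ?thesis using s by (intro exI[of _ s]) (auto simp: G_def \<pi>id)
  qed
  have stays: "v t \<in> ?B \<and> norm (v t) \<le> sqrt (c2 / c1) * exp (- (a / c2) * t) * norm (v 0)"
    if J: "time_interval J" and v: "\<forall>t\<in>J. v t \<in> K \<and> (v has_vector_derivative F (v t)) (at t within J)"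
      and v0: "norm (v 0) \<le> \<delta>" and t: "t \<in> J" for J v t
  proof -
    have vK: "v u \<in> K" and vd: "(v has_vector_derivative F (v u)) (at u within J)" if "u \<in> J" for u
      using v that by auto
    have vdec: "P (v u) \<bullet> F (v u) \<le> - a * (norm (v u))\<^sup>2" if "u \<in> J" "norm (v u) \<le> r" for u
      using dec[of "v u"] vK that by auto
    note decay = quadratic_lyapunov_decay[where J = J and s = v and s' = "\<lambda>t. F (v t)" and t = t,
        OF J bl P(2) c1 c2 a r vK vd vdec small[OF v0] t]
    show ?thesis using decay vK[OF t] by simp
  qed
  show ?thesis
    unfolding locally_exp_stable_def
  proof (intro conjI, goal_cases)
    case 3
    have "0 < a / c2" using a c2 by simp
    show ?case
    proof (rule exI[of _ \<delta>], rule conjI[OF \<delta>(1)], rule exI[of _ "sqrt (c2 / c1)"], rule conjI[OF sq],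
        rule exI[of _ "a / c2"], rule conjI[OF \<open>0 < a / c2\<close>], intro ballI impI allI conjI)
      fix s0 assume s0: "s0 \<in> K" "norm (s0 - 0) \<le> \<delta>"
      then obtain s where s: "s 0 = s0"
        "\<And>t. t \<ge> 0 \<Longrightarrow> s t \<in> ?B \<and> (s has_vector_derivative F (s t)) (at t within {0..})"
        using ex[of s0] by auto
      then show "\<exists>s. (\<forall>t\<in>{0..}. s t \<in> K \<and> (s has_vector_derivative F (s t)) (at t within {0..})) \<and> s 0 = s0"
        by auto
      fix J v
      assume v: "time_interval J \<and> (\<forall>t\<in>J. v t \<in> K \<and> (v has_vector_derivative F (v t)) (at t within J))
        \<and> v 0 = s0"
      then have J0: "J \<subseteq> {0..}" by (auto simp: time_interval_def)
      \<comment> \<open>Both curves stay in the ball on which \<open>F\<close> is Lipschitz, so the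
        given solution on \<open>J\<close> is a restriction of the global one.\<close>
      have "s t = v t" if t: "t \<in> J" for t
      proof (rule solution_unique_lipschitz[OF _ lip _ _ _ _ _ t])
        fix u assume u: "u \<in> J"
        show "s u \<in> ?B" "(s has_vector_derivative F (s u)) (at u within J)"
          using s(2)[of u] u J0 has_vector_derivative_within_subset by blast+
        show "v u \<in> ?B" using stays[of J v u] v s0 u by auto
      qed (use v s in auto)
      then show "\<exists>s'. (\<forall>t\<in>{0..}. s' t \<in> K \<and> (s' has_vector_derivative F (s' t)) (at t within {0..}))
          \<and> (\<forall>t\<in>J. s' t = v t)"
        using s by (intro exI[of _ s]) auto
      fix t assume "t \<in> J"
      then show "norm (v t - 0) \<le> sqrt (c2 / c1) * exp (- (a / c2) * t) * norm (s0 - 0)"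
        using stays[of J v t] v s0 by auto
    qed
  qed (auto simp: F0 subspace_0[OF K])
qed

text \<open>Near 0 the remainder \<open>F v - G v\<close> is at most \<open>e * norm v\<close>, and
  \<open>e\<close> is so small that it consumes at most half of the decay \<open>a\<close>. The
  summand 1 in its denominator keeps it defined when \<open>onorm P\<close> is 0.\<close>

corollary locally_exp_stable_linearization:
  fixes F G P :: "'a::euclidean_space \<Rightarrow> 'a"
  assumes K: "subspace K" and P: "linear P" "\<And>u v. P u \<bullet> v = u \<bullet> P v"
    and c1: "0 < c1" "\<And>v. v \<in> K \<Longrightarrow> c1 * (norm v)\<^sup>2 \<le> v \<bullet> P v"
    and r: "0 < r" and lip: "l-lipschitz_on (cball 0 r) F"
    and FK: "\<And>v. v \<in> K \<Longrightarrow> F v \<in> K" and F0: "F 0 = 0"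
    and G: "(F has_derivative G) (at 0)"
    and a: "0 < a" and dec: "\<And>v. v \<in> K \<Longrightarrow> P v \<bullet> G v \<le> - a * (norm v)\<^sup>2"
  shows "locally_exp_stable
    (\<lambda>J v. \<forall>t\<in>J. v t \<in> K \<and> (v has_vector_derivative F (v t)) (at t within J)) K 0"
proof -
  have bl: "bounded_linear P" using P(1) by (simp add: linear_linear)
  define e where "e = a / (2 * (onorm P + 1))"
  have oP: "0 \<le> onorm P" by (rule onorm_pos_le[OF bl])
  have e: "0 < e" "onorm P * e \<le> a / 2" using a oP by (auto simp: e_def field_simps)
  obtain d where d: "0 < d" "\<And>v. norm (v - 0) < d \<Longrightarrow> norm (F v - F 0 - G (v - 0)) \<le> e * norm (v - 0)"
    using G e(1) unfolding has_derivative_at_alt by blast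
  define \<rho> where "\<rho> = min r (d / 2)"
  show ?thesis
  proof (rule locally_exp_stable_quadratic_lyapunov[OF K P c1, where r = \<rho> and a = "a / 2"])
    show "l-lipschitz_on (K \<inter> cball 0 \<rho>) F"
      by (rule lipschitz_on_subset[OF lip]) (auto simp: \<rho>_def)
    fix v assume v: "v \<in> K \<inter> cball 0 \<rho>"
    then have "norm (v - 0) < d" using d(1) by (auto simp: \<rho>_def)
    then have n: "norm (F v - G v) \<le> e * norm v" using d(2)[of v] F0 by simp
    have "P v \<bullet> (F v - G v) \<le> norm (P v) * norm (F v - G v)" by (rule norm_cauchy_schwarz)
    also have "\<dots> \<le> (onorm P * norm v) * (e * norm v)"
      by (intro mult_mono onorm[OF bl] n) (use oP in auto)
    also have "\<dots> = (onorm P * e) * (norm v)\<^sup>2" by (simp add: power2_eq_square)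
    also have "\<dots> \<le> a / 2 * (norm v)\<^sup>2" by (intro mult_right_mono e) auto
    finally show "P v \<bullet> F v \<le> - (a / 2) * (norm v)\<^sup>2"
      using dec[of v] v by (simp add: inner_diff_right)
  qed (use r d a FK F0 in \<open>auto simp: \<rho>_def\<close>)
qed


section \<open>Linear saddle point systems\<close>

text \<open>The form is \<open>x \<bullet> M x + w \<bullet> T w + 2 * \<epsilon> * (B w \<bullet> M
  x)\<close>. The cross term carries \<open>M\<close> so that its derivative contains \<open>B w
  \<bullet> M x' = - (B w \<bullet> H x) - (norm (B w))\<^sup>2\<close>: the last summand is the
  missing decay in \<open>w\<close>, as \<open>B\<close> is bounded below on \<open>K\<close>. The
  velocity \<open>x'\<close> enters only through \<open>M x'\<close>, so no inverse of
  \<open>M\<close> has to be formed.\<close>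

lemma saddle_point_lyapunov:
  fixes M H :: "'a::euclidean_space \<Rightarrow> 'a" and B :: "'b::euclidean_space \<Rightarrow> 'a"
    and C :: "'a \<Rightarrow> 'b" and T :: "'b \<Rightarrow> 'b"
  assumes lin: "linear M" "linear H" "linear B" "linear C" "linear T"
    and M: "\<And>u v. M u \<bullet> v = u \<bullet> M v" "0 < m" "\<And>x. m * (norm x)\<^sup>2 \<le> x \<bullet> M x"
    and H: "0 < h" "\<And>x. h * (norm x)\<^sup>2 \<le> x \<bullet> H x"
    and T: "\<And>u v. T u \<bullet> v = u \<bullet> T v" "0 < \<tau>" "\<And>w. \<tau> * (norm w)\<^sup>2 \<le> w \<bullet> T w"
    and BC: "\<And>w x. w \<in> K \<Longrightarrow> T w \<bullet> C x = B w \<bullet> x"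
    and b: "0 < b" "\<And>w. w \<in> K \<Longrightarrow> b * norm w \<le> norm (B w)"
  obtains P a c where "linear P" "\<And>u v. P u \<bullet> v = u \<bullet> P v"
    "0 < c" "\<And>v. c * (norm v)\<^sup>2 \<le> v \<bullet> P v" "0 < a"
    "\<And>x w x'. w \<in> K \<Longrightarrow> M x' = - (H x + B w)
       \<Longrightarrow> P (x, w) \<bullet> (x', C x) \<le> - a * (norm (x, w))\<^sup>2"
proof -
  obtain \<beta> where \<beta>: "0 < \<beta>" "\<And>w. norm (B w) \<le> \<beta> * norm w"
    using linear_bounded_pos[OF lin(3)] by blast
  obtain \<nu> where \<nu>: "0 < \<nu>" "\<And>x. norm (M x) \<le> \<nu> * norm x"
    using linear_bounded_pos[OF lin(1)] by blast
  obtain \<eta> where \<eta>: "0 < \<eta>" "\<And>x. norm (H x) \<le> \<eta> * norm x"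
    using linear_bounded_pos[OF lin(2)] by blast
  obtain \<gamma> where \<gamma>: "0 < \<gamma>" "\<And>x. norm (C x) \<le> \<gamma> * norm x"
    using linear_bounded_pos[OF lin(4)] by blast
  \<comment> \<open>Here \<open>k1\<close> bounds \<open>B w \<bullet> H x\<close>,
    \<open>k2\<close> bounds \<open>M x \<bullet> B (C x)\<close> and \<open>k3\<close> bounds
    \<open>B w \<bullet> M x\<close>. The second summand of \<open>k4\<close> is what Young's
    inequality charges to \<open>norm x\<close> when half of
    \<open>b\<^sup>2 * (norm w)\<^sup>2\<close> absorbs the \<open>k1\<close> term.\<close>
  define k1 where "k1 = \<beta> * \<eta>"
  define k2 where "k2 = \<nu> * (\<beta> * \<gamma>)"
  define k3 where "k3 = \<beta> * \<nu>"
  define k4 where "k4 = k2 + k1\<^sup>2 / (2 * b\<^sup>2)"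
  have k: "0 < k1" "0 < k2" "0 < k3" using \<beta> \<nu> \<eta> \<gamma> by (auto simp: k1_def k2_def k3_def)
  have k4: "0 < k4" unfolding k4_def using k b by (intro add_pos_nonneg) auto
  \<comment> \<open>The first two entries leave half of \<open>m\<close> and half of
    \<open>\<tau>\<close> once the cross term is subtracted, which makes the form positive definite;
    the third leaves half of \<open>h\<close> in the decrease.\<close>
  define \<epsilon> where "\<epsilon> = min (min (m / (2 * k3)) (\<tau> / (2 * k3))) (h / (2 * k4))"
  have \<epsilon>: "0 < \<epsilon>" using M(2) T(2) H(1) k k4 by (simp add: \<epsilon>_def)
  have "\<epsilon> \<le> m / (2 * k3)" "\<epsilon> \<le> \<tau> / (2 * k3)" "\<epsilon> \<le> h / (2 * k4)" by (auto simp: \<epsilon>_def)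
  then have \<epsilon>3: "\<epsilon> * k3 \<le> m / 2" "\<epsilon> * k3 \<le> \<tau> / 2" "\<epsilon> * k4 \<le> h / 2"
    using k k4 by (simp_all add: pos_le_divide_eq mult.commute)
  define B' where "B' = adjoint B"
  have B': "linear B'" "\<And>w x. w \<bullet> B' x = B w \<bullet> x" "\<And>w x. B' x \<bullet> w = x \<bullet> B w"
    using adjoint_linear[OF lin(3)] adjoint_works[OF lin(3)]
    by (simp_all add: B'_def inner_commute)
  \<comment> \<open>The cross term is shared equally between the two components; the adjoint
    \<open>B'\<close> makes the operator symmetric.\<close>
  define P where "P = (\<lambda>v. (M (fst v) + \<epsilon> *\<^sub>R M (B (snd v)), T (snd v) + \<epsilon> *\<^sub>R B' (M (fst v))))"
  have cross: "\<bar>B w \<bullet> M x\<bar> \<le> k3 * (norm x * norm w)" for x w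
  proof -
    have "\<bar>B w \<bullet> M x\<bar> \<le> norm (B w) * norm (M x)" by (rule Cauchy_Schwarz_ineq2)
    also have "\<dots> \<le> (\<beta> * norm w) * (\<nu> * norm x)"
      by (intro mult_mono \<beta> \<nu>) (use \<beta> in auto)
    finally show ?thesis by (simp add: k3_def mult.commute mult.left_commute)
  qed
  show thesis
  proof (rule that)
    show "linear P"
      unfolding P_def using lin B'
      by (intro linearI) (simp_all add: linear_add linear_scale scaleR_add_right mult.commute)
    show "P u \<bullet> v = u \<bullet> P v" for u v
      by (cases u; cases v) (simp add: P_def inner_add_left inner_add_right B' M(1) T(1))
    show "min m \<tau> / 2 * (norm v)\<^sup>2 \<le> v \<bullet> P v" for v
    proof -
      obtain x w where v: "v = (x, w)" by (cases v)
      have "v \<bullet> P v = x \<bullet> M x + w \<bullet> T w + 2 * (\<epsilon> * (B w \<bullet> M x))"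
        using M(1)[of x "B w"] by (simp add: v P_def inner_add_right B' inner_commute)
      moreover have "- (\<epsilon> * k3 * (norm x * norm w)) \<le> \<epsilon> * (B w \<bullet> M x)"
      proof -
        have "\<epsilon> * (- (B w \<bullet> M x)) \<le> \<epsilon> * (k3 * (norm x * norm w))"
          using cross[of w x] \<epsilon> by (intro mult_left_mono) auto
        then show ?thesis by simp
      qed
      moreover have "2 * (\<epsilon> * k3 * (norm x * norm w)) \<le> \<epsilon> * k3 * (norm x)\<^sup>2 + \<epsilon> * k3 * (norm w)\<^sup>2"
      proof -
        have "2 * (norm x * norm w) \<le> (norm x)\<^sup>2 + (norm w)\<^sup>2"
          using sum_squares_bound[of "norm x" "norm w"] by simp
        then have "\<epsilon> * k3 * (2 * (norm x * norm w)) \<le> \<epsilon> * k3 * ((norm x)\<^sup>2 + (norm w)\<^sup>2)"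
          using \<epsilon> k by (intro mult_left_mono) auto
        then show ?thesis by (simp add: distrib_left)
      qed
      moreover have "\<epsilon> * k3 * (norm x)\<^sup>2 \<le> m / 2 * (norm x)\<^sup>2" "\<epsilon> * k3 * (norm w)\<^sup>2 \<le> \<tau> / 2 * (norm w)\<^sup>2"
        by (intro mult_right_mono \<epsilon>3; simp)+
      moreover have "min m \<tau> / 2 * (norm x)\<^sup>2 \<le> m / 2 * (norm x)\<^sup>2" "min m \<tau> / 2 * (norm w)\<^sup>2 \<le> \<tau> / 2 * (norm w)\<^sup>2"
        by (intro mult_right_mono; simp)+
      moreover have "min m \<tau> / 2 * (norm v)\<^sup>2 = min m \<tau> / 2 * (norm x)\<^sup>2 + min m \<tau> / 2 * (norm w)\<^sup>2"
        unfolding v norm_Pair by (subst real_sqrt_pow2) (simp_all only: distrib_left, simp)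
      moreover note M(3)[of x] T(3)[of w]
      ultimately show ?thesis by linarith
    qed
    show "P (x, w) \<bullet> (x', C x) \<le> - min (h / 2) (\<epsilon> * b\<^sup>2 / 2) * (norm (x, w))\<^sup>2"
      if w: "w \<in> K" and x': "M x' = - (H x + B w)" for x w x'
    proof -
      have "P (x, w) \<bullet> (x', C x) = M x \<bullet> x' + \<epsilon> * (M (B w) \<bullet> x') + T w \<bullet> C x + \<epsilon> * (M x \<bullet> B (C x))"
        by (simp add: P_def inner_add_left B')
      also have "\<dots> = x \<bullet> M x' + \<epsilon> * (B w \<bullet> M x') + B w \<bullet> x + \<epsilon> * (M x \<bullet> B (C x))"
        by (simp only: M(1) BC[OF w])
      also have "x \<bullet> M x' = - (x \<bullet> H x) - B w \<bullet> x"
        by (simp add: x' inner_diff_right inner_commute)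
      also have "B w \<bullet> M x' = - (B w \<bullet> H x) - (norm (B w))\<^sup>2"
        by (simp add: x' inner_diff_right power2_norm_eq_inner)
      finally have eq: "P (x, w) \<bullet> (x', C x) =
          - (x \<bullet> H x) - \<epsilon> * (B w \<bullet> H x) - \<epsilon> * (norm (B w))\<^sup>2 + \<epsilon> * (M x \<bullet> B (C x))"
        by (simp add: right_diff_distrib)
      have 1: "- (\<epsilon> * (B w \<bullet> H x)) \<le> \<epsilon> * (k1 * (norm x * norm w))"
      proof -
        have "- (B w \<bullet> H x) \<le> norm (B w) * norm (H x)" using Cauchy_Schwarz_ineq2[of "B w" "H x"] by linarith
        also have "\<dots> \<le> (\<beta> * norm w) * (\<eta> * norm x)"
          by (intro mult_mono \<beta> \<eta>) (use \<beta> in auto)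
        also have "\<dots> = k1 * (norm x * norm w)" by (simp add: k1_def mult.commute mult.left_commute)
        finally have "\<epsilon> * (- (B w \<bullet> H x)) \<le> \<epsilon> * (k1 * (norm x * norm w))"
          using \<epsilon> by (intro mult_left_mono) auto
        then show ?thesis by simp
      qed
      have 2: "\<epsilon> * (M x \<bullet> B (C x)) \<le> \<epsilon> * (k2 * (norm x)\<^sup>2)"
      proof -
        have "M x \<bullet> B (C x) \<le> norm (M x) * norm (B (C x))" by (rule norm_cauchy_schwarz)
        also have "\<dots> \<le> (\<nu> * norm x) * (\<beta> * (\<gamma> * norm x))"
        proof (intro mult_mono \<nu>)
          have "norm (B (C x)) \<le> \<beta> * norm (C x)" by (rule \<beta>)
          also have "\<dots> \<le> \<beta> * (\<gamma> * norm x)" using \<beta> by (intro mult_left_mono \<gamma>) auto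
          finally show "norm (B (C x)) \<le> \<beta> * (\<gamma> * norm x)" .
        qed (use \<nu> in auto)
        also have "\<dots> = k2 * (norm x)\<^sup>2"
          by (simp add: k2_def power2_eq_square mult.commute mult.left_commute)
        finally show ?thesis using \<epsilon> by (intro mult_left_mono) auto
      qed
      have 3: "\<epsilon> * (b\<^sup>2 * (norm w)\<^sup>2) \<le> \<epsilon> * (norm (B w))\<^sup>2"
      proof -
        have "(b * norm w)\<^sup>2 \<le> (norm (B w))\<^sup>2" using b w by (intro power_mono) auto
        then show ?thesis using \<epsilon> by (intro mult_left_mono) (auto simp: power_mult_distrib)
      qed
      \<comment> \<open>Young's inequality for the product of \<open>b * norm w\<close> and
        \<open>k1 / b * norm x\<close>.\<close>
      have 4: "\<epsilon> * (k1 * (norm x * norm w)) \<le> \<epsilon> * (b\<^sup>2 / 2 * (norm w)\<^sup>2 + k1\<^sup>2 / (2 * b\<^sup>2) * (norm x)\<^sup>2)"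
      proof -
        have "2 * (b * norm w) * (k1 / b * norm x) \<le> (b * norm w)\<^sup>2 + (k1 / b * norm x)\<^sup>2"
          by (rule sum_squares_bound)
        moreover have "2 * (b * norm w) * (k1 / b * norm x) = 2 * (k1 * (norm x * norm w))"
          using b(1) by simp
        ultimately have "k1 * (norm x * norm w) \<le> b\<^sup>2 / 2 * (norm w)\<^sup>2 + k1\<^sup>2 / (2 * b\<^sup>2) * (norm x)\<^sup>2"
          by (simp add: power_mult_distrib power_divide)
        then show ?thesis using \<epsilon> by (intro mult_left_mono) auto
      qed
      have 5: "\<epsilon> * (k2 * (norm x)\<^sup>2) + \<epsilon> * (k1\<^sup>2 / (2 * b\<^sup>2) * (norm x)\<^sup>2) \<le> h / 2 * (norm x)\<^sup>2"
      proof -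
        have "\<epsilon> * k4 * (norm x)\<^sup>2 \<le> h / 2 * (norm x)\<^sup>2" by (intro mult_right_mono \<epsilon>3) simp
        moreover have "\<epsilon> * k4 * (norm x)\<^sup>2 = \<epsilon> * (k2 * (norm x)\<^sup>2) + \<epsilon> * (k1\<^sup>2 / (2 * b\<^sup>2) * (norm x)\<^sup>2)"
          unfolding k4_def by (simp only: distrib_left distrib_right mult.assoc)
        ultimately show ?thesis by simp
      qed
      define d where "d = min (h / 2) (\<epsilon> * b\<^sup>2 / 2)"
      have d: "d * (norm (x, w))\<^sup>2 = d * (norm x)\<^sup>2 + d * (norm w)\<^sup>2"
        unfolding norm_Pair by (subst real_sqrt_pow2) (simp_all only: distrib_left, simp)
      have 6: "d * (norm x)\<^sup>2 \<le> h / 2 * (norm x)\<^sup>2"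
        by (intro mult_right_mono) (simp_all add: d_def)
      have 7: "d * (norm w)\<^sup>2 \<le> \<epsilon> * (b\<^sup>2 * (norm w)\<^sup>2) / 2"
      proof -
        have "d * (norm w)\<^sup>2 \<le> \<epsilon> * b\<^sup>2 / 2 * (norm w)\<^sup>2" by (intro mult_right_mono) (simp_all add: d_def)
        then show ?thesis by (simp add: mult.assoc)
      qed
      have 8: "\<epsilon> * (k1 * (norm x * norm w)) \<le>
          \<epsilon> * (b\<^sup>2 * (norm w)\<^sup>2) / 2 + \<epsilon> * (k1\<^sup>2 / (2 * b\<^sup>2) * (norm x)\<^sup>2)"
        using 4 by (simp add: distrib_left)
      \<comment> \<open>With squares and products replaced by plain real variables the final
        bookkeeping is linear.\<close>
      have combine: "- g + c1 - n + c2 \<le> - (d1 + d2)"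
        if "c1 \<le> e1" "c2 \<le> e2" "p \<le> n" "e1 \<le> p / 2 + q" "e2 + q \<le> g1" "2 * g1 \<le> g" "d1 \<le> g1" "d2 \<le> p / 2"
        for g c1 n c2 d1 d2 e1 e2 p q g1 :: real using that by linarith
      have "2 * (h / 2 * (norm x)\<^sup>2) \<le> x \<bullet> H x" using H(2)[of x] by simp
      from combine[OF 1 2 3 8 5 this 6 7]
      show ?thesis unfolding eq d_def[symmetric] by (simp add: d)
    qed
  qed (use M(2) T(2) H(1) \<epsilon> b(1) in auto)
qed


section \<open>Stability of nonlinear saddle point systems\<close>

text \<open>Pair \<open>A (a - b) = (u - v) - (A b - A' b)\<close> with \<open>a - b\<close> and use
  the coercivity of \<open>A\<close>. This is the Lipschitz estimate for a point-dependent inverse: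
  operator and right-hand side may change together.\<close>

lemma inverse_perturbation:
  fixes A A' :: "'a::real_inner \<Rightarrow> 'a"
  assumes lin: "linear A" and \<mu>: "0 < \<mu>" "\<And>v. \<mu> * (norm v)\<^sup>2 \<le> v \<bullet> A v"
    and a: "A a = u" and b: "A' b = v" and \<delta>: "norm (A b - A' b) \<le> \<delta> * norm b"
  shows "norm (a - b) \<le> (norm (u - v) + \<delta> * norm b) / \<mu>"
proof (cases "a = b")
  case True
  have "0 \<le> \<delta> * norm b" using \<delta> norm_ge_zero order_trans by blast
  then show ?thesis using True \<mu>(1) by simp
next
  case False
  have "A (a - b) = (u - v) - (A b - A' b)" by (simp add: linear_diff[OF lin] a b)
  then have "\<mu> * (norm (a - b))\<^sup>2 \<le> (a - b) \<bullet> ((u - v) - (A b - A' b))"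
    using \<mu>(2)[of "a - b"] by simp
  also have "\<dots> \<le> norm (a - b) * norm ((u - v) - (A b - A' b))" by (rule norm_cauchy_schwarz)
  also have "\<dots> \<le> norm (a - b) * (norm (u - v) + \<delta> * norm b)"
    using norm_triangle_ineq4[of "u - v" "A b - A' b"] \<delta> by (intro mult_left_mono) auto
  finally have "norm (a - b) * (\<mu> * norm (a - b)) \<le> norm (a - b) * (norm (u - v) + \<delta> * norm b)"
    by (simp add: power2_eq_square mult.left_commute)
  then have "\<mu> * norm (a - b) \<le> norm (u - v) + \<delta> * norm b" using False by simp
  then show ?thesis using \<mu>(1) by (simp add: pos_le_divide_eq mult.commute)
qed

lemma norm_fst_snd_le: "norm (fst v) \<le> norm v" "norm (snd v) \<le> norm v"
  by (simp_all add: norm_fst_le[of "fst v" "snd v", simplified] norm_snd_le[of "snd v" "fst v", simplified])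

lemma subspace_snd: "subspace K \<Longrightarrow> subspace {v. snd v \<in> K}"
  by (auto simp: subspace_def)

text \<open>Up to sign the first velocity is the solution \<open>p\<close> of
  \<open>M x p = g x + B w\<close>. Comparing these equations at two states gives the Lipschitz
  bound; comparing one state with the linear equation for \<open>M 0\<close> gives the derivative.
  Freezing \<open>M x\<close> at \<open>M 0\<close> costs the product of \<open>norm x\<close> and
  the norm of the linearised velocity, which is of second order.\<close>

lemma implicit_saddle_system_stable:
  fixes M :: "'a::euclidean_space \<Rightarrow> 'a \<Rightarrow> 'a" and B :: "'b::euclidean_space \<Rightarrow> 'a"
    and C :: "'a \<Rightarrow> 'b"
  assumes r: "0 < r" and K: "subspace K"
    and M: "\<And>x. x \<in> cball 0 r \<Longrightarrow> linear (M x)" "0 < m"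
      "\<And>x v. x \<in> cball 0 r \<Longrightarrow> m * (norm v)\<^sup>2 \<le> v \<bullet> M x v"
      "\<And>x y v. x \<in> cball 0 r \<Longrightarrow> y \<in> cball 0 r \<Longrightarrow> norm (M x v - M y v) \<le> k * norm (x - y) * norm v"
      "\<And>u v. M 0 u \<bullet> v = u \<bullet> M 0 v"
    and N: "\<And>x v. x \<in> cball 0 r \<Longrightarrow> M x (N x v) = v" and N0: "linear (N 0)"
    and g: "l-lipschitz_on (cball 0 r) g" "g 0 = 0" "(g has_derivative H) (at 0)"
    and H: "0 < h" "\<And>x. h * (norm x)\<^sup>2 \<le> x \<bullet> H x"
    and BC: "linear B" "linear C" "\<And>w x. w \<in> K \<Longrightarrow> w \<bullet> C x = B w \<bullet> x" "\<And>x. C x \<in> K"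
    and b: "0 < b" "\<And>w. w \<in> K \<Longrightarrow> b * norm w \<le> norm (B w)"
  defines "F \<equiv> \<lambda>v. (- N (fst v) (g (fst v) + B (snd v)), C (fst v))"
  shows "locally_exp_stable (\<lambda>J v. \<forall>t\<in>J. v t \<in> {v. snd v \<in> K} \<and>
      (v has_vector_derivative F (v t)) (at t within J)) {v. snd v \<in> K} 0"
proof -
  have linH: "linear H" by (rule has_derivative_linear[OF g(3)])
  have zero: "0 \<in> cball 0 r" using r by simp
  have one: "1 * (norm w)\<^sup>2 \<le> w \<bullet> w" for w :: 'b by (simp add: power2_norm_eq_inner)
  obtain P a c where P: "linear P" "\<And>u v. P u \<bullet> v = u \<bullet> P v"
    "0 < c" "\<And>v. c * (norm v)\<^sup>2 \<le> v \<bullet> P v" "0 < a"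
    "\<And>x w x'. w \<in> K \<Longrightarrow> M 0 x' = - (H x + B w) \<Longrightarrow> P (x, w) \<bullet> (x', C x) \<le> - a * (norm (x, w))\<^sup>2"
    by (rule saddle_point_lyapunov[where K = K and T = "\<lambda>w. w" and \<tau> = 1, OF M(1)[OF zero] linH BC(1,2)
          linear_ident M(5,2) M(3)[OF zero] H refl zero_less_one one BC(3) b]) (assumption | rule that)+
  have l: "0 \<le> l" by (rule lipschitz_on_nonneg[OF g(1)])
  obtain \<beta> where \<beta>: "0 < \<beta>" "\<And>w. norm (B w) \<le> \<beta> * norm w"
    using linear_bounded_pos[OF BC(1)] by blast
  obtain \<gamma> where \<gamma>: "0 < \<gamma>" "\<And>x. norm (C x) \<le> \<gamma> * norm x"
    using linear_bounded_pos[OF BC(2)] by blast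
  define G where "G = (\<lambda>v. (- N 0 (H (fst v) + B (snd v)), C (fst v)))"
  have linG1: "linear (\<lambda>v. N 0 (H (fst v) + B (snd v)))"
  proof (rule linearI)
    show "N 0 (H (fst (u + v)) + B (snd (u + v))) = N 0 (H (fst u) + B (snd u)) + N 0 (H (fst v) + B (snd v))" for u v
      using linear_add[OF N0, of "H (fst u) + B (snd u)" "H (fst v) + B (snd v)"]
      by (simp add: linear_add[OF linH] linear_add[OF BC(1)] add.assoc add.left_commute)
    show "N 0 (H (fst (s *\<^sub>R v)) + B (snd (s *\<^sub>R v))) = s *\<^sub>R N 0 (H (fst v) + B (snd v))" for s v
      by (simp add: linear_scale[OF linH] linear_scale[OF BC(1)] linear_scale[OF N0] scaleR_add_right[symmetric])
  qed
  \<comment> \<open>The hypothesis does not fix the sign of \<open>k\<close>, while the monotonicity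
    arguments below need a nonnegative factor.\<close>
  define k' where "k' = \<bar>k\<bar>"
  have k': "norm (M x v - M y v) \<le> k' * norm (x - y) * norm v"
    if "x \<in> cball 0 r" "y \<in> cball 0 r" for x y v
  proof -
    have "norm (M x v - M y v) \<le> k * norm (x - y) * norm v" using that by (rule M(4))
    also have "\<dots> \<le> k' * norm (x - y) * norm v"
      unfolding k'_def by (intro mult_right_mono) auto
    finally show ?thesis .
  qed
  have k'0: "0 \<le> k'" by (simp add: k'_def)
  have perturb: "norm (N x u - N y v) \<le> (norm (u - v) + k' * norm (x - y) * norm (N y v)) / m"
    if "x \<in> cball 0 r" "y \<in> cball 0 r" for x y u v
    by (rule inverse_perturbation[where A = "M x" and A' = "M y" and a = "N x u" and b = "N y v" and \<delta> = "k' * norm (x - y)", OF M(1)[OF that(1)] M(2) M(3)[OF that(1)] N[OF that(1)] N[OF that(2)] k'[OF that]])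
  define p where "p = (\<lambda>v. N (fst v) (g (fst v) + B (snd v)))"
  have in_ball: "fst v \<in> cball 0 r" if "v \<in> cball 0 r" for v :: "'a \<times> 'b"
    using that norm_fst_snd_le(1)[of v] by simp
  have N00: "N x 0 = 0" if "x \<in> cball 0 r" for x
  proof -
    have "m * (norm (N x 0))\<^sup>2 \<le> 0" using M(3)[OF that, of "N x 0"] N[OF that, of 0] by simp
    then show ?thesis using M(2) by (simp add: mult_le_0_iff)
  qed
  have gle: "norm (g x) \<le> l * norm x" if "x \<in> cball 0 r" for x
    using lipschitz_on_normD[OF g(1) that zero] g(2) by simp
  \<comment> \<open>In \<open>perturb\<close> the change of the operator is weighted by the size of
    the solution, so a uniform bound for \<open>p\<close> has to precede the Lipschitz
    estimate.\<close>
  have p_bound: "norm (p v) \<le> (l + \<beta>) * r / m" if v: "v \<in> cball 0 r" for v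
  proof -
    have "norm (N (fst v) (g (fst v) + B (snd v)) - N (fst v) 0) \<le>
        (norm (g (fst v) + B (snd v) - 0) + k' * norm (fst v - fst v) * norm (N (fst v) 0)) / m"
      by (rule perturb[OF in_ball[OF v] in_ball[OF v]])
    then have "norm (p v) \<le> norm (g (fst v) + B (snd v)) / m"
      by (simp add: p_def N00[OF in_ball[OF v]])
    also have "\<dots> \<le> (l + \<beta>) * r / m"
    proof (rule divide_right_mono)
      have "norm (g (fst v) + B (snd v)) \<le> l * norm (fst v) + \<beta> * norm (snd v)"
        using norm_triangle_ineq[of "g (fst v)" "B (snd v)"] gle[OF in_ball[OF v]] \<beta>(2)[of "snd v"] by linarith
      also have "\<dots> \<le> l * r + \<beta> * r"
        using norm_fst_snd_le[of v] v l \<beta> by (intro add_mono mult_left_mono) auto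
      finally show "norm (g (fst v) + B (snd v)) \<le> (l + \<beta>) * r" by (simp add: distrib_right)
    qed (use M(2) in simp)
    finally show ?thesis .
  qed
  define D where "D = (l + \<beta>) * r / m"
  have D0: "0 \<le> D" unfolding D_def using l \<beta> r M(2) by simp
  have p_lip: "norm (p u - p v) \<le> (l + \<beta> + k' * D) / m * norm (u - v)"
    if u: "u \<in> cball 0 r" and v: "v \<in> cball 0 r" for u v
  proof -
    have "norm (p u - p v) \<le> (norm ((g (fst u) + B (snd u)) - (g (fst v) + B (snd v)))
        + k' * norm (fst u - fst v) * norm (p v)) / m"
      unfolding p_def by (rule perturb[OF in_ball[OF u] in_ball[OF v]])
    also have "\<dots> \<le> ((l + \<beta>) * norm (u - v) + k' * norm (u - v) * D) / m"
    proof (intro divide_right_mono add_mono)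
      have "(g (fst u) + B (snd u)) - (g (fst v) + B (snd v)) = (g (fst u) - g (fst v)) + B (snd (u - v))"
        by (simp add: linear_diff[OF BC(1)])
      also have "norm \<dots> \<le> l * norm (fst u - fst v) + \<beta> * norm (snd (u - v))"
        by (intro norm_triangle_mono lipschitz_on_normD[OF g(1)] in_ball u v \<beta>)
      also have "\<dots> \<le> l * norm (u - v) + \<beta> * norm (u - v)"
        using norm_fst_snd_le[of "u - v"] l \<beta>(1) by (intro add_mono mult_left_mono) auto
      finally show "norm ((g (fst u) + B (snd u)) - (g (fst v) + B (snd v))) \<le> (l + \<beta>) * norm (u - v)"
        by (simp add: distrib_right)
      show "k' * norm (fst u - fst v) * norm (p v) \<le> k' * norm (u - v) * D"
        using norm_fst_snd_le(1)[of "u - v"] p_bound[OF v] k'0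
        by (intro mult_mono) (auto simp: D_def)
    qed (use M(2) in simp)
    also have "\<dots> = (l + \<beta> + k' * D) / m * norm (u - v)"
      by (simp add: distrib_left distrib_right mult.commute mult.left_commute)
    finally show ?thesis .
  qed
  show ?thesis
  proof (rule locally_exp_stable_linearization[OF subspace_snd[OF K] P(1-4) r, where G = G and a = a
        and l = "(l + \<beta> + k' * D) / m + \<gamma>"])
    show "((l + \<beta> + k' * D) / m + \<gamma>)-lipschitz_on (cball 0 r) F"
    proof (rule lipschitz_onI)
      fix u v :: "'a \<times> 'b" assume uv: "u \<in> cball 0 r" "v \<in> cball 0 r"
      have "norm (F u - F v) = norm (- (p u - p v), C (fst (u - v)))"
        by (simp add: F_def p_def linear_diff[OF BC(2)])
      also have "\<dots> \<le> norm (- (p u - p v)) + norm (C (fst (u - v)))" by (rule norm_Pair_le)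
      also have "\<dots> \<le> (l + \<beta> + k' * D) / m * norm (u - v) + \<gamma> * norm (u - v)"
      proof (rule add_mono)
        show "norm (- (p u - p v)) \<le> (l + \<beta> + k' * D) / m * norm (u - v)"
          unfolding norm_minus_cancel by (rule p_lip[OF uv])
        have "norm (C (fst (u - v))) \<le> \<gamma> * norm (fst (u - v))" by (rule \<gamma>)
        also have "\<dots> \<le> \<gamma> * norm (u - v)"
          using \<gamma>(1) by (intro mult_left_mono norm_fst_snd_le) auto
        finally show "norm (C (fst (u - v))) \<le> \<gamma> * norm (u - v)" .
      qed
      finally show "dist (F u) (F v) \<le> ((l + \<beta> + k' * D) / m + \<gamma>) * dist u v"
        by (simp only: dist_norm distrib_right)
    qed (use l \<beta> k'0 D0 M(2) \<gamma> in simp)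
    show "F v \<in> {v. snd v \<in> K}" for v by (simp add: F_def BC(4))
    show "F 0 = 0"
      by (simp add: F_def g(2) linear_0[OF BC(1)] linear_0[OF BC(2)] N00[OF zero] zero_prod_def)
    have "(p has_derivative (\<lambda>v. N 0 (H (fst v) + B (snd v)))) (at 0)"
      unfolding has_derivative_at_alt
    proof (intro conjI allI impI)
      show "bounded_linear (\<lambda>v. N 0 (H (fst v) + B (snd v)))" using linG1 by (simp add: linear_linear)
      obtain \<nu> where \<nu>: "0 < \<nu>" "\<And>v. norm (N 0 (H (fst v) + B (snd v))) \<le> \<nu> * norm v"
        using linear_bounded_pos[OF linG1] by blast
      fix e :: real assume e: "0 < e"
      \<comment> \<open>There are two error sources, the remainder of \<open>g\<close> and the
        passage from \<open>M 0\<close> to \<open>M x\<close>. Each gets half of \<open>e\<close>;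
        the factor \<open>m\<close> offsets the division in \<open>perturb\<close>.\<close>
      define e' where "e' = e * m / 2"
      have e': "0 < e'" using e M(2) by (simp add: e'_def)
      obtain d where d: "0 < d" "\<And>x. norm (x - 0) < d \<Longrightarrow> norm (g x - g 0 - H (x - 0)) \<le> e' * norm (x - 0)"
        using g(3) e' unfolding has_derivative_at_alt by blast
      \<comment> \<open>The last entry ensures \<open>k' * \<nu> * norm v \<le> e'\<close>; the
        summand 1 avoids a zero denominator when \<open>k'\<close> is 0.\<close>
      define \<rho> where "\<rho> = min r (min d (e' / (k' * \<nu> + 1)))"
      have kn: "0 \<le> k' * \<nu>" using k'0 \<nu> by simp
      have \<rho>: "0 < \<rho>" using r d e' kn by (simp add: \<rho>_def add_nonneg_pos)
      have "norm (p v - p 0 - N 0 (H (fst (v - 0)) + B (snd (v - 0)))) \<le> e * norm (v - 0)"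
        if v: "norm (v - 0) < \<rho>" for v
      proof -
        have vb: "v \<in> cball 0 r" "norm (fst v - 0) < d" "norm v \<le> e' / (k' * \<nu> + 1)"
          using v norm_fst_snd_le(1)[of v] by (auto simp: \<rho>_def)
        have "norm (p v - N 0 (H (fst v) + B (snd v))) \<le>
            (norm ((g (fst v) + B (snd v)) - (H (fst v) + B (snd v)))
              + k' * norm (fst v - 0) * norm (N 0 (H (fst v) + B (snd v)))) / m"
          unfolding p_def by (rule perturb[OF in_ball[OF vb(1)] zero])
        also have "\<dots> \<le> (e' * norm v + e' * norm v) / m"
        proof (intro divide_right_mono add_mono)
          have "norm ((g (fst v) + B (snd v)) - (H (fst v) + B (snd v))) \<le> e' * norm (fst v)"
            using d(2)[OF vb(2)] g(2) by simp
          also have "\<dots> \<le> e' * norm v" using e' by (intro mult_left_mono norm_fst_snd_le) auto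
          finally show "norm ((g (fst v) + B (snd v)) - (H (fst v) + B (snd v))) \<le> e' * norm v" .
          have "k' * norm (fst v - 0) * norm (N 0 (H (fst v) + B (snd v))) \<le> k' * norm v * (\<nu> * norm v)"
            using k'0 norm_fst_snd_le(1)[of v] by (intro mult_mono \<nu>) auto
          also have "\<dots> = (k' * \<nu>) * norm v * norm v" by (simp only: mult.commute mult.left_commute)
          also have "\<dots> \<le> e' * norm v"
          proof (rule mult_right_mono)
            have "(k' * \<nu>) * norm v \<le> (k' * \<nu> + 1) * norm v" by (intro mult_right_mono) auto
            also have "\<dots> \<le> (k' * \<nu> + 1) * (e' / (k' * \<nu> + 1))"
              using kn by (intro mult_left_mono vb(3)) auto
            also have "\<dots> = e'" using kn by simp
            finally show "(k' * \<nu>) * norm v \<le> e'" .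
          qed simp
          finally show "k' * norm (fst v - 0) * norm (N 0 (H (fst v) + B (snd v))) \<le> e' * norm v" .
        qed (use M(2) in simp)
        also have "\<dots> = e * norm v" using M(2) by (simp add: e'_def)
        finally show ?thesis by (simp add: p_def g(2) linear_0[OF BC(1)] N00[OF zero])
      qed
      then show "\<exists>d>0. \<forall>v. norm (v - 0) < d \<longrightarrow>
          norm (p v - p 0 - N 0 (H (fst (v - 0)) + B (snd (v - 0)))) \<le> e * norm (v - 0)"
        using \<rho> by blast
    qed
    moreover have "((\<lambda>v. C (fst v)) has_derivative (\<lambda>v. C (fst v))) (at (0 :: 'a \<times> 'b))"
      using BC(2) by (intro bounded_linear_imp_has_derivative bounded_linear_compose[OF _ bounded_linear_fst])
        (simp add: linear_linear)
    ultimately show "(F has_derivative G) (at 0)"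
      unfolding F_def G_def p_def by (intro has_derivative_Pair has_derivative_minus)
    show "P v \<bullet> G v \<le> - a * (norm v)\<^sup>2" if "v \<in> {v. snd v \<in> K}" for v
    proof -
      have "M 0 (- N 0 (H (fst v) + B (snd v))) = - (H (fst v) + B (snd v))"
        using linear_neg[OF M(1)[OF zero]] N[OF zero] by simp
      then show ?thesis using P(6)[of "snd v" _ "fst v"] that by (simp add: G_def)
    qed
  qed (rule P(5))
qed

text \<open>In the linearisation put x = N \<zeta> for the dual variable \<zeta>. Then \<zeta>' = -
  (H (N \<zeta>) + w) reads M x' = - (H x + w), a saddle point system in which B is the identity.
  Its operator \<open>P\<close> is pulled back along \<open>N2\<close>, which applies
  \<open>N\<close> to the first component; the result \<open>N2 P N2\<close> is symmetric because
  \<open>N\<close> inherits symmetry from \<open>M\<close>.\<close>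

lemma mirrored_saddle_system_stable:
  fixes M N :: "'a::euclidean_space \<Rightarrow> 'a" and C T :: "'a \<Rightarrow> 'a"
  assumes r: "0 < r" and K: "subspace K"
    and M: "linear M" "\<And>u v. M u \<bullet> v = u \<bullet> M v" "0 < m" "\<And>v. m * (norm v)\<^sup>2 \<le> v \<bullet> M v"
    and N: "linear N" "\<And>v. M (N v) = v"
    and g: "l-lipschitz_on (cball 0 r) g" "g 0 = 0" "(g has_derivative (\<lambda>v. H (N v))) (at 0)"
    and q: "l'-lipschitz_on (cball 0 r) q" "q 0 = 0" "(q has_derivative N) (at 0)"
    and H: "linear H" "0 < h" "\<And>x. h * (norm x)\<^sup>2 \<le> x \<bullet> H x"
    and T: "linear T" "\<And>u v. T u \<bullet> v = u \<bullet> T v" "0 < \<tau>" "\<And>w. \<tau> * (norm w)\<^sup>2 \<le> w \<bullet> T w"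
    and C: "linear C" "\<And>w x. w \<in> K \<Longrightarrow> T w \<bullet> C x = w \<bullet> x" "\<And>x. C x \<in> K"
  defines "F \<equiv> \<lambda>v. (- (g (fst v) + snd v), C (q (fst v)))"
  shows "locally_exp_stable (\<lambda>J v. \<forall>t\<in>J. v t \<in> {v. snd v \<in> K} \<and>
      (v has_vector_derivative F (v t)) (at t within J)) {v. snd v \<in> K} 0"
proof -
  have one: "1 * norm w \<le> norm w" for w :: 'a by simp
  obtain P a c where P: "linear P" "\<And>u v. P u \<bullet> v = u \<bullet> P v"
    "0 < c" "\<And>v. c * (norm v)\<^sup>2 \<le> v \<bullet> P v" "0 < a"
    "\<And>x w x'. w \<in> K \<Longrightarrow> M x' = - (H x + w) \<Longrightarrow> P (x, w) \<bullet> (x', C x) \<le> - a * (norm (x, w))\<^sup>2"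
    by (rule saddle_point_lyapunov[where K = K and B = "\<lambda>w. w" and b = 1, OF M(1) H(1) linear_ident C(1) T(1)
          M(2-4) H(2,3) T(2-4) C(2) zero_less_one one]) (assumption | rule that)+
  have symN: "N u \<bullet> v = u \<bullet> N v" for u v
    using M(2)[of "N u" "N v"] by (simp add: N(2))
  define N2 where "N2 = (\<lambda>v::'a \<times> 'a. (N (fst v), snd v))"
  define P2 where "P2 = (\<lambda>v. N2 (P (N2 v)))"
  have linN2: "linear N2"
    unfolding N2_def by (rule linearI) (simp_all add: linear_add[OF N(1)] linear_scale[OF N(1)])
  have symN2: "N2 u \<bullet> v = u \<bullet> N2 v" for u v
    by (cases u; cases v) (simp add: N2_def symN)
  obtain \<nu> where \<nu>: "0 < \<nu>" "\<And>x. norm (M x) \<le> \<nu> * norm x"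
    using linear_bounded_pos[OF M(1)] by blast
  \<comment> \<open>Since \<open>M (N x) = x\<close>, the norm of \<open>x\<close> is at most
    \<open>\<nu> * norm (N x)\<close>; the summand 1 covers the second component.\<close>
  define \<alpha> where "\<alpha> = \<nu>\<^sup>2 + 1"
  have \<alpha>: "0 < \<alpha>" by (simp add: \<alpha>_def add_nonneg_pos)
  have N2_below: "(norm v)\<^sup>2 \<le> \<alpha> * (norm (N2 v))\<^sup>2" for v
  proof -
    obtain x w where v: "v = (x, w)" by (cases v)
    have "(norm x)\<^sup>2 \<le> (\<nu> * norm (N x))\<^sup>2"
      using \<nu>(2)[of "N x"] by (intro power_mono) (simp_all add: N(2))
    moreover have "(norm x)\<^sup>2 + (norm w)\<^sup>2 = (norm v)\<^sup>2"
      unfolding v norm_Pair by (subst real_sqrt_pow2) simp_all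
    moreover have "(norm (N x))\<^sup>2 + (norm w)\<^sup>2 = (norm (N2 v))\<^sup>2"
      unfolding v N2_def norm_Pair by (subst real_sqrt_pow2) simp_all
    moreover have "(\<nu> * norm (N x))\<^sup>2 + (norm w)\<^sup>2 \<le> \<alpha> * ((norm (N x))\<^sup>2 + (norm w)\<^sup>2)"
      by (simp add: \<alpha>_def power_mult_distrib distrib_left distrib_right)
    ultimately show ?thesis by simp
  qed
  have scale: "s / \<alpha> * (norm v)\<^sup>2 \<le> s * (norm (N2 v))\<^sup>2" if "0 < s" for s v
  proof -
    have "s / \<alpha> * (norm v)\<^sup>2 \<le> s / \<alpha> * (\<alpha> * (norm (N2 v))\<^sup>2)"
      using that \<alpha> by (intro mult_left_mono N2_below) auto
    then show ?thesis using \<alpha> by simp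
  qed
  obtain \<gamma> where \<gamma>: "0 < \<gamma>" "\<And>x. norm (C x) \<le> \<gamma> * norm x"
    using linear_bounded_pos[OF C(1)] by blast
  have l: "0 \<le> l" "0 \<le> l'" by (rule lipschitz_on_nonneg[OF g(1)] lipschitz_on_nonneg[OF q(1)])+
  define G where "G = (\<lambda>v. (- (H (N (fst v)) + snd v), C (N (fst v))))"
  show ?thesis
  proof (rule locally_exp_stable_linearization[OF subspace_snd[OF K] _ _ _ _ r, where G = G and a = "a / \<alpha>"
        and P = P2 and l = "l + 1 + \<gamma> * l'" and ?c1.0 = "c / \<alpha>"])
    show "linear P2"
      using linear_compose[OF linear_compose[OF linN2 P(1)] linN2] by (simp add: P2_def comp_def)
    show "P2 u \<bullet> v = u \<bullet> P2 v" for u v by (simp add: P2_def symN2 P(2))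
    show "c / \<alpha> * (norm v)\<^sup>2 \<le> v \<bullet> P2 v" for v
    proof -
      have "c * (norm (N2 v))\<^sup>2 \<le> N2 v \<bullet> P (N2 v)" by (rule P(4))
      then show ?thesis using scale[OF P(3), of v] by (simp add: P2_def symN2)
    qed
    show "0 < c / \<alpha>" "0 < a / \<alpha>" using P(3,5) \<alpha> by auto
    show "(l + 1 + \<gamma> * l')-lipschitz_on (cball 0 r) F"
    proof (rule lipschitz_onI)
      fix u v :: "'a \<times> 'a" assume "u \<in> cball 0 r" "v \<in> cball 0 r"
      then have uv: "fst u \<in> cball 0 r" "fst v \<in> cball 0 r"
        using norm_fst_snd_le(1)[of u] norm_fst_snd_le(1)[of v] by auto
      have "- (g (fst u) + snd u) - - (g (fst v) + snd v) = - ((g (fst u) - g (fst v)) + snd (u - v))"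
        by simp
      then have "norm (F u - F v) = norm (- ((g (fst u) - g (fst v)) + snd (u - v)), C (q (fst u) - q (fst v)))"
        by (simp only: F_def diff_Pair linear_diff[OF C(1)])
      also have "\<dots> \<le> norm (- ((g (fst u) - g (fst v)) + snd (u - v))) + norm (C (q (fst u) - q (fst v)))"
        by (rule norm_Pair_le)
      also have "\<dots> \<le> (l * norm (u - v) + norm (u - v)) + \<gamma> * (l' * norm (u - v))"
      proof (rule add_mono)
        have "norm ((g (fst u) - g (fst v)) + snd (u - v)) \<le> l * norm (fst u - fst v) + norm (u - v)"
          by (intro norm_triangle_mono lipschitz_on_normD[OF g(1) uv] norm_fst_snd_le)
        also have "\<dots> \<le> l * norm (u - v) + norm (u - v)"
          using norm_fst_snd_le(1)[of "u - v"] l by (intro add_mono mult_left_mono) auto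
        finally show "norm (- ((g (fst u) - g (fst v)) + snd (u - v))) \<le> l * norm (u - v) + norm (u - v)"
          unfolding norm_minus_cancel .
        have "norm (C (q (fst u) - q (fst v))) \<le> \<gamma> * norm (q (fst u) - q (fst v))" by (rule \<gamma>)
        also have "\<dots> \<le> \<gamma> * (l' * norm (fst u - fst v))"
          using \<gamma>(1) by (intro mult_left_mono lipschitz_on_normD[OF q(1) uv]) auto
        also have "\<dots> \<le> \<gamma> * (l' * norm (u - v))"
          using \<gamma>(1) l norm_fst_snd_le(1)[of "u - v"] by (intro mult_left_mono) auto
        finally show "norm (C (q (fst u) - q (fst v))) \<le> \<gamma> * (l' * norm (u - v))" .
      qed
      finally show "dist (F u) (F v) \<le> (l + 1 + \<gamma> * l') * dist u v"
        by (simp add: dist_norm distrib_right)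
    qed (use l \<gamma> in simp)
    show "F v \<in> {v. snd v \<in> K}" for v by (simp add: F_def C(3))
    show "F 0 = 0" by (simp add: F_def g(2) q(2) linear_0[OF C(1)] zero_prod_def)
    have fst0: "(fst has_derivative fst) (at (0 :: 'a \<times> 'a))"
      by (intro bounded_linear_imp_has_derivative bounded_linear_fst)
    have g': "((\<lambda>v. g (fst v)) has_derivative (\<lambda>v. H (N (fst v)))) (at (0 :: 'a \<times> 'a))"
      by (rule has_derivative_compose[OF fst0]) (simp add: g(3))
    have q': "((\<lambda>v. q (fst v)) has_derivative (\<lambda>v. N (fst v))) (at (0 :: 'a \<times> 'a))"
      by (rule has_derivative_compose[OF fst0]) (simp add: q(3))
    have C': "bounded_linear C" using C(1) by (simp add: linear_linear)
    show "(F has_derivative G) (at 0)"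
      unfolding F_def G_def
      by (intro has_derivative_Pair has_derivative_minus has_derivative_add g'
          bounded_linear.has_derivative[OF C' q'] bounded_linear_imp_has_derivative bounded_linear_snd)
    show "P2 v \<bullet> G v \<le> - (a / \<alpha>) * (norm v)\<^sup>2" if v: "v \<in> {v. snd v \<in> K}" for v
    proof -
      \<comment> \<open>Moving the outer \<open>N2\<close> to \<open>G v\<close> turns the dual
        velocity into \<open>x' = N (- (H x + w))\<close> with \<open>x = N (fst v)\<close>, and
        \<open>M x'\<close> is then the right-hand side required for \<open>P\<close>.\<close>
      have "P2 v \<bullet> G v = P (N2 v) \<bullet> (N (- (H (N (fst v)) + snd v)), C (N (fst v)))"
        by (simp add: P2_def symN2) (simp add: N2_def G_def)
      also have "\<dots> \<le> - a * (norm (N2 v))\<^sup>2"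
        using P(6)[of "snd v" "N (- (H (N (fst v)) + snd v))" "N (fst v)"] v
        by (simp add: N(2) N2_def)
      also have "\<dots> \<le> - (a / \<alpha>) * (norm v)\<^sup>2" using scale[OF P(5), of v] by simp
      finally show ?thesis .
    qed
  qed
qed


section \<open>Gradients, Hessians and conjugates of convex functions\<close>

text \<open>At interior points \<open>at x within S\<close> is the full neighbourhood filter, where
  derivatives are unique; this gives the definite description in \<open>gradient\<close> its
  value.\<close>

lemma gradient_eqI:
  fixes f :: "'a::euclidean_space \<Rightarrow> real"
  assumes x: "x \<in> interior S" and f: "(f has_derivative (\<lambda>h. h \<bullet> g)) (at x)"
  shows "gradient S f x = g"
  unfolding gradient_def
proof (rule the_equality)
  show "(f has_derivative (\<lambda>h. h \<bullet> g)) (at x within S)"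
    by (rule has_derivative_at_withinI[OF f])
  fix g' assume "(f has_derivative (\<lambda>h. h \<bullet> g')) (at x within S)"
  then have "(f has_derivative (\<lambda>h. h \<bullet> g')) (at x)"
    using at_within_interior[OF x] by simp
  then have "(\<lambda>h. h \<bullet> g') = (\<lambda>h. h \<bullet> g)" by (rule has_derivative_unique[OF _ f])
  then have "\<forall>h. h \<bullet> g' = h \<bullet> g" by metis
  then show "g' = g" by (simp only: vector_eq_ldot)
qed

lemma has_derivative_gradient:
  fixes f :: "'a::euclidean_space \<Rightarrow> real"
  assumes x: "x \<in> interior S" and f: "f differentiable_on S"
  shows "(f has_derivative (\<lambda>h. h \<bullet> gradient S f x)) (at x)"
proof -
  have "x \<in> S" using x interior_subset by auto
  then have "f differentiable (at x)"
    using f at_within_interior[OF x] by (auto simp: differentiable_on_def)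
  then obtain f' where f': "(f has_derivative f') (at x)" by (auto simp: differentiable_def)
  have lin: "linear f'" by (rule has_derivative_linear[OF f'])
  \<comment> \<open>The vector \<open>adjoint f' 1\<close> is the Riesz representative of the
    functional \<open>f'\<close>.\<close>
  have "f' = (\<lambda>h. h \<bullet> adjoint f' 1)"
    using adjoint_works[OF lin] by (simp add: fun_eq_iff)
  then have d: "(f has_derivative (\<lambda>h. h \<bullet> adjoint f' 1)) (at x)" using f' by simp
  then show ?thesis using gradient_eqI[OF x d] by simp
qed

text \<open>Divide the convexity inequality on the segment by \<open>t\<close> and let
  \<open>t\<close> tend to 0 from the right. The modulus may have any sign here, so the case
  \<open>\<mu> = 0\<close> serves plain convex functions.\<close>

lemma strongly_convex_first_order:
  fixes f :: "'a::real_inner \<Rightarrow> real"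
  assumes f: "\<And>t. t \<in> {0..1} \<Longrightarrow> f ((1 - t) *\<^sub>R x + t *\<^sub>R y)
      \<le> (1 - t) * f x + t * f y - \<mu> / 2 * t * (1 - t) * (norm (x - y))\<^sup>2"
    and g: "(f has_derivative (\<lambda>h. h \<bullet> g)) (at x)"
  shows "f x + (y - x) \<bullet> g + \<mu> / 2 * (norm (x - y))\<^sup>2 \<le> f y"
proof -
  define q where "q = (\<lambda>t. f (x + t *\<^sub>R (y - x)))"
  have "(q has_derivative (\<lambda>t. (t *\<^sub>R (y - x)) \<bullet> g)) (at 0 within {0<..1})"
    unfolding q_def
    by (rule has_derivative_compose[of "\<lambda>t. x + t *\<^sub>R (y - x)" "\<lambda>t. t *\<^sub>R (y - x)" 0 _ f])
      (use g in \<open>auto intro!: derivative_eq_intros\<close>)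
  moreover have "(\<lambda>t. (t *\<^sub>R (y - x)) \<bullet> g) = (*) ((y - x) \<bullet> g)" by (auto simp: mult.commute)
  ultimately have "(q has_real_derivative (y - x) \<bullet> g) (at 0 within {0<..1})"
    by (simp only: has_field_derivative_def)
  then have lim: "((\<lambda>t. (q t - q 0) / (t - 0)) \<longlongrightarrow> (y - x) \<bullet> g) (at 0 within {0<..1})"
    by (simp only: has_field_derivative_iff)
  have lim2: "((\<lambda>t. f y - f x - \<mu> / 2 * (1 - t) * (norm (x - y))\<^sup>2)
      \<longlongrightarrow> f y - f x - \<mu> / 2 * (1 - 0) * (norm (x - y))\<^sup>2) (at 0 within {0<..1})"
    by (intro tendsto_intros)
  have "(y - x) \<bullet> g \<le> f y - f x - \<mu> / 2 * (1 - 0) * (norm (x - y))\<^sup>2"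
  proof (rule tendsto_le[OF _ lim2 lim])
    have "at (0::real) within {0<..1} = at_right 0"
      by (rule at_within_nhd[of _ "{-1<..<1}"]) auto
    then show "at (0::real) within {0<..1} \<noteq> bot" by (simp add: trivial_limit_at_right_real)
    show "\<forall>\<^sub>F t in at 0 within {0<..1}.
        (q t - q 0) / (t - 0) \<le> f y - f x - \<mu> / 2 * (1 - t) * (norm (x - y))\<^sup>2"
      unfolding eventually_at_filter
    proof (rule always_eventually, intro allI impI)
      fix t :: real assume t: "t \<in> {0<..1}"
      have "x + t *\<^sub>R (y - x) = (1 - t) *\<^sub>R x + t *\<^sub>R y" by (simp add: algebra_simps)
      then have "q t - q 0 \<le> (1 - t) * f x + t * f y - \<mu> / 2 * t * (1 - t) * (norm (x - y))\<^sup>2 - f x"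
        using f[of t] t by (simp add: q_def)
      also have "\<dots> = t * (f y - f x - \<mu> / 2 * (1 - t) * (norm (x - y))\<^sup>2)"
        by (simp add: left_diff_distrib right_diff_distrib mult.commute mult.left_commute)
      finally show "(q t - q 0) / (t - 0) \<le> f y - f x - \<mu> / 2 * (1 - t) * (norm (x - y))\<^sup>2"
        using t by (simp add: pos_divide_le_eq mult.commute)
    qed
  qed
  then show ?thesis by simp
qed

text \<open>Monotonicity between \<open>x\<close> and \<open>x + t *\<^sub>R h\<close>, divided by
  \<open>t\<^sup>2\<close>, is the claim up to the differentiation error, which is smaller than any
  given \<open>e\<close>.\<close>

lemma strongly_monotone_derivative:
  fixes G :: "'a::real_inner \<Rightarrow> 'a"
  assumes r: "0 < r" and mono: "\<And>u. u \<in> ball x r \<Longrightarrow> \<mu> * (norm (u - x))\<^sup>2 \<le> (u - x) \<bullet> (G u - G x)"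
    and A: "(G has_derivative A) (at x)"
  shows "\<mu> * (norm h)\<^sup>2 \<le> h \<bullet> A h"
proof (cases "h = 0")
  case True
  then show ?thesis using linear_0[OF has_derivative_linear[OF A]] by simp
next
  case False
  have "\<mu> * (norm h)\<^sup>2 \<le> h \<bullet> A h + e" if e: "0 < e" for e :: real
  proof -
    define e' where "e' = e / (norm h)\<^sup>2"
    have e': "0 < e'" "e' * (norm h)\<^sup>2 = e" using e False by (auto simp: e'_def)
    obtain d where d: "0 < d" "\<And>u. norm (u - x) < d \<Longrightarrow> norm (G u - G x - A (u - x)) \<le> e' * norm (u - x)"
      using A e'(1) unfolding has_derivative_at_alt by blast
    define t where "t = min d r / (2 * norm h)"
    have t: "0 < t" using d r False by (simp add: t_def)
    have "norm (t *\<^sub>R h) = min d r / 2" using False d r by (simp add: t_def)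
    then have lt: "norm (t *\<^sub>R h) < d" "norm (t *\<^sub>R h) < r" using d r by auto
    have "\<mu> * (t\<^sup>2 * (norm h)\<^sup>2) \<le> (t *\<^sub>R h) \<bullet> (G (x + t *\<^sub>R h) - G x)"
      using mono[of "x + t *\<^sub>R h"] lt by (simp add: dist_norm power_mult_distrib)
    also have "\<dots> = (t *\<^sub>R h) \<bullet> (A (t *\<^sub>R h)) + (t *\<^sub>R h) \<bullet> (G (x + t *\<^sub>R h) - G x - A (t *\<^sub>R h))"
      by (simp only: inner_add_right[symmetric]) simp
    also have "(t *\<^sub>R h) \<bullet> (A (t *\<^sub>R h)) = t\<^sup>2 * (h \<bullet> A h)"
      by (simp add: linear_scale[OF has_derivative_linear[OF A]] power2_eq_square)
    also have "(t *\<^sub>R h) \<bullet> (G (x + t *\<^sub>R h) - G x - A (t *\<^sub>R h)) \<le> t\<^sup>2 * e"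
    proof -
      have "(t *\<^sub>R h) \<bullet> (G (x + t *\<^sub>R h) - G x - A (t *\<^sub>R h))
          \<le> norm (t *\<^sub>R h) * norm (G (x + t *\<^sub>R h) - G x - A (t *\<^sub>R h))" by (rule norm_cauchy_schwarz)
      also have "\<dots> \<le> norm (t *\<^sub>R h) * (e' * norm (t *\<^sub>R h))"
        using d(2)[of "x + t *\<^sub>R h"] lt by (intro mult_left_mono) auto
      also have "\<dots> = t\<^sup>2 * (e' * (norm h)\<^sup>2)"
        using t by (simp add: power2_eq_square)
      finally show ?thesis by (simp only: e')
    qed
    finally have "t\<^sup>2 * (\<mu> * (norm h)\<^sup>2) \<le> t\<^sup>2 * (h \<bullet> A h + e)"
      by (simp add: distrib_left mult.left_commute)
    then show ?thesis using t by simp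
  qed
  then show ?thesis by (rule field_le_epsilon)
qed

text \<open>Schwarz's theorem under the sole assumption that the gradient is differentiable at the point:
  the second difference is symmetric in both directions, and the mean value theorem in one of them
  evaluates it up to an error of second order.\<close>

lemma derivative_of_gradient_symmetric:
  fixes f :: "'a::real_inner \<Rightarrow> real"
  assumes r: "0 < r" and f: "\<And>u. u \<in> ball x r \<Longrightarrow> (f has_derivative (\<lambda>h. h \<bullet> G u)) (at u)"
    and A: "(G has_derivative A) (at x)"
  shows "A h \<bullet> k = h \<bullet> A k"
proof -
  have lin: "linear A" by (rule has_derivative_linear[OF A])
  define \<Delta> where "\<Delta> = (\<lambda>t h k. f (x + t *\<^sub>R k + t *\<^sub>R h) - f (x + t *\<^sub>R h) - f (x + t *\<^sub>R k) + f x)"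
  define N where "N = norm h + norm k"
  have est: "\<bar>h \<bullet> A k - k \<bullet> A h\<bar> \<le> e" if e: "0 < e" for e :: real
  proof -
    \<comment> \<open>Each of the two orders of \<open>h\<close> and \<open>k\<close> contributes an
      error \<open>2 * e' * N\<^sup>2\<close>; replacing \<open>N\<close> by \<open>N + 1\<close>
      keeps the denominator positive when both vectors are 0.\<close>
    define e' where "e' = e / (4 * (N + 1)\<^sup>2)"
    have N0: "0 \<le> N" by (simp add: N_def)
    have "0 < 4 * (N + 1)\<^sup>2" using N0 by simp
    then have e': "0 < e'" "4 * (N + 1)\<^sup>2 * e' = e" using e by (auto simp: e'_def)
    obtain d where d: "0 < d" "\<And>u. norm (u - x) < d \<Longrightarrow> norm (G u - G x - A (u - x)) \<le> e' * norm (u - x)"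
      using A e'(1) unfolding has_derivative_at_alt by blast
    define t where "t = min d r / 2 / (N + 1)"
    have t: "0 < t" using d r N0 by (simp add: t_def)
    have "N + 1 \<noteq> 0" using N0 by linarith
    then have tN: "t * (N + 1) = min d r / 2"
      unfolding t_def by (rule nonzero_divide_eq_eq[THEN iffD1, OF _ refl, symmetric])
    have tN2: "t * N < d" "t * N < r"
    proof -
      have "t * N \<le> t * (N + 1)" using t by simp
      then show "t * N < d" "t * N < r" using tN d r by linarith+
    qed
    have claim: "\<bar>\<Delta> t h k - t\<^sup>2 * (h \<bullet> A k)\<bar> \<le> t\<^sup>2 * (2 * e' * N\<^sup>2)" if hk: "norm h + norm k = N" for h k
    proof -
      have small: "norm (s *\<^sub>R h + c *\<^sub>R k) \<le> t * N" if "0 \<le> s" "s \<le> t" "0 \<le> c" "c \<le> t" for s c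
      proof -
        have "norm (s *\<^sub>R h + c *\<^sub>R k) \<le> s * norm h + c * norm k"
          using that norm_triangle_ineq[of "s *\<^sub>R h" "c *\<^sub>R k"] by simp
        also have "\<dots> \<le> t * norm h + t * norm k" using that by (intro add_mono mult_right_mono) auto
        finally show ?thesis by (simp add: hk[symmetric] distrib_left)
      qed
      \<comment> \<open>The second difference is the increment of \<open>\<psi>\<close> over
        \<open>{0..t}\<close>, so the mean value theorem along \<open>h\<close> leaves two gradients
        whose arguments differ by \<open>t *\<^sub>R k\<close>.\<close>
      define \<psi> where "\<psi> = (\<lambda>s. f (x + t *\<^sub>R k + s *\<^sub>R h) - f (x + s *\<^sub>R h))"
      have line: "((\<lambda>s. f (p + s *\<^sub>R h)) has_derivative (\<lambda>c. (c *\<^sub>R h) \<bullet> G (p + s *\<^sub>R h))) (at s within {0..t})"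
        if "p + s *\<^sub>R h \<in> ball x r" for p s
        by (rule has_derivative_compose[of "\<lambda>s. p + s *\<^sub>R h" "\<lambda>c. c *\<^sub>R h" s _ f])
          (use f[OF that] in \<open>auto intro!: derivative_eq_intros\<close>)
      have "\<exists>s\<in>{0..t}. \<psi> t - \<psi> 0 = (\<lambda>s c. (c *\<^sub>R h) \<bullet> G (x + t *\<^sub>R k + s *\<^sub>R h) - (c *\<^sub>R h) \<bullet> G (x + s *\<^sub>R h)) s (t - 0)"
      proof (rule mvt_very_simple)
        fix s assume s: "0 \<le> s" "s \<le> t"
        have "norm (s *\<^sub>R h + t *\<^sub>R k) < r" "norm (s *\<^sub>R h + 0 *\<^sub>R k) < r"
          using small[of s t] small[of s 0] s t tN2 by auto
        moreover have "(x + t *\<^sub>R k + s *\<^sub>R h) - x = s *\<^sub>R h + t *\<^sub>R k" "(x + s *\<^sub>R h) - x = s *\<^sub>R h + 0 *\<^sub>R k"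
          by simp_all
        ultimately have "norm ((x + t *\<^sub>R k + s *\<^sub>R h) - x) < r" "norm ((x + s *\<^sub>R h) - x) < r"
          by (simp_all only:)
        then have mem: "x + t *\<^sub>R k + s *\<^sub>R h \<in> ball x r" "x + s *\<^sub>R h \<in> ball x r"
          by (simp_all only: mem_ball dist_norm norm_minus_commute[of x])
        show "(\<psi> has_derivative (\<lambda>c. (c *\<^sub>R h) \<bullet> G (x + t *\<^sub>R k + s *\<^sub>R h) - (c *\<^sub>R h) \<bullet> G (x + s *\<^sub>R h))) (at s within {0..t})"
          unfolding \<psi>_def by (rule has_derivative_diff[OF line[OF mem(1)] line[OF mem(2)]])
      qed (use t in simp)
      then obtain s where s: "0 \<le> s" "s \<le> t"
        "\<psi> t - \<psi> 0 = t * (h \<bullet> (G (x + (s *\<^sub>R h + t *\<^sub>R k)) - G (x + s *\<^sub>R h)))"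
        by (auto simp: inner_diff_right right_diff_distrib add.assoc add.commute[of "t *\<^sub>R k"])
      define E where "E = (\<lambda>v. G (x + v) - G x - A v)"
      have E: "norm (E v) \<le> e' * (t * N)" if "norm v \<le> t * N" for v
      proof -
        have "norm (E v) \<le> e' * norm v" using d(2)[of "x + v"] that tN2 by (simp add: E_def)
        also have "\<dots> \<le> e' * (t * N)" using that e' by (intro mult_left_mono) auto
        finally show ?thesis .
      qed
      \<comment> \<open>Both gradients are expanded at \<open>x\<close>, not at each other, since
        differentiability is given only there; the terms \<open>A (s *\<^sub>R h)\<close>
        cancel.\<close>
      have "G (x + (s *\<^sub>R h + t *\<^sub>R k)) - G (x + s *\<^sub>R h) = t *\<^sub>R A k + (E (s *\<^sub>R h + t *\<^sub>R k) - E (s *\<^sub>R h))"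
        by (simp add: E_def linear_add[OF lin] linear_scale[OF lin])
      then have "\<Delta> t h k = t * (t * (h \<bullet> A k) + h \<bullet> (E (s *\<^sub>R h + t *\<^sub>R k) - E (s *\<^sub>R h)))"
        using s(3) by (simp add: \<Delta>_def \<psi>_def inner_add_right)
      then have "\<Delta> t h k - t\<^sup>2 * (h \<bullet> A k) = t * (h \<bullet> (E (s *\<^sub>R h + t *\<^sub>R k) - E (s *\<^sub>R h)))"
        by (simp add: distrib_left power2_eq_square)
      then have "\<bar>\<Delta> t h k - t\<^sup>2 * (h \<bullet> A k)\<bar> = t * \<bar>h \<bullet> (E (s *\<^sub>R h + t *\<^sub>R k) - E (s *\<^sub>R h))\<bar>"
        using t by (simp add: abs_mult)
      also have "\<dots> \<le> t * (N * (2 * (e' * (t * N))))"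
      proof (intro mult_left_mono)
        have "\<bar>h \<bullet> (E (s *\<^sub>R h + t *\<^sub>R k) - E (s *\<^sub>R h))\<bar> \<le> norm h * norm (E (s *\<^sub>R h + t *\<^sub>R k) - E (s *\<^sub>R h))"
          by (rule Cauchy_Schwarz_ineq2)
        also have "\<dots> \<le> N * (2 * (e' * (t * N)))"
        proof (intro mult_mono)
          have "norm (E (s *\<^sub>R h + t *\<^sub>R k)) \<le> e' * (t * N)" "norm (E (s *\<^sub>R h + 0 *\<^sub>R k)) \<le> e' * (t * N)"
            using small[of s t] small[of s 0] s t by (intro E; simp)+
          then show "norm (E (s *\<^sub>R h + t *\<^sub>R k) - E (s *\<^sub>R h)) \<le> 2 * (e' * (t * N))"
            using norm_triangle_ineq4[of "E (s *\<^sub>R h + t *\<^sub>R k)" "E (s *\<^sub>R h)"] by simp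
          show "norm h \<le> N" using hk norm_ge_zero[of k] by linarith
        qed (use N0 in auto)
        finally show "\<bar>h \<bullet> (E (s *\<^sub>R h + t *\<^sub>R k) - E (s *\<^sub>R h))\<bar> \<le> N * (2 * (e' * (t * N)))" .
      qed (use t in auto)
      also have "\<dots> = t\<^sup>2 * (2 * e' * N\<^sup>2)" by (simp add: power2_eq_square mult.commute mult.left_commute)
      finally show ?thesis .
    qed
    have "\<Delta> t h k = \<Delta> t k h" by (simp add: \<Delta>_def add.commute add.left_commute add.assoc)
    then have "\<bar>t\<^sup>2 * (h \<bullet> A k) - t\<^sup>2 * (k \<bullet> A h)\<bar> \<le> 2 * (t\<^sup>2 * (2 * e' * N\<^sup>2))"
      using claim[of h k] claim[of k h] by (simp add: N_def add.commute[of "norm k"])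
    moreover have "\<bar>t\<^sup>2 * (h \<bullet> A k) - t\<^sup>2 * (k \<bullet> A h)\<bar> = t\<^sup>2 * \<bar>h \<bullet> A k - k \<bullet> A h\<bar>"
      unfolding right_diff_distrib[symmetric] abs_mult by simp
    moreover have "2 * (t\<^sup>2 * (2 * e' * N\<^sup>2)) = t\<^sup>2 * (4 * N\<^sup>2 * e')" by simp
    ultimately have "t\<^sup>2 * \<bar>h \<bullet> A k - k \<bullet> A h\<bar> \<le> t\<^sup>2 * (4 * N\<^sup>2 * e')" by (simp only:)
    then have "\<bar>h \<bullet> A k - k \<bullet> A h\<bar> \<le> 4 * N\<^sup>2 * e'" using t by simp
    also have "\<dots> \<le> 4 * (N + 1)\<^sup>2 * e'"
      using N0 e' by (intro mult_right_mono mult_left_mono power_mono) auto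
    finally show ?thesis by (simp only: e')
  qed
  have "\<bar>h \<bullet> A k - k \<bullet> A h\<bar> \<le> 0 + e" if "0 < e" for e using est[OF that] by simp
  then have "\<bar>h \<bullet> A k - k \<bullet> A h\<bar> \<le> 0" by (rule field_le_epsilon)
  then show ?thesis by (simp add: inner_commute)
qed

text \<open>All three facts concern the maximiser \<open>m z\<close> of
  \<open>x \<bullet> z - \<phi> x\<close> over \<open>X\<close>. Strong convexity gives a quadratic
  gap below the maximum; the gaps at two dual points add up to strong monotonicity of
  \<open>m\<close> and thus to its Lipschitz bound, which in turn makes the conjugate differentiable
  with gradient \<open>m z\<close>. Only values of \<open>\<phi>\<close> are used, so maximisers on
  the boundary are covered.\<close>

lemma
  fixes \<phi> :: "'a::euclidean_space \<Rightarrow> real"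
  assumes X: "compact X" "X \<noteq> {}" and cont: "continuous_on X \<phi>" and sc: "strongly_convex_on \<mu> X \<phi>"
  shows gradient_conjugate_mem: "gradient UNIV (conjugate X \<phi>) z \<in> X"
    and gradient_conjugate_max:
      "\<And>x. x \<in> X \<Longrightarrow> x \<bullet> z - \<phi> x \<le> gradient UNIV (conjugate X \<phi>) z \<bullet> z - \<phi> (gradient UNIV (conjugate X \<phi>) z)"
    and gradient_conjugate_lipschitz:
      "norm (gradient UNIV (conjugate X \<phi>) z' - gradient UNIV (conjugate X \<phi>) z) \<le> 2 / \<mu> * norm (z' - z)"
proof -
  have \<mu>: "0 < \<mu>" and cX: "convex X" using sc by (auto simp: strongly_convex_on_def)
  have "\<exists>x\<in>X. \<forall>y\<in>X. y \<bullet> z - \<phi> y \<le> x \<bullet> z - \<phi> x" for z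
    by (rule continuous_attains_sup[OF X]) (intro continuous_intros cont)
  then obtain m where m: "\<And>z. m z \<in> X" "\<And>z y. y \<in> X \<Longrightarrow> y \<bullet> z - \<phi> y \<le> m z \<bullet> z - \<phi> (m z)"
    by metis
  \<comment> \<open>Comparison with the midpoint of \<open>m z\<close> and \<open>y\<close>. It
    yields \<open>\<mu> / 4\<close> where the sharp constant is \<open>\<mu> / 2\<close>, which is
    why the Lipschitz constant is \<open>2 / \<mu>\<close>.\<close>
  have gap: "\<mu> / 4 * (norm (m z - y))\<^sup>2 \<le> (m z \<bullet> z - \<phi> (m z)) - (y \<bullet> z - \<phi> y)" if y: "y \<in> X" for z y
  proof -
    let ?w = "(1 - 1/2) *\<^sub>R m z + (1/2) *\<^sub>R y"
    have w: "?w \<in> X" using cX m(1)[of z] y by (intro convexD) auto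
    have "\<phi> ?w \<le> (1 - 1/2) * \<phi> (m z) + 1/2 * \<phi> y - \<mu> / 2 * (1/2) * (1 - 1/2) * (norm (m z - y))\<^sup>2"
    proof -
      have "(1/2 :: real) \<in> {0..1}" by simp
      then show ?thesis using sc m(1)[of z] y unfolding strongly_convex_on_def by blast
    qed
    moreover have "?w \<bullet> z - \<phi> ?w \<le> m z \<bullet> z - \<phi> (m z)" by (rule m(2)[OF w])
    moreover have "?w \<bullet> z = 1/2 * (m z \<bullet> z) + 1/2 * (y \<bullet> z)" by (simp add: inner_add_left)
    ultimately show ?thesis by simp
  qed
  have mono: "\<mu> / 2 * (norm (m z' - m z))\<^sup>2 \<le> (m z' - m z) \<bullet> (z' - z)" for z z'
    using gap[OF m(1)[of z'], of z] gap[OF m(1)[of z], of z']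
    by (simp add: inner_diff_left inner_diff_right norm_minus_commute)
  have lip: "norm (m z' - m z) \<le> 2 / \<mu> * norm (z' - z)" for z z'
  proof (cases "m z' = m z")
    case True then show ?thesis using \<mu> by simp
  next
    case False
    have "\<mu> / 2 * (norm (m z' - m z))\<^sup>2 \<le> norm (m z' - m z) * norm (z' - z)"
      using mono[of z' z] norm_cauchy_schwarz[of "m z' - m z" "z' - z"] by linarith
    then have "norm (m z' - m z) * (\<mu> / 2 * norm (m z' - m z)) \<le> norm (m z' - m z) * norm (z' - z)"
      by (simp add: power2_eq_square mult.left_commute)
    then have "\<mu> / 2 * norm (m z' - m z) \<le> norm (z' - z)" using False by simp
    then show ?thesis using \<mu> by (simp add: pos_le_divide_eq mult.commute)
  qed
  have conj: "conjugate X \<phi> z = m z \<bullet> z - \<phi> (m z)" for z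
    unfolding conjugate_def by (rule cSup_eq_maximum) (use m in auto)
  have grad: "gradient UNIV (conjugate X \<phi>) z = m z" for z
  proof (rule gradient_eqI)
    show "(conjugate X \<phi> has_derivative (\<lambda>h. h \<bullet> m z)) (at z)"
      unfolding has_derivative_at_alt
    proof (intro conjI allI impI)
      show "bounded_linear (\<lambda>h. h \<bullet> m z)" by (rule bounded_linear_inner_left)
      fix e :: real assume e: "0 < e"
      \<comment> \<open>Using each maximiser as a competitor in the other problem places the
        remainder between 0 and \<open>(m y - m z) \<bullet> (y - z)\<close>; on the radius
        \<open>e * \<mu> / 2\<close> the Lipschitz bound makes the first factor at most
        \<open>e\<close>.\<close>
      have "norm (conjugate X \<phi> y - conjugate X \<phi> z - (y - z) \<bullet> m z) \<le> e * norm (y - z)"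
        if y: "norm (y - z) < e * \<mu> / 2" for y
      proof -
        have "0 \<le> conjugate X \<phi> y - conjugate X \<phi> z - (y - z) \<bullet> m z"
          using m(2)[OF m(1)[of z], of y]
          by (simp add: conj inner_diff_left inner_commute[of y "m z"] inner_commute[of z "m z"])
        moreover have "conjugate X \<phi> y - conjugate X \<phi> z - (y - z) \<bullet> m z \<le> (m y - m z) \<bullet> (y - z)"
          using m(2)[OF m(1)[of y], of z]
          by (simp add: conj inner_diff_left inner_diff_right inner_commute[of y "m z"] inner_commute[of z "m z"])
        moreover have "(m y - m z) \<bullet> (y - z) \<le> norm (m y - m z) * norm (y - z)"
          by (rule norm_cauchy_schwarz)
        moreover have "norm (m y - m z) * norm (y - z) \<le> e * norm (y - z)"
        proof (intro mult_right_mono)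
          have "norm (m y - m z) \<le> 2 / \<mu> * norm (y - z)" by (rule lip)
          also have "\<dots> \<le> 2 / \<mu> * (e * \<mu> / 2)" using y \<mu> by (intro mult_left_mono) auto
          also have "\<dots> = e" using \<mu> by simp
          finally show "norm (m y - m z) \<le> e" .
        qed simp
        ultimately show ?thesis by simp
      qed
      moreover have "0 < e * \<mu> / 2" using e \<mu> by simp
      ultimately show "\<exists>d>0. \<forall>y. norm (y - z) < d \<longrightarrow>
          norm (conjugate X \<phi> y - conjugate X \<phi> z - (y - z) \<bullet> m z) \<le> e * norm (y - z)"
        by blast
    qed
  qed simp
  show "gradient UNIV (conjugate X \<phi>) z \<in> X" unfolding grad by (rule m)
  show "x \<bullet> z - \<phi> x \<le> gradient UNIV (conjugate X \<phi>) z \<bullet> z - \<phi> (gradient UNIV (conjugate X \<phi>) z)"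
    if "x \<in> X" for x unfolding grad by (rule m(2)[OF that])
  show "norm (gradient UNIV (conjugate X \<phi>) z' - gradient UNIV (conjugate X \<phi>) z) \<le> 2 / \<mu> * norm (z' - z)"
    unfolding grad by (rule lip)
qed

lemma interior_min_gradient_zero:
  fixes f :: "'a::euclidean_space \<Rightarrow> real"
  assumes x: "x \<in> interior S" and min: "\<And>y. y \<in> S \<Longrightarrow> f x \<le> f y"
    and f: "(f has_derivative (\<lambda>h. h \<bullet> g)) (at x)"
  shows "g = 0"
proof -
  have "(\<lambda>h. h \<bullet> g) = (\<lambda>h. 0)"
    by (rule differential_zero_maxmin[OF x open_interior f]) (use min interior_subset in blast)
  then have "g \<bullet> g = 0" by metis
  then show ?thesis by simp
qed

text \<open>On a small ball the derivative stays within distance 1 of \<open>g' x\<close>, and the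
  mean value inequality on this convex set gives the constant \<open>norm (g' x) + 1\<close>.
  Halving the radius makes the ball closed.\<close>

lemma C1_around_lipschitz:
  assumes "C1_around S g x"
  obtains r l where "0 < r" "cball x r \<subseteq> S" "l-lipschitz_on (cball x r) g"
    "\<And>u. u \<in> cball x r \<Longrightarrow> g differentiable (at u)"
proof -
  obtain U g' where U: "open U" "x \<in> U" "U \<subseteq> S"
    and g': "\<And>u. u \<in> U \<Longrightarrow> (g has_derivative blinfun_apply (g' u)) (at u)" and cont: "continuous_on U g'"
    using assms unfolding C1_around_def by blast
  have "isCont g' x" using cont U by (simp add: continuous_on_eq_continuous_at)
  then have "\<forall>\<^sub>F u in at x. dist (g' u) (g' x) < 1"
    unfolding isCont_def by (rule tendstoD) simp
  then have "\<forall>\<^sub>F u in nhds x. u \<noteq> x \<longrightarrow> dist (g' u) (g' x) < 1"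
    by (simp add: eventually_at_filter)
  then have "\<forall>\<^sub>F u in nhds x. dist (g' u) (g' x) < 1"
    by (rule eventually_mono) (metis dist_self zero_less_one)
  then have "\<forall>\<^sub>F u in nhds x. u \<in> U \<and> dist (g' u) (g' x) < 1"
    using eventually_nhds_in_open[OF U(1,2)] by (intro eventually_conj)
  then obtain d where d: "0 < d" "\<And>u. dist u x < d \<Longrightarrow> u \<in> U \<and> dist (g' u) (g' x) < 1"
    unfolding eventually_nhds_metric by blast
  define r where "r = d / 2"
  have r: "0 < r" using d by (simp add: r_def)
  have in_U: "u \<in> U" "dist (g' u) (g' x) < 1" if "u \<in> cball x r" for u
    using d(2)[of u] d(1) that by (auto simp: r_def dist_commute)
  show thesis
  proof (rule that[OF r])
    show "cball x r \<subseteq> S" using in_U(1) U(3) by blast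
    show "g differentiable (at u)" if "u \<in> cball x r" for u
      using g'[OF in_U(1)[OF that]] by (auto simp: differentiable_def)
    show "(norm (g' x) + 1)-lipschitz_on (cball x r) g"
    proof (rule lipschitz_onI)
      fix u v assume uv: "u \<in> cball x r" "v \<in> cball x r"
      have "norm (g u - g v) \<le> (norm (g' x) + 1) * norm (u - v)"
      proof (rule differentiable_bound[OF convex_cball _ _ uv])
        fix w assume w: "w \<in> cball x r"
        show "(g has_derivative blinfun_apply (g' w)) (at w within cball x r)"
          by (rule has_derivative_at_withinI[OF g'[OF in_U(1)[OF w]]])
        have "norm (g' w) \<le> norm (g' x) + norm (g' w - g' x)" by (rule norm_triangle_sub)
        then show "onorm (blinfun_apply (g' w)) \<le> norm (g' x) + 1"
          using in_U(2)[OF w] by (simp add: norm_blinfun.rep_eq[symmetric] dist_norm)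
      qed
      then show "dist (g u) (g v) \<le> (norm (g' x) + 1) * dist u v" by (simp add: dist_norm)
    qed simp
  qed
qed


section \<open>Stacked vectors and the graph Laplacian\<close>

lemma block_col [simp]: "block (col v) i = v i"
  by (simp add: block_def col_def vec_eq_iff)

lemma col_block [simp]: "col (block x) = x"
  by (simp add: block_def col_def vec_eq_iff)

lemma block_eqI: "(\<And>i. block x i = block y i) \<Longrightarrow> x = y"
  by (metis col_block ext)

lemma block_add [simp]: "block (x + y) i = block x i + block y i"
  and block_diff [simp]: "block (x - y) i = block x i - block y i"
  and block_minus [simp]: "block (- x) i = - block x i"
  and block_scaleR [simp]: "block (c *\<^sub>R x) i = c *\<^sub>R block x i"
  and block_zero [simp]: "block 0 i = 0"
  by (simp_all add: block_def vec_eq_iff)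

lemma linear_block: "linear (\<lambda>x. block x i)"
  by (rule linearI) simp_all

lemma inner_stacked: "x \<bullet> y = (\<Sum>i\<in>UNIV. block x i \<bullet> block y i)"
proof -
  have "x \<bullet> y = (\<Sum>p\<in>UNIV \<times> UNIV. x $ p * y $ p)" by (simp add: inner_vec_def)
  also have "\<dots> = (\<Sum>i\<in>UNIV. \<Sum>a\<in>UNIV. x $ (i, a) * y $ (i, a))"
    by (simp add: sum.cartesian_product)
  finally show ?thesis by (simp add: inner_vec_def block_def)
qed

lemma norm_stacked: "(norm x)\<^sup>2 = (\<Sum>i\<in>UNIV. (norm (block x i))\<^sup>2)"
  by (simp add: power2_norm_eq_inner inner_stacked)

lemma norm_block_le: "norm (block x i) \<le> norm x"
proof (rule power2_le_imp_le)
  show "(norm (block x i))\<^sup>2 \<le> (norm x)\<^sup>2"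
    unfolding norm_stacked by (rule member_le_sum) auto
qed simp

lemma stacked_has_derivative:
  fixes g :: "'n::finite \<Rightarrow> real^'d \<Rightarrow> real^'d"
  assumes "\<And>i. (g i has_derivative A i) (at (block x i))"
  shows "((\<lambda>x. col (\<lambda>i. g i (block x i))) has_derivative (\<lambda>h. col (\<lambda>i. A i (block h i)))) (at x)"
proof -
  have "((\<lambda>x. g (fst p) (block x (fst p)) $ snd p) has_derivative
      (\<lambda>h. A (fst p) (block h (fst p)) $ snd p)) (at x)" for p
  proof -
    have "((\<lambda>x. block x (fst p)) has_derivative (\<lambda>h. block h (fst p))) (at x)"
      by (rule linear_imp_has_derivative[OF linear_block])
    then have "((\<lambda>x. g (fst p) (block x (fst p))) has_derivative (\<lambda>h. A (fst p) (block h (fst p)))) (at x)"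
      by (rule has_derivative_compose) (rule assms)
    then show ?thesis by (rule bounded_linear.has_derivative[OF bounded_linear_vec_nth])
  qed
  then show ?thesis
    by (subst has_derivative_componentwise_within)
      (auto simp: Basis_vec_def inner_axis col_def)
qed

lemma stacked_lipschitz:
  fixes g :: "'n::finite \<Rightarrow> real^'d::finite \<Rightarrow> real^'d"
  assumes "\<And>i. l-lipschitz_on U (g i)"
  shows "l-lipschitz_on {x :: real^('n \<times> 'd). \<forall>i. block x i \<in> U} (\<lambda>x. col (\<lambda>i. g i (block x i)))"
proof (rule lipschitz_onI)
  show l: "0 \<le> l" by (rule lipschitz_on_nonneg[OF assms])
  fix x y :: "real^('n \<times> 'd)" assume xy: "x \<in> {x. \<forall>i. block x i \<in> U}" "y \<in> {x. \<forall>i. block x i \<in> U}"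
  have "(norm (col (\<lambda>i. g i (block x i)) - col (\<lambda>i. g i (block y i))))\<^sup>2
      = (\<Sum>i\<in>UNIV. (norm (g i (block x i) - g i (block y i)))\<^sup>2)"
    by (simp add: norm_stacked)
  also have "\<dots> \<le> (\<Sum>i\<in>UNIV. (l * norm (block x i - block y i))\<^sup>2)"
    using xy by (intro sum_mono power_mono lipschitz_on_normD[OF assms]) auto
  also have "\<dots> = (l * norm (x - y))\<^sup>2"
    by (simp add: norm_stacked[of "x - y"] power_mult_distrib sum_distrib_left)
  finally have "norm (col (\<lambda>i. g i (block x i)) - col (\<lambda>i. g i (block y i))) \<le> l * norm (x - y)"
    by (rule power2_le_imp_le) (use l in simp)
  then show "dist (col (\<lambda>i. g i (block x i))) (col (\<lambda>i. g i (block y i))) \<le> l * dist x y"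
    by (simp add: dist_norm)
qed

lemma block_diag_mult: "block_diag B *v x = col (\<lambda>i. B i *v block x i)"
proof -
  have "(block_diag B *v x) $ (i, a) = (B i *v block x i) $ a" for i a
  proof -
    have "(block_diag B *v x) $ (i, a) =
        (\<Sum>q\<in>UNIV \<times> UNIV. (if i = fst q then B i $ a $ snd q else 0) * x $ q)"
      by (simp add: matrix_vector_mult_def block_diag_def cong: if_cong)
    also have "\<dots> = (\<Sum>j\<in>UNIV. \<Sum>b\<in>UNIV. (if i = j then B i $ a $ b else 0) * x $ (j, b))"
      by (simp add: sum.cartesian_product split_def)
    also have "\<dots> = (\<Sum>j\<in>UNIV. if i = j then \<Sum>b\<in>UNIV. B i $ a $ b * x $ (j, b) else 0)"
      by (intro sum.cong refl) simp
    finally show ?thesis by (simp add: matrix_vector_mult_def block_def)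
  qed
  then show ?thesis by (simp add: vec_eq_iff col_def)
qed

text \<open>The splitting complementary to \<open>block\<close>: \<open>kron A (mat 1)\<close> mixes
  the blocks but acts on each coordinate slice as \<open>A\<close> itself, so claims on the
  Kronecker product reduce to claims on the graph.\<close>

definition slice :: "real^('n::finite \<times> 'd::finite) \<Rightarrow> 'd \<Rightarrow> real^'n" where
  "slice x a = (\<chi> i. x $ (i, a))"

lemma slice_nth [simp]: "slice x a $ i = x $ (i, a)"
  by (simp add: slice_def)

lemma slice_eqI: "(\<And>a. slice x a = slice y a) \<Longrightarrow> x = y"
  by (simp add: slice_def vec_eq_iff)

lemma slice_zero [simp]: "slice 0 a = 0"
  by (simp add: slice_def vec_eq_iff)

lemma slice_kron: "slice (kron A (mat 1) *v x) a = A *v slice x a"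
proof -
  have "(kron A (mat 1) *v x) $ (i, a) = (A *v slice x a) $ i" for i
  proof -
    have "(kron A (mat 1) *v x) $ (i, a) =
        (\<Sum>q\<in>UNIV \<times> UNIV. A $ i $ fst q * (if a = snd q then 1 else 0) * x $ q)"
      by (simp add: matrix_vector_mult_def kron_def mat_def)
    also have "\<dots> = (\<Sum>j\<in>UNIV. \<Sum>b\<in>UNIV. A $ i $ j * (if a = b then 1 else 0) * x $ (j, b))"
      by (simp add: sum.cartesian_product split_def)
    also have "\<dots> = (\<Sum>j\<in>UNIV. \<Sum>b\<in>UNIV. if a = b then A $ i $ j * x $ (j, b) else 0)"
      by (intro sum.cong refl) simp
    finally show ?thesis by (simp add: matrix_vector_mult_def)
  qed
  then show ?thesis by (simp add: vec_eq_iff)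
qed

text \<open>Edges at \<open>i\<close> correspond bijectively to neighbours of \<open>i\<close>,
  because an edge has exactly two vertices; the degree thus supplies one copy of
  \<open>u $ i\<close> for each neighbour.\<close>

lemma laplacian_mult_nth:
  assumes E: "simple_graph E"
  shows "(laplacian E *v u) $ i = (\<Sum>j\<in>{j. {i, j} \<in> E}. u $ i - u $ j)"
proof -
  have loop: "{i, i} \<notin> E" for i using E by (auto simp: simple_graph_def)
  have "bij_betw (\<lambda>j. {i, j}) {j. {i, j} \<in> E} {e \<in> E. i \<in> e}"
    unfolding bij_betw_def
  proof (intro conjI subset_antisym subsetI)
    show "inj_on (\<lambda>j. {i, j}) {j. {i, j} \<in> E}" by (auto simp: inj_on_def doubleton_eq_iff)
    fix e assume e: "e \<in> {e \<in> E. i \<in> e}"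
    then obtain v w where "e = {v, w}" using E by (auto simp: simple_graph_def card_2_iff)
    then have "\<exists>j. e = {i, j}" using e by auto
    then show "e \<in> (\<lambda>j. {i, j}) ` {j. {i, j} \<in> E}" using e by auto
  qed auto
  then have deg: "card {e \<in> E. i \<in> e} = card {j. {i, j} \<in> E}"
    by (simp add: bij_betw_same_card)
  have "(laplacian E *v u) $ i = (\<Sum>j\<in>UNIV. (if i = j then real (card {e \<in> E. i \<in> e}) * u $ i else 0)
      + (if {i, j} \<in> E then - u $ j else 0))"
    using loop by (auto simp: matrix_vector_mult_def laplacian_def intro!: sum.cong)
  also have "\<dots> = real (card {e \<in> E. i \<in> e}) * u $ i + (\<Sum>j\<in>{j. {i, j} \<in> E}. - u $ j)"
    by (simp add: sum.distrib sum.If_cases)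
  also have "\<dots> = (\<Sum>j\<in>{j. {i, j} \<in> E}. u $ i - u $ j)"
    by (simp add: deg sum_subtractf sum_negf)
  finally show ?thesis .
qed

text \<open>Maximum principle: where u is maximal, all summands of the Laplacian are nonnegative.\<close>

lemma laplacian_null_space:
  assumes E: "simple_graph E" "connected_graph E" and u: "laplacian E *v u = 0"
  shows "u $ i = u $ j"
proof -
  have "finite (range (($) u))" "range (($) u) \<noteq> {}" by auto
  then obtain k where k: "u $ k = Max (range (($) u))" using Max_in by (metis imageE)
  then have max: "u $ i \<le> u $ k" for i by simp
  have "u $ i = u $ k" for i
  proof -
    \<comment> \<open>Equality with the maximum is propagated along a path from the maximiser
      \<open>k\<close>: at a maximal vertex nonnegative summands add up to 0, so all neighbours are
      maximal too.\<close>
    have "(\<lambda>u v. {u, v} \<in> E)\<^sup>*\<^sup>* k i" using E(2) by (simp add: connected_graph_def)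
    then show ?thesis
    proof induction
      case (step v w)
      have "(\<Sum>j\<in>{j. {v, j} \<in> E}. u $ v - u $ j) = 0"
        using laplacian_mult_nth[OF E(1), of u v] u by simp
      then have "\<forall>j\<in>{j. {v, j} \<in> E}. u $ v - u $ j = 0"
        by (subst (asm) sum_nonneg_eq_0_iff) (use max step.IH in auto)
      then show ?case using step by auto
    qed simp
  qed
  then show ?thesis by metis
qed

lemma kron_laplacian_consensus:
  assumes "simple_graph E"
  shows "kron (laplacian E) (mat 1) *v col (\<lambda>_. c) = 0"
proof (rule slice_eqI)
  fix a
  have "laplacian E *v slice (col (\<lambda>_. c)) a = 0"
    by (simp add: vec_eq_iff laplacian_mult_nth[OF assms] col_def)
  then show "slice (kron (laplacian E) (mat 1) *v col (\<lambda>_. c)) a = slice 0 a"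
    by (simp add: slice_kron)
qed

lemma kron_laplacian_null_space:
  assumes E: "simple_graph E" "connected_graph E" and x: "kron (laplacian E) (mat 1) *v x = 0"
  shows "block x i = block x j"
proof -
  have "laplacian E *v slice x a = 0" for a
    using slice_kron[of "laplacian E" x a] x by simp
  then have "slice x a $ i = slice x a $ j" for a by (rule laplacian_null_space[OF E])
  then show ?thesis by (simp add: block_def)
qed

lemma inner_consensus: "col (\<lambda>_. c) \<bullet> y = c \<bullet> (\<Sum>i\<in>UNIV. block y i)"
  by (simp add: inner_stacked inner_sum_right)

text \<open>The form attains a positive minimum on the compact unit sphere, and homogeneity spreads
  it to all vectors.\<close>

lemma quadratic_form_bounded_below:
  fixes H :: "'a::euclidean_space \<Rightarrow> 'a"
  assumes lin: "linear H" and pos: "\<And>x. x \<noteq> 0 \<Longrightarrow> 0 < x \<bullet> H x"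
  obtains h where "0 < h" "\<And>x. h * (norm x)\<^sup>2 \<le> x \<bullet> H x"
proof -
  have "continuous_on (sphere 0 1) H"
    using lin by (intro linear_continuous_on) (simp add: linear_linear)
  then have "continuous_on (sphere 0 1) (\<lambda>x. x \<bullet> H x)" by (intro continuous_intros)
  then have "\<exists>x\<in>sphere 0 1. \<forall>y\<in>sphere 0 1. x \<bullet> H x \<le> y \<bullet> H y"
    by (intro continuous_attains_inf) auto
  then obtain x0 where x0: "norm x0 = 1" "\<And>y. norm y = 1 \<Longrightarrow> x0 \<bullet> H x0 \<le> y \<bullet> H y"
    by auto
  show thesis
  proof (rule that)
    show "0 < x0 \<bullet> H x0" using pos[of x0] x0(1) by force
    fix x show "x0 \<bullet> H x0 * (norm x)\<^sup>2 \<le> x \<bullet> H x"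
    proof (cases "x = 0")
      case False
      let ?y = "(1 / norm x) *\<^sub>R x"
      have "x0 \<bullet> H x0 \<le> ?y \<bullet> H ?y" using False by (intro x0) simp
      also have "?y \<bullet> H ?y = (x \<bullet> H x) / (norm x)\<^sup>2"
        by (simp add: linear_scale[OF lin] power2_eq_square)
      finally show ?thesis using False by (simp add: pos_le_divide_eq)
    qed (use lin in \<open>simp add: linear_0\<close>)
  qed
qed

text \<open>Adding the projection onto the consensus directions (up to a factor) makes the Laplacian
  invertible without changing its inverse on the stacked vectors with vanishing block sum.\<close>

lemma symmetric_inverse_on_zero_sum:
  fixes L :: "real^('n::finite \<times> 'd::finite) \<Rightarrow> real^('n \<times> 'd)"
  assumes lin: "linear L" and sym: "\<And>u v. L u \<bullet> v = u \<bullet> L v"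
    and psd: "\<And>x. 0 \<le> x \<bullet> L x" "\<And>x. x \<bullet> L x = 0 \<Longrightarrow> \<exists>c. x = col (\<lambda>_. c)"
    and sum0: "\<And>x. (\<Sum>i\<in>UNIV. block (L x) i) = 0"
  obtains T \<tau> where "linear T" "\<And>u v. T u \<bullet> v = u \<bullet> T v" "0 < \<tau>"
    "\<And>w. \<tau> * (norm w)\<^sup>2 \<le> w \<bullet> T w"
    "\<And>w x. (\<Sum>i\<in>UNIV. block w i) = 0 \<Longrightarrow> T w \<bullet> L x = w \<bullet> x"
proof -
  define \<sigma> :: "real^('n \<times> 'd) \<Rightarrow> real^'d" where "\<sigma> x = (\<Sum>i\<in>UNIV. block x i)" for x
  define A where "A = (\<lambda>x. L x + col (\<lambda>_. \<sigma> x))"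
  have colI: "col (\<lambda>_. \<sigma> x) \<bullet> y = \<sigma> x \<bullet> \<sigma> y" for x y by (simp add: inner_consensus \<sigma>_def)
  have \<sigma>lin: "\<sigma> (x + y) = \<sigma> x + \<sigma> y" "\<sigma> (c *\<^sub>R x) = c *\<^sub>R \<sigma> x" for x y c
    by (simp_all add: \<sigma>_def sum.distrib scaleR_sum_right)
  have linA: "linear A"
  proof (rule linearI)
    show "A (x + y) = A x + A y" for x y
      by (rule block_eqI) (simp add: A_def \<sigma>lin linear_add[OF lin])
    show "A (c *\<^sub>R x) = c *\<^sub>R A x" for x c
      by (rule block_eqI) (simp add: A_def \<sigma>lin linear_scale[OF lin] scaleR_add_right)
  qed
  have symA: "A u \<bullet> v = u \<bullet> A v" for u v
    by (simp add: A_def inner_add_left inner_add_right sym colI inner_commute[of u "col _"] inner_commute[of "\<sigma> u"])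
  have posA: "0 < x \<bullet> A x" if x: "x \<noteq> 0" for x
  proof -
    have eq: "x \<bullet> A x = x \<bullet> L x + \<sigma> x \<bullet> \<sigma> x"
      by (simp add: A_def inner_add_right colI inner_commute[of x "col _"])
    have "x = 0" if "x \<bullet> L x = 0" "\<sigma> x = 0"
    proof -
      obtain c where c: "x = col (\<lambda>_. c)" using psd(2)[OF \<open>x \<bullet> L x = 0\<close>] by blast
      have "real CARD('n) *\<^sub>R c = 0"
        using \<open>\<sigma> x = 0\<close> sum_constant_scaleR[of c "UNIV :: 'n set"] by (simp only: \<sigma>_def c block_col)
      then have "c = 0" by (simp only: scaleR_eq_0_iff of_nat_eq_0_iff card_eq_0_iff) simp
      then show ?thesis by (intro block_eqI) (simp add: c)
    qed
    then show ?thesis using x psd(1)[of x] inner_ge_zero[of "\<sigma> x"] eq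
      by (metis add_nonneg_eq_0_iff add_nonneg_nonneg inner_eq_zero_iff less_eq_real_def)
  qed
  have injA: "inj A"
  proof (subst linear_injective_0[OF linA], intro allI impI)
    fix x assume "A x = 0"
    then have "x \<bullet> A x = 0" by simp
    then show "x = 0" using posA[of x] by (metis less_irrefl)
  qed
  obtain T where T: "linear T" "\<And>x. T (A x) = x" "\<And>x. A (T x) = x"
    using linear_injective_isomorphism[OF linA injA] by blast
  obtain h where h: "0 < h" "\<And>x. h * (norm x)\<^sup>2 \<le> x \<bullet> A x"
    using quadratic_form_bounded_below[OF linA posA] by blast
  obtain \<alpha> where \<alpha>: "0 < \<alpha>" "\<And>x. norm (A x) \<le> \<alpha> * norm x"
    using linear_bounded_pos[OF linA] by blast
  show thesis
  proof (rule that[OF T(1)])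
    show "T u \<bullet> v = u \<bullet> T v" for u v
      using symA[of "T u" "T v"] by (simp add: T(3))
    \<comment> \<open>The constant comes from the coercivity of \<open>A\<close> at
      \<open>T w\<close> and
      \<open>norm w = norm (A (T w)) \<le> \<alpha> * norm (T w)\<close>.\<close>
    show "0 < h / \<alpha>\<^sup>2" using h \<alpha> by simp
    show "h / \<alpha>\<^sup>2 * (norm w)\<^sup>2 \<le> w \<bullet> T w" for w
    proof -
      have "(norm w)\<^sup>2 \<le> (\<alpha> * norm (T w))\<^sup>2"
        using \<alpha>(2)[of "T w"] by (intro power_mono) (simp_all add: T(3))
      then have "h / \<alpha>\<^sup>2 * (norm w)\<^sup>2 \<le> h / \<alpha>\<^sup>2 * (\<alpha> * norm (T w))\<^sup>2"
        using h \<alpha> by (intro mult_left_mono) auto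
      also have "\<dots> = h * (norm (T w))\<^sup>2" using \<alpha>(1) by (simp add: power_mult_distrib)
      also have "\<dots> \<le> T w \<bullet> A (T w)" by (rule h)
      finally show ?thesis by (simp add: T(3) inner_commute)
    qed
    fix w x :: "real^('n \<times> 'd)" assume w: "(\<Sum>i\<in>UNIV. block w i) = 0"
    \<comment> \<open>\<open>L\<close> contributes no block sum, and the added term contributes
      \<open>\<sigma> (T w)\<close> once per vertex. A vector \<open>w\<close> with block sum 0
      therefore forces \<open>\<sigma> (T w) = 0\<close>, so \<open>A\<close> and \<open>L\<close>
      agree at \<open>T w\<close>.\<close>
    have "\<sigma> (A (T w)) = \<sigma> (L (T w)) + real CARD('n) *\<^sub>R \<sigma> (T w)"
      using sum_constant_scaleR[of "\<sigma> (T w)" "UNIV :: 'n set"]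
      by (simp only: A_def \<sigma>lin) (simp only: \<sigma>_def[of "col _"] block_col)
    then have "real CARD('n) *\<^sub>R \<sigma> (T w) = 0" using w by (simp add: T(3) \<sigma>_def sum0)
    then have "\<sigma> (T w) = 0" by (simp only: scaleR_eq_0_iff of_nat_eq_0_iff card_eq_0_iff) simp
    then have "A (T w) = L (T w)" by (intro block_eqI) (simp add: A_def)
    then have "L (T w) = w" by (simp add: T(3))
    then show "T w \<bullet> L x = w \<bullet> x" using sym[of "T w" x] by simp
  qed
qed


section \<open>Curvature of strongly convex functions and the mirror map as an inverse
  gradient\<close>

lemma strongly_convex_derivative_of_gradient:
  fixes f :: "'a::euclidean_space \<Rightarrow> real"
  assumes sc: "\<And>x y t. x \<in> S \<Longrightarrow> y \<in> S \<Longrightarrow> t \<in> {0..1} \<Longrightarrow> f ((1 - t) *\<^sub>R x + t *\<^sub>R y)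
      \<le> (1 - t) * f x + t * f y - \<mu> / 2 * t * (1 - t) * (norm (x - y))\<^sup>2"
    and G: "\<And>u. u \<in> interior S \<Longrightarrow> (f has_derivative (\<lambda>h. h \<bullet> G u)) (at u)"
    and x: "x \<in> interior S" and A: "(G has_derivative A) (at x)"
  shows "\<mu> * (norm h)\<^sup>2 \<le> h \<bullet> A h"
proof -
  obtain r where r: "0 < r" "ball x r \<subseteq> interior S"
    using x open_interior openE by blast
  have S: "u \<in> S" if "u \<in> interior S" for u using that interior_subset by blast
  show ?thesis
  proof (rule strongly_monotone_derivative[OF r(1) _ A])
    fix u assume "u \<in> ball x r"
    then have u: "u \<in> interior S" using r(2) by blast
    \<comment> \<open>Adding the first-order inequalities based at \<open>x\<close> and at
      \<open>u\<close> gives strong monotonicity of the gradient.\<close>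
    have "f x + (u - x) \<bullet> G x + \<mu> / 2 * (norm (x - u))\<^sup>2 \<le> f u"
      by (rule strongly_convex_first_order[OF sc[OF S[OF x] S[OF u]] G[OF x]])
    moreover have "f u + (x - u) \<bullet> G u + \<mu> / 2 * (norm (u - x))\<^sup>2 \<le> f x"
      by (rule strongly_convex_first_order[OF sc[OF S[OF u] S[OF x]] G[OF u]])
    moreover have "(x - u) \<bullet> G u = - ((u - x) \<bullet> G u)"
      using inner_minus_left[of "u - x" "G u"] by simp
    ultimately show "\<mu> * (norm (u - x))\<^sup>2 \<le> (u - x) \<bullet> (G u - G x)"
      unfolding inner_diff_right by (simp add: norm_minus_commute)
  qed
qed

text \<open>The gradient of the conjugate is a maximiser; when it is interior, it is a critical
  point of \<open>\<phi> y - y \<bullet> z\<close>.\<close>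

lemma gradient_gradient_conjugate:
  fixes \<phi> :: "'a::euclidean_space \<Rightarrow> real"
  assumes X: "compact X" "X \<noteq> {}" and \<phi>: "\<phi> differentiable_on X" "strongly_convex_on \<mu> X \<phi>"
    and z: "gradient UNIV (conjugate X \<phi>) z \<in> interior X"
  shows "gradient X \<phi> (gradient UNIV (conjugate X \<phi>) z) = z"
proof -
  let ?m = "gradient UNIV (conjugate X \<phi>) z"
  have cont: "continuous_on X \<phi>" by (rule differentiable_imp_continuous_on[OF \<phi>(1)])
  have "((\<lambda>y. \<phi> y - y \<bullet> z) has_derivative (\<lambda>h. h \<bullet> gradient X \<phi> ?m - h \<bullet> z)) (at ?m)"
    by (intro has_derivative_diff has_derivative_gradient[OF z \<phi>(1)]
        bounded_linear_imp_has_derivative bounded_linear_inner_left)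
  then have d: "((\<lambda>y. \<phi> y - y \<bullet> z) has_derivative (\<lambda>h. h \<bullet> (gradient X \<phi> ?m - z))) (at ?m)"
    by (simp only: inner_diff_right)
  have "gradient X \<phi> ?m - z = 0"
    by (rule interior_min_gradient_zero[OF z _ d])
      (use gradient_conjugate_max[OF X cont \<phi>(2), of _ z] in \<open>simp add: algebra_simps\<close>)
  then show ?thesis by simp
qed

text \<open>First-order strong convexity at \<open>x\<close> says that \<open>x\<close> maximises
  the dual objective for \<open>z = gradient X \<phi> x\<close> with a quadratic margin, so the
  maximiser cannot be another point.\<close>

lemma gradient_conjugate_gradient:
  fixes \<phi> :: "'a::euclidean_space \<Rightarrow> real"
  assumes X: "compact X" "X \<noteq> {}" and \<phi>: "\<phi> differentiable_on X" "strongly_convex_on \<mu> X \<phi>"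
    and x: "x \<in> interior X"
  shows "gradient UNIV (conjugate X \<phi>) (gradient X \<phi> x) = x"
proof -
  let ?z = "gradient X \<phi> x"
  let ?m = "gradient UNIV (conjugate X \<phi>) ?z"
  have cont: "continuous_on X \<phi>" by (rule differentiable_imp_continuous_on[OF \<phi>(1)])
  have \<mu>: "0 < \<mu>" using \<phi>(2) by (simp add: strongly_convex_on_def)
  have xX: "x \<in> X" using x interior_subset by blast
  have mX: "?m \<in> X" by (rule gradient_conjugate_mem[OF X cont \<phi>(2)])
  have "\<phi> x + (?m - x) \<bullet> ?z + \<mu> / 2 * (norm (x - ?m))\<^sup>2 \<le> \<phi> ?m"
  proof (rule strongly_convex_first_order[OF _ has_derivative_gradient[OF x \<phi>(1)]])
    show "\<phi> ((1 - t) *\<^sub>R x + t *\<^sub>R ?m)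
        \<le> (1 - t) * \<phi> x + t * \<phi> ?m - \<mu> / 2 * t * (1 - t) * (norm (x - ?m))\<^sup>2" if "t \<in> {0..1}" for t
      using \<phi>(2) xX mX that unfolding strongly_convex_on_def by blast
  qed
  moreover have "x \<bullet> ?z - \<phi> x \<le> ?m \<bullet> ?z - \<phi> ?m"
    by (rule gradient_conjugate_max[OF X cont \<phi>(2) xX])
  ultimately have "\<mu> / 2 * (norm (x - ?m))\<^sup>2 \<le> 0" unfolding inner_diff_left by linarith
  then have "(norm (x - ?m))\<^sup>2 \<le> 0" using \<mu> by (simp add: mult_le_0_iff)
  then show ?thesis by simp
qed

lemma gradient_conjugate_near:
  fixes \<phi> :: "'a::euclidean_space \<Rightarrow> real"
  assumes X: "compact X" "X \<noteq> {}" and \<phi>: "\<phi> differentiable_on X" "strongly_convex_on \<mu> X \<phi>"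
    and x: "x \<in> interior X"
  shows "norm (gradient UNIV (conjugate X \<phi>) z - x) \<le> 2 / \<mu> * norm (z - gradient X \<phi> x)"
  using gradient_conjugate_lipschitz[OF X differentiable_imp_continuous_on[OF \<phi>(1)] \<phi>(2), of z "gradient X \<phi> x"]
  by (simp only: gradient_conjugate_gradient[OF assms])

text \<open>An inverse map is differentiable where it is continuous and a right inverse nearby,
  provided the derivative of the original map is invertible. Continuity is the global Lipschitz
  bound; the same bound \<open>2 / \<mu>\<close> carries the radius \<open>r * \<mu> / 2\<close>
  into a ball inside \<open>X\<close>, where the maximisers are interior and the inversion formula
  holds.\<close>

lemma gradient_conjugate_has_derivative:
  fixes \<phi> :: "'a::euclidean_space \<Rightarrow> real"
  assumes X: "compact X" "X \<noteq> {}" and \<phi>: "\<phi> differentiable_on X" "strongly_convex_on \<mu> X \<phi>"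
    and x: "x \<in> interior X" and A: "(gradient X \<phi> has_derivative A) (at x)"
    and B: "linear B" "\<And>h. B (A h) = h"
  shows "(gradient UNIV (conjugate X \<phi>) has_derivative B) (at (gradient X \<phi> x))"
proof -
  let ?z = "gradient X \<phi> x" and ?m = "gradient UNIV (conjugate X \<phi>)"
  have \<mu>: "0 < \<mu>" using \<phi>(2) by (simp add: strongly_convex_on_def)
  have cont: "continuous_on X \<phi>" by (rule differentiable_imp_continuous_on[OF \<phi>(1)])
  obtain r where r: "0 < r" "ball x r \<subseteq> interior X"
    using x open_interior openE by blast
  have near: "?m z \<in> interior X" if z: "z \<in> ball ?z (r * \<mu> / 2)" for z
  proof -
    have "norm (?m z - x) \<le> 2 / \<mu> * norm (z - ?z)" by (rule gradient_conjugate_near[OF X \<phi> x])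
    also have "\<dots> < 2 / \<mu> * (r * \<mu> / 2)"
      using z \<mu> by (intro mult_strict_left_mono) (auto simp: dist_norm norm_minus_commute)
    also have "\<dots> = r" using \<mu> by simp
    finally show ?thesis using r(2) by (auto simp: dist_norm norm_minus_commute)
  qed
  have "(2 / \<mu>)-lipschitz_on UNIV ?m"
    using gradient_conjugate_lipschitz[OF X cont \<phi>(2)] \<mu> by (intro lipschitz_onI) (auto simp: dist_norm)
  then have "continuous_on UNIV ?m" by (rule lipschitz_on_continuous_on)
  then have "continuous (at ?z) ?m" by (simp add: continuous_on_eq_continuous_at)
  then show ?thesis
  proof (rule has_derivative_inverse_basic[where f = "gradient X \<phi>" and f' = A and T = "ball ?z (r * \<mu> / 2)", rotated 3])
    show "(gradient X \<phi> has_derivative A) (at (?m ?z))"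
      by (simp only: gradient_conjugate_gradient[OF X \<phi> x] A)
    show "bounded_linear B" using B(1) by (simp add: linear_linear)
    show "B \<circ> A = id" using B(2) by (simp add: fun_eq_iff)
    show "gradient X \<phi> (?m z) = z" if "z \<in> ball ?z (r * \<mu> / 2)" for z
      by (rule gradient_gradient_conjugate[OF X \<phi> near[OF that]])
  qed (use r \<mu> in auto)
qed

section \<open>Matrix estimates, the square root of the Laplacian and the padded matrix R\<close>

lemma inner_transpose_mult: "(transpose A *v x) \<bullet> y = x \<bullet> (A *v y)"
  for A :: "real^'n^'m"
  by (simp add: dot_lmul_matrix)

text \<open>The norm of a matrix is here the Euclidean norm of its entries, so Cauchy-Schwarz in
  each row suffices. It converts Lipschitz continuity of the matrix-valued Hessian into a bound on
  its action.\<close>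

lemma norm_matrix_vector_mult_le:
  fixes A :: "real^'n^'m"
  shows "norm (A *v x) \<le> norm A * norm x"
proof (rule power2_le_imp_le)
  have "(norm (A *v x))\<^sup>2 = (\<Sum>i\<in>UNIV. (A $ i \<bullet> x)\<^sup>2)"
    unfolding power2_norm_eq_inner
    by (simp add: inner_vec_def matrix_vector_mult_def power2_eq_square)
  also have "\<dots> \<le> (\<Sum>i\<in>UNIV. (norm (A $ i))\<^sup>2 * (norm x)\<^sup>2)"
  proof (rule sum_mono)
    fix i
    have "\<bar>A $ i \<bullet> x\<bar>\<^sup>2 \<le> (norm (A $ i) * norm x)\<^sup>2"
      by (rule power_mono[OF Cauchy_Schwarz_ineq2]) simp
    then show "(A $ i \<bullet> x)\<^sup>2 \<le> (norm (A $ i))\<^sup>2 * (norm x)\<^sup>2" by (simp add: power_mult_distrib)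
  qed
  also have "\<dots> = (norm A * norm x)\<^sup>2"
    unfolding power_mult_distrib sum_distrib_right[symmetric]
    by (simp add: power2_norm_eq_inner[of A] inner_vec_def[of A] power2_norm_eq_inner)
  finally show "(norm (A *v x))\<^sup>2 \<le> (norm A * norm x)\<^sup>2" .
qed simp

text \<open>Coercivity makes the square matrix injective, hence invertible, and only then does the
  choice in \<open>matrix_inv\<close> denote a two-sided inverse.\<close>

lemma positive_definite_matrix_inv:
  fixes A :: "real^'n^'n"
  assumes \<mu>: "0 < \<mu>" and A: "\<And>v. \<mu> * (norm v)\<^sup>2 \<le> v \<bullet> (A *v v)"
  shows "A *v (matrix_inv A *v v) = v" "matrix_inv A *v (A *v v) = v"
proof -
  have "inj ((*v) A)"
  proof (subst linear_injective_0[OF matrix_vector_mul_linear], intro allI impI)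
    fix x assume "A *v x = 0"
    then have "\<mu> * (norm x)\<^sup>2 \<le> 0" using A[of x] by simp
    then show "x = 0" using \<mu> by (simp add: mult_le_0_iff)
  qed
  then have "invertible A" by (simp only: invertible_left_inverse matrix_left_invertible_injective)
  then have "A ** matrix_inv A = mat 1 \<and> matrix_inv A ** A = mat 1"
    unfolding invertible_def matrix_inv_def by (rule someI_ex)
  then show "A *v (matrix_inv A *v v) = v" "matrix_inv A *v (A *v v) = v"
    by (simp_all add: matrix_vector_mul_assoc)
qed

text \<open>The zeroed column meets only the vanishing block, so on admissible vectors the padded
  matrix acts like the orthogonal \<open>Q\<close>.\<close>

lemma kron_drop_column_mult:
  assumes "block w k0 = 0"
  shows "slice (kron (drop_column k0 Q) (mat 1) *v w) a = Q *v slice w a"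
proof -
  have "w $ (k0, a) = 0" using arg_cong[OF assms, of "\<lambda>v. v $ a"] by (simp add: block_def)
  then have "drop_column k0 Q *v slice w a = Q *v slice w a"
    by (auto simp: vec_eq_iff matrix_vector_mult_def drop_column_def intro!: sum.cong)
  then show ?thesis by (simp add: slice_kron)
qed

text \<open>The padding column is zero; hence the velocity of the second variable stays in the
  admissible subspace.\<close>

lemma block_transpose_drop_column: "block (transpose (kron (drop_column k0 Q) (mat 1)) *v x) k0 = 0"
  by (simp add: block_def vec_eq_iff matrix_vector_mult_def transpose_def kron_def drop_column_def
      del: transpose_matrix_vector)

lemma psd_sqrt_inner:
  assumes "is_psd_sqrt S L"
  shows "x \<bullet> (L *v y) = (S *v x) \<bullet> (S *v y)" "S *v (S *v x) = L *v x" "(S *v x) \<bullet> y = x \<bullet> (S *v y)"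
proof -
  have S: "transpose S = S" "S ** S = L" using assms by (auto simp: is_psd_sqrt_def)
  have 3: "(S *v x) \<bullet> y = x \<bullet> (S *v y)" for x y
    using inner_transpose_mult[of S x y] by (simp only: S(1))
  have 2: "S *v (S *v x) = L *v x" for x by (simp add: matrix_vector_mul_assoc S(2))
  show "x \<bullet> (L *v y) = (S *v x) \<bullet> (S *v y)" by (simp only: 3 2)
  show "S *v (S *v x) = L *v x" "(S *v x) \<bullet> y = x \<bullet> (S *v y)" by (rule 2 3)+
qed

text \<open>If S R w = 0, then R w is a consensus direction; but the columns of R are orthogonal to
  the all-ones vector.\<close>

lemma sqrt_laplacian_reduced_injective:
  fixes w :: "real^('n::finite \<times> 'd::finite)"
  assumes E: "simple_graph E" "connected_graph E" and Q: "laplacian_eigenbasis E k0 Q lam"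
    and S: "is_psd_sqrt S (kron (laplacian E) (mat 1))"
    and w: "block w k0 = 0" "S *v (kron (drop_column k0 Q) (mat 1) *v w) = 0"
  shows "w = 0"
proof (rule slice_eqI)
  fix a
  let ?u = "kron (drop_column k0 Q) (mat 1) *v w"
  have "kron (laplacian E) (mat 1) *v ?u = 0"
    using psd_sqrt_inner(2)[OF S, of ?u] w(2) by simp
  then have cons: "block ?u i = block ?u j" for i j by (rule kron_laplacian_null_space[OF E])
  define \<omega> where "\<omega> = slice w a"
  have Q1: "transpose Q ** Q = mat 1" "column k0 Q = (\<chi> i. 1 / sqrt (real CARD('n)))"
    using Q by (auto simp: laplacian_eigenbasis_def orthogonal_matrix)
  have u: "Q *v \<omega> = slice ?u a" unfolding \<omega>_def by (rule kron_drop_column_mult[OF w(1), symmetric])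
  define c where "c = slice ?u a $ k0"
  have c: "Q *v \<omega> = (\<chi> i. c)"
    unfolding u c_def using cons[of _ k0] by (simp add: vec_eq_iff block_def)
  have QtQ: "transpose Q *v (Q *v \<omega>) = \<omega>"
    by (simp add: matrix_vector_mul_assoc Q1(1) del: transpose_matrix_vector)
  \<comment> \<open>The coordinate \<open>k0\<close> of \<open>\<omega>\<close> is computed twice:
    as the inner product of the constant vector \<open>Q *v \<omega>\<close> with the normalised
    all-ones vector, a nonzero multiple of \<open>c\<close>, and as 0 because block
    \<open>k0\<close> of \<open>w\<close> vanishes.\<close>
  have "(transpose Q *v (Q *v \<omega>)) $ k0 = column k0 Q \<bullet> (Q *v \<omega>)"
    by (simp add: matrix_vector_mult_def transpose_def column_def inner_vec_def del: transpose_matrix_vector)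
  also have "\<dots> = real CARD('n) * (1 / sqrt (real CARD('n)) * c)"
    by (simp add: Q1(2) c inner_vec_def)
  finally have "\<omega> $ k0 = real CARD('n) * (1 / sqrt (real CARD('n)) * c)" by (simp only: QtQ)
  moreover have "\<omega> $ k0 = 0" using arg_cong[OF w(1), of "\<lambda>v. v $ a"] by (simp add: \<omega>_def block_def)
  ultimately have "c = 0" by simp
  then have "Q *v \<omega> = 0" using c by (simp add: vec_eq_iff)
  then have "\<omega> = 0" using QtQ by simp
  then show "slice w a = slice 0 a" by (simp add: \<omega>_def)
qed

text \<open>Meant for a differential-algebraic system with a redundant component:
  \<open>\<Phi>\<close> drops it and \<open>\<Psi>\<close> rebuilds it, so
  \<open>\<Psi> (\<Phi> u) = u\<close> is demanded only on \<open>M'\<close> and along solutions. As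
  \<open>\<Phi>\<close> does not increase distances to the equilibrium, the same
  \<open>\<delta>\<close> serves; the Lipschitz constant \<open>k\<close> of \<open>\<Psi>\<close>
  multiplies \<open>c\<close>, and the rate is unchanged. Solutions are carried over only from
  starting points in \<open>M'\<close>, since the invariant set is entered through the initial
  value.\<close>

lemma locally_exp_stable_transfer:
  fixes \<Phi> :: "'b::real_normed_vector \<Rightarrow> 'a::real_normed_vector" and \<Psi> :: "'a \<Rightarrow> 'b"
  assumes stable: "locally_exp_stable sol M p"
    and to_sol: "\<And>J s. time_interval J \<Longrightarrow> sol' J s \<Longrightarrow> s 0 \<in> M' \<Longrightarrow> sol J (\<lambda>t. \<Phi> (s t))"
    and from_sol: "\<And>J v. sol J v \<Longrightarrow> sol' J (\<lambda>t. \<Psi> (v t))"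
    and inv_sol: "\<And>J s t. sol' J s \<Longrightarrow> t \<in> J \<Longrightarrow> \<Psi> (\<Phi> (s t)) = s t"
    and inv: "\<And>u. u \<in> M' \<Longrightarrow> \<Phi> u \<in> M" "\<And>u. u \<in> M' \<Longrightarrow> \<Psi> (\<Phi> u) = u"
    and bounds: "\<And>u. norm (\<Phi> u - p) \<le> norm (u - \<Psi> p)" "0 < k" "\<And>v. norm (\<Psi> v - \<Psi> p) \<le> k * norm (v - p)"
    and p: "\<Psi> p \<in> M'"
  shows "locally_exp_stable sol' M' (\<Psi> p)"
proof -
  obtain \<delta> c \<kappa> where pos: "0 < \<delta>" "0 < c" "0 < \<kappa>"
    and all: "\<forall>s0\<in>M. norm (s0 - p) \<le> \<delta> \<longrightarrow> (\<exists>s. sol {0..} s \<and> s 0 = s0) \<and>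
        (\<forall>J s. time_interval J \<and> sol J s \<and> s 0 = s0 \<longrightarrow>
           (\<exists>s'. sol {0..} s' \<and> (\<forall>t\<in>J. s' t = s t)) \<and>
           (\<forall>t\<in>J. norm (s t - p) \<le> c * exp (- \<kappa> * t) * norm (s0 - p)))"
    using stable unfolding locally_exp_stable_def by (elim conjE exE, intro that)
  have ex: "\<exists>s. sol {0..} s \<and> s 0 = s0" if "s0 \<in> M" "norm (s0 - p) \<le> \<delta>" for s0
    using all that by simp
  have "(\<exists>s'. sol {0..} s' \<and> (\<forall>t\<in>J. s' t = s t)) \<and>
      (\<forall>t\<in>J. norm (s t - p) \<le> c * exp (- \<kappa> * t) * norm (s0 - p))"
    if "s0 \<in> M" "norm (s0 - p) \<le> \<delta>" "time_interval J" "sol J s" "s 0 = s0" for s0 J s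
    using all that by simp
  then have ext: "\<And>s0 J s. s0 \<in> M \<Longrightarrow> norm (s0 - p) \<le> \<delta> \<Longrightarrow> time_interval J \<Longrightarrow> sol J s \<Longrightarrow> s 0 = s0 \<Longrightarrow>
        \<exists>s'. sol {0..} s' \<and> (\<forall>t\<in>J. s' t = s t)"
    and dec: "\<And>s0 J s t. s0 \<in> M \<Longrightarrow> norm (s0 - p) \<le> \<delta> \<Longrightarrow> time_interval J \<Longrightarrow> sol J s \<Longrightarrow> s 0 = s0 \<Longrightarrow>
        t \<in> J \<Longrightarrow> norm (s t - p) \<le> c * exp (- \<kappa> * t) * norm (s0 - p)"
    by simp_all
  have "sol {0..} (\<lambda>_. p)" using stable by (simp add: locally_exp_stable_def)
  then have const: "sol' {0..} (\<lambda>_. \<Psi> p)" by (rule from_sol)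
  have kc: "0 < k * c" using bounds(2) pos by simp
  have main: "(\<exists>s. sol' {0..} s \<and> s 0 = s0) \<and>
        (\<forall>J s. time_interval J \<and> sol' J s \<and> s 0 = s0 \<longrightarrow>
           (\<exists>s'. sol' {0..} s' \<and> (\<forall>t\<in>J. s' t = s t)) \<and>
           (\<forall>t\<in>J. norm (s t - \<Psi> p) \<le> k * c * exp (- \<kappa> * t) * norm (s0 - \<Psi> p)))"
    if s0: "s0 \<in> M'" "norm (s0 - \<Psi> p) \<le> \<delta>" for s0
  proof -
    have \<Phi>0: "\<Phi> s0 \<in> M" "norm (\<Phi> s0 - p) \<le> \<delta>"
      using inv(1)[OF s0(1)] bounds(1)[of s0] s0(2) by auto
    obtain v where v: "sol {0..} v" "v 0 = \<Phi> s0" using ex[OF \<Phi>0] by blast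
    have 1: "\<exists>s. sol' {0..} s \<and> s 0 = s0"
      using from_sol[OF v(1)] v(2) inv(2)[OF s0(1)] by (intro exI[of _ "\<lambda>t. \<Psi> (v t)"]) simp
    have 2: "\<exists>s'. sol' {0..} s' \<and> (\<forall>t\<in>J. s' t = s t)" and
      3: "\<And>t. t \<in> J \<Longrightarrow> norm (s t - \<Psi> p) \<le> k * c * exp (- \<kappa> * t) * norm (s0 - \<Psi> p)"
      if J: "time_interval J" and s: "sol' J s" "s 0 = s0" for J s
    proof -
      have \<Phi>s: "sol J (\<lambda>t. \<Phi> (s t))" using to_sol[OF J s(1)] s(2) s0(1) by simp
      have \<Phi>s0: "\<Phi> (s 0) = \<Phi> s0" by (simp add: s(2))
      obtain v' where v': "sol {0..} v'" "\<forall>t\<in>J. v' t = \<Phi> (s t)"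
        using ext[OF \<Phi>0 J \<Phi>s \<Phi>s0] by blast
      show "\<exists>s'. sol' {0..} s' \<and> (\<forall>t\<in>J. s' t = s t)"
        using from_sol[OF v'(1)] v'(2) inv_sol[OF s(1)] by (intro exI[of _ "\<lambda>t. \<Psi> (v' t)"]) simp
      fix t assume t: "t \<in> J"
      have "norm (s t - \<Psi> p) \<le> k * norm (\<Phi> (s t) - p)"
        using bounds(3)[of "\<Phi> (s t)"] inv_sol[OF s(1) t] by simp
      also have "\<dots> \<le> k * (c * exp (- \<kappa> * t) * norm (\<Phi> s0 - p))"
        using bounds(2) by (intro mult_left_mono dec[OF \<Phi>0 J \<Phi>s \<Phi>s0 t]) simp
      also have "\<dots> \<le> k * (c * exp (- \<kappa> * t) * norm (s0 - \<Psi> p))"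
        using bounds(2) pos by (intro mult_left_mono bounds(1)) auto
      finally show "norm (s t - \<Psi> p) \<le> k * c * exp (- \<kappa> * t) * norm (s0 - \<Psi> p)"
        by (simp only: mult.assoc)
    qed
    show ?thesis using 1 2 3 by blast
  qed
  show ?thesis
    unfolding locally_exp_stable_def
  proof (intro conjI p const)
    show "\<exists>\<delta>>0. \<exists>c>0. \<exists>\<kappa>>0. \<forall>s0\<in>M'. norm (s0 - \<Psi> p) \<le> \<delta> \<longrightarrow> (\<exists>s. sol' {0..} s \<and> s 0 = s0) \<and>
        (\<forall>J s. time_interval J \<and> sol' J s \<and> s 0 = s0 \<longrightarrow>
           (\<exists>s'. sol' {0..} s' \<and> (\<forall>t\<in>J. s' t = s t)) \<and>
           (\<forall>t\<in>J. norm (s t - \<Psi> p) \<le> c * exp (- \<kappa> * t) * norm (s0 - \<Psi> p)))"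
      by (rule exI[of _ \<delta>], rule conjI[OF pos(1)], rule exI[of _ "k * c"], rule conjI[OF kc],
          rule exI[of _ \<kappa>], rule conjI[OF pos(3)], intro ballI impI main)
  qed
qed


lemma ex_pair_components:
  "(\<exists>x y. s = (\<lambda>t. (x t, y t)) \<and> Q x y) \<longleftrightarrow> Q (\<lambda>t. fst (s t)) (\<lambda>t. snd (s t))"
proof
  assume "Q (\<lambda>t. fst (s t)) (\<lambda>t. snd (s t))"
  then show "\<exists>x y. s = (\<lambda>t. (x t, y t)) \<and> Q x y"
    by (intro exI[of _ "\<lambda>t. fst (s t)"] exI[of _ "\<lambda>t. snd (s t)"]) simp
qed auto

lemma has_vector_derivative_pair_iff:
  "(s has_vector_derivative d) (at t within J) \<longleftrightarrow>
    ((\<lambda>t. fst (s t)) has_vector_derivative fst d) (at t within J) \<and>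
    ((\<lambda>t. snd (s t)) has_vector_derivative snd d) (at t within J)"
proof
  assume "(s has_vector_derivative d) (at t within J)"
  then show "((\<lambda>t. fst (s t)) has_vector_derivative fst d) (at t within J) \<and>
      ((\<lambda>t. snd (s t)) has_vector_derivative snd d) (at t within J)"
    by (intro conjI bounded_linear.has_vector_derivative[OF bounded_linear_fst]
        bounded_linear.has_vector_derivative[OF bounded_linear_snd])
next
  assume *: "((\<lambda>t. fst (s t)) has_vector_derivative fst d) (at t within J) \<and>
      ((\<lambda>t. snd (s t)) has_vector_derivative snd d) (at t within J)"
  have "((\<lambda>t. (fst (s t), snd (s t))) has_derivative (\<lambda>h. (h *\<^sub>R fst d, h *\<^sub>R snd d))) (at t within J)"
    using * unfolding has_vector_derivative_def by (intro has_derivative_Pair) blast+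
  moreover have "(\<lambda>h. (h *\<^sub>R fst d, h *\<^sub>R snd d)) = (\<lambda>h. h *\<^sub>R d)" by (simp add: scaleR_prod_def)
  ultimately show "(s has_vector_derivative d) (at t within J)"
    by (simp add: has_vector_derivative_def)
qed

theorem theorem2:
  fixes X :: "(real^'d) set"
    and f :: "'n::finite \<Rightarrow> real^'d \<Rightarrow> real"
    and \<phi> :: "real^'d \<Rightarrow> real" and \<mu>\<^sub>\<phi> :: real
    and xstar :: "real^'d"
    and E :: "'n set set"
    and Q :: "real^'n^'n" and lam :: "'n \<Rightarrow> real" and k0 :: 'n
    and L S R :: "real^('n \<times> 'd)^('n \<times> 'd)"
    and xs ys zs :: "real^('n \<times> 'd)"
  assumes X: "compact X" "convex X"
    and f_convex: "\<And>i. convex_on X (f i)"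
    and f_diff: "\<And>i. f i differentiable_on X"
    and F_strong: "\<exists>\<mu>. strongly_convex_on \<mu> X (\<lambda>x. \<Sum>i\<in>UNIV. f i x)"
    and xstar: "\<And>x. is_arg_min (\<lambda>x. \<Sum>i\<in>UNIV. f i x) (\<lambda>x. x \<in> X) x \<longleftrightarrow> x = xstar"
    and f_C1: "\<And>i. C1_around X (gradient X (f i)) xstar"
    and graph: "simple_graph E" "connected_graph E"
    and phi_closed: "closed (epigraph X \<phi>)"
    and phi_diff: "\<phi> differentiable_on X"
    and phi_strong: "strongly_convex_on \<mu>\<^sub>\<phi> X \<phi>"
    and phi_hessian: "\<forall>\<^sub>F x in nhds xstar. gradient X \<phi> differentiable (at x)"
      "C1_around X (hessian X \<phi>) xstar"
    and Q: "laplacian_eigenbasis E k0 Q lam"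
    and L_eq: "L = kron (laplacian E) (mat 1)"
    and S_sqrt: "is_psd_sqrt S L"
    and R_eq: "R = kron (drop_column k0 Q) (mat 1)"
    and xs_eq: "xs = col (\<lambda>_. xstar)"
    and ys_eq: "ys = - stacked_gradient X f xs"
    and zs_eq: "zs = col (\<lambda>_. gradient X \<phi> xstar)"
  shows "locally_exp_stable (centered_solution X f \<phi> xs L S R k0) (centered_states k0) (0, 0)
    \<and> locally_exp_stable (mirror_descent_solution X f \<phi> L) (mirror_descent_states X \<phi>) (xs, ys, zs)
    \<and> (\<forall>J s. time_interval J \<and> mirror_descent_solution X f \<phi> L J s
          \<and> s 0 \<in> mirror_descent_states X \<phi> \<longrightarrow> (\<forall>t\<in>J. s t \<in> mirror_descent_states X \<phi>))"
proof -
  have \<mu>: "0 < \<mu>\<^sub>\<phi>" using phi_strong by (simp add: strongly_convex_on_def)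
  have "is_arg_min (\<lambda>x. \<Sum>i\<in>UNIV. f i x) (\<lambda>x. x \<in> X) xstar" by (simp add: xstar)
  then have xsX: "xstar \<in> X" and F_min: "\<And>y. y \<in> X \<Longrightarrow> (\<Sum>i\<in>UNIV. f i xstar) \<le> (\<Sum>i\<in>UNIV. f i y)"
    by (auto simp: is_arg_min_def not_less)
  have ne: "X \<noteq> {}" using xsX by blast
  have phi_cont: "continuous_on X \<phi>" by (rule differentiable_imp_continuous_on[OF phi_diff])

  \<comment> \<open>Local regularity around the minimiser\<close>
  have "\<exists>r l. 0 < r \<and> l-lipschitz_on (cball xstar r) (gradient X (f i)) \<and>
      gradient X (f i) differentiable (at xstar)" for i
    by (rule C1_around_lipschitz[OF f_C1[of i]]) (metis centre_in_cball less_imp_le)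
  then obtain rf lf where rf: "\<And>i. 0 < rf i" "\<And>i. (lf i)-lipschitz_on (cball xstar (rf i)) (gradient X (f i))"
    and f_diff2: "\<And>i. gradient X (f i) differentiable (at xstar)"
    by metis
  obtain rh lh where rh: "0 < rh" "cball xstar rh \<subseteq> X" "lh-lipschitz_on (cball xstar rh) (hessian X \<phi>)"
    by (rule C1_around_lipschitz[OF phi_hessian(2)])
  obtain re where re: "0 < re" "\<And>x. dist x xstar < re \<Longrightarrow> gradient X \<phi> differentiable (at x)"
    using phi_hessian(1) unfolding eventually_nhds_metric by blast
  \<comment> \<open>One radius for all estimates. Halving \<open>rh\<close> and \<open>re\<close>
    puts the closed ball inside the open balls on which points are interior and the mirror gradient
    is differentiable; the balls of radius \<open>rf i\<close> are closed already.\<close>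
  define \<rho> where "\<rho> = Min (insert (rh / 2) (insert (re / 2) (range rf)))"
  have \<rho>: "0 < \<rho>" using rh(1) re(1) rf(1) by (simp add: \<rho>_def)
  have \<rho>_le: "\<rho> \<le> rh / 2" "\<rho> \<le> re / 2" "\<rho> \<le> rf i" for i
    unfolding \<rho>_def by (rule Min_le; simp)+
  have "ball xstar rh \<subseteq> interior X"
    using rh(2) ball_subset_cball by (intro interior_maximal open_ball) blast
  then have int: "u \<in> interior X" if "u \<in> cball xstar \<rho>" for u
    using that \<rho>_le(1) rh(1) by (force simp: subset_iff)
  have xs_int: "xstar \<in> interior X" by (rule int) (use \<rho> in simp)
  define l where "l = (\<Sum>i\<in>UNIV. lf i)"
  have lf0: "0 \<le> lf i" for i by (rule lipschitz_on_nonneg[OF rf(2)])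
  have f_lip: "l-lipschitz_on (cball xstar \<rho>) (gradient X (f i))" for i
  proof (rule lipschitz_on_mono[OF rf(2)])
    show "cball xstar \<rho> \<subseteq> cball xstar (rf i)" using \<rho>_le(3)[of i] by (simp add: subset_cball)
    show "lf i \<le> l" unfolding l_def by (rule member_le_sum) (use lf0 in auto)
  qed
  have l0: "0 \<le> l" by (rule lipschitz_on_nonneg[OF f_lip])
  have h_lip: "lh-lipschitz_on (cball xstar \<rho>) (hessian X \<phi>)"
    by (rule lipschitz_on_subset[OF rh(3)]) (use \<rho>_le(1) rh(1) in auto)
  have h_deriv: "(gradient X \<phi> has_derivative (\<lambda>h. hessian X \<phi> u *v h)) (at u)" if "u \<in> cball xstar \<rho>" for u
  proof -
    have "gradient X \<phi> differentiable (at u)"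
      by (rule re(2)) (use that \<rho>_le(2) re(1) in \<open>auto simp: dist_commute\<close>)
    then show ?thesis
      using at_within_interior[OF int[OF that]] by (simp add: hessian_def jacobian_works)
  qed
  have phi_sc: "\<phi> ((1 - t) *\<^sub>R x + t *\<^sub>R y)
      \<le> (1 - t) * \<phi> x + t * \<phi> y - \<mu>\<^sub>\<phi> / 2 * t * (1 - t) * (norm (x - y))\<^sup>2"
    if "x \<in> X" "y \<in> X" "t \<in> {0..1}" for x y t
    using phi_strong that unfolding strongly_convex_on_def by blast
  have h_pos: "\<mu>\<^sub>\<phi> * (norm h)\<^sup>2 \<le> h \<bullet> (hessian X \<phi> u *v h)" if "u \<in> cball xstar \<rho>" for u h
    by (rule strongly_convex_derivative_of_gradient[OF phi_sc has_derivative_gradient[OF _ phi_diff]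
          int[OF that] h_deriv[OF that]])
  define M0 where "M0 = hessian X \<phi> xstar"
  \<comment> \<open>Symmetry is established at \<open>xstar\<close> only: the Lyapunov form is built
    from the Hessian at the equilibrium, and nearby Hessians enter as perturbations.\<close>
  have M0_sym: "(M0 *v u) \<bullet> v = u \<bullet> (M0 *v v)" for u v
  proof -
    have "xstar \<in> cball xstar \<rho>" using \<rho> by simp
    moreover have "ball xstar \<rho> \<subseteq> cball xstar \<rho>" by (rule ball_subset_cball)
    ultimately show ?thesis
      unfolding M0_def
      by (intro derivative_of_gradient_symmetric[OF \<rho> has_derivative_gradient[OF int phi_diff] h_deriv]) auto
  qed

  \<comment> \<open>Curvature of the objectives at the minimiser\<close>
  obtain A where A: "\<And>i. (gradient X (f i) has_derivative A i) (at xstar)"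
    using f_diff2 unfolding differentiable_def by metis
  have A_pos: "0 \<le> h \<bullet> A i h" for i h
  proof -
    \<comment> \<open>Plain convexity is the inequality with modulus 0.\<close>
    have "0 * (norm h)\<^sup>2 \<le> h \<bullet> A i h"
      by (rule strongly_convex_derivative_of_gradient[OF _ has_derivative_gradient[OF _ f_diff] xs_int A])
        (use convex_onD[OF f_convex] in auto)
    then show ?thesis by simp
  qed
  obtain \<mu>\<^sub>F where F_sc: "strongly_convex_on \<mu>\<^sub>F X (\<lambda>x. \<Sum>i\<in>UNIV. f i x)" using F_strong by blast
  have \<mu>F: "0 < \<mu>\<^sub>F" using F_sc by (simp add: strongly_convex_on_def)
  have F_deriv: "((\<lambda>x. \<Sum>i\<in>UNIV. f i x) has_derivative (\<lambda>h. h \<bullet> (\<Sum>i\<in>UNIV. gradient X (f i) u))) (at u)"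
    if "u \<in> interior X" for u
    unfolding inner_sum_right by (intro has_derivative_sum has_derivative_gradient[OF that f_diff])
  have A_sum: "\<mu>\<^sub>F * (norm h)\<^sup>2 \<le> h \<bullet> (\<Sum>i\<in>UNIV. A i h)" for h
    by (rule strongly_convex_derivative_of_gradient[OF _ F_deriv xs_int has_derivative_sum[OF A]])
      (use F_sc in \<open>auto simp: strongly_convex_on_def\<close>)
  \<comment> \<open>The minimiser is interior, since \<open>C1_around\<close> supplies a
    neighbourhood inside \<open>X\<close>; so the summed gradient vanishes there. This is what
    places \<open>ys\<close> among the vectors with block sum 0.\<close>
  have grad_sum: "(\<Sum>i\<in>UNIV. gradient X (f i) xstar) = 0"
    by (rule interior_min_gradient_zero[OF xs_int F_min F_deriv[OF xs_int]])

  \<comment> \<open>The Laplacian on stacked vectors\<close>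
  have block_xs: "block xs i = xstar" for i by (simp add: xs_eq)
  have L_xs: "L *v xs = 0" unfolding L_eq xs_eq by (rule kron_laplacian_consensus[OF graph(1)])
  note S_L = psd_sqrt_inner[OF S_sqrt]
  have L_sym: "(L *v u) \<bullet> v = u \<bullet> (L *v v)" for u v
    using S_L(1)[of u v] S_L(1)[of v u] by (simp add: inner_commute)
  have L_psd: "0 \<le> x \<bullet> (L *v x)" for x by (simp add: S_L(1))
  have L_null: "\<exists>c. x = col (\<lambda>_. c)" if "x \<bullet> (L *v x) = 0" for x
  proof -
    \<comment> \<open>The quadratic form of \<open>L\<close> at \<open>x\<close> is the squared norm
      of \<open>S *v x\<close>, so its zeros are null vectors of \<open>L\<close>.\<close>
    have "S *v x = 0" using that by (simp add: S_L(1))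
    then have "L *v x = 0" using S_L(2)[of x] by simp
    then have "block x i = block x k0" for i
      unfolding L_eq by (rule kron_laplacian_null_space[OF graph])
    then show ?thesis by (intro exI[of _ "block x k0"] block_eqI) simp
  qed
  have L_sum: "(\<Sum>i\<in>UNIV. block (L *v x) i) = 0" for x
  proof -
    let ?s = "\<Sum>i\<in>UNIV. block (L *v x) i"
    \<comment> \<open>The block sum is tested against the consensus vector with value
      \<open>?s\<close> itself, which \<open>L\<close> annihilates.\<close>
    have "?s \<bullet> ?s = (L *v col (\<lambda>_. ?s)) \<bullet> x"
      unfolding L_sym by (rule inner_consensus[symmetric])
    also have "\<dots> = 0" unfolding L_eq by (simp add: kron_laplacian_consensus[OF graph(1)])
    finally show ?thesis by simp
  qed
  have linL: "linear ((*v) L)" by (rule matrix_vector_mul_linear)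
  obtain lL where lL: "0 < lL" "\<And>x. norm (L *v x) \<le> lL * norm x"
    using linear_bounded_pos[OF linL] by blast

  \<comment> \<open>The centred force and its linearisation\<close>
  define Gf where "Gf = (\<lambda>x :: real^('n \<times> 'd). col (\<lambda>i. gradient X (f i) (block x i + xstar)))"
  have Gf: "stacked_gradient X f (x + xs) = Gf x" for x
    by (simp add: stacked_gradient_def Gf_def block_xs)
  have ys: "ys = - Gf 0" using Gf[of 0] by (simp add: ys_eq)
  define g where "g = (\<lambda>x. Gf x - Gf 0 + L *v x)"
  define H where "H = (\<lambda>x :: real^('n \<times> 'd). col (\<lambda>i. A i (block x i)) + L *v x)"
  have shift: "((\<lambda>y. y + xstar) has_derivative (\<lambda>h. h)) (at 0)"
    by (auto intro!: derivative_eq_intros)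
  have Gf_deriv: "(Gf has_derivative (\<lambda>h. col (\<lambda>i. A i (block h i)))) (at 0)"
    unfolding Gf_def
  proof (rule stacked_has_derivative)
    show "((\<lambda>y. gradient X (f i) (y + xstar)) has_derivative A i) (at (block 0 i))" for i
      using has_derivative_compose[OF shift, of "gradient X (f i)" "A i"] A[of i] by simp
  qed
  have g_deriv: "(g has_derivative H) (at 0)"
    unfolding g_def H_def
    by (rule has_derivative_add[OF has_derivative_diff[OF Gf_deriv has_derivative_const, simplified]
          linear_imp_has_derivative[OF linL]])
  have linH: "linear H" by (rule has_derivative_linear[OF g_deriv])
  have in_cball: "block x i + xstar \<in> cball xstar \<rho>" if "x \<in> cball 0 \<rho>" for x :: "real^('n \<times> 'd)" and i
    using that norm_block_le[of x i] by (simp add: dist_norm)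
  have Gf_lip: "norm (Gf x - Gf y) \<le> l * norm (x - y)"
    if "x \<in> cball 0 \<rho>" "y \<in> cball 0 \<rho>" for x y
  proof -
    have "l-lipschitz_on {y. y + xstar \<in> cball xstar \<rho>} (\<lambda>y. gradient X (f i) (y + xstar))" for i
      using l0 lipschitz_onD[OF f_lip] by (intro lipschitz_onI) (fastforce simp: dist_norm)+
    then have "l-lipschitz_on {x. \<forall>i. block x i \<in> {y. y + xstar \<in> cball xstar \<rho>}} Gf"
      unfolding Gf_def by (rule stacked_lipschitz)
    then show ?thesis using in_cball that by (intro lipschitz_on_normD) blast+
  qed
  have g_lip: "(l + lL)-lipschitz_on (cball 0 \<rho>) g"
  proof (rule lipschitz_onI)
    fix x y :: "real^('n \<times> 'd)" assume xy: "x \<in> cball 0 \<rho>" "y \<in> cball 0 \<rho>"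
    have "g x - g y = (Gf x - Gf y) + L *v (x - y)"
      by (simp add: g_def matrix_vector_mult_diff_distrib)
    then have "norm (g x - g y) \<le> norm (Gf x - Gf y) + norm (L *v (x - y))"
      using norm_triangle_ineq[of "Gf x - Gf y" "L *v (x - y)"] by simp
    also have "\<dots> \<le> l * norm (x - y) + lL * norm (x - y)" by (intro add_mono Gf_lip xy lL)
    finally show "dist (g x) (g y) \<le> (l + lL) * dist x y" by (simp add: dist_norm distrib_right)
  qed (use l0 lL in simp)
  have g0: "g 0 = 0" by (simp add: g_def)
  have H_pos: "0 < x \<bullet> H x" if x: "x \<noteq> 0" for x
  proof -
    have eq: "x \<bullet> H x = (\<Sum>i\<in>UNIV. block x i \<bullet> A i (block x i)) + x \<bullet> (L *v x)"
      by (simp add: H_def inner_add_right inner_stacked[of x "col _"])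
    have nn: "0 \<le> (\<Sum>i\<in>UNIV. block x i \<bullet> A i (block x i))" by (intro sum_nonneg A_pos)
    show ?thesis
    proof (rule ccontr)
      assume "\<not> 0 < x \<bullet> H x"
      then have 0: "x \<bullet> (L *v x) = 0" "(\<Sum>i\<in>UNIV. block x i \<bullet> A i (block x i)) = 0"
        using eq nn L_psd[of x] by linarith+
      obtain c where c: "x = col (\<lambda>_. c)" using L_null[OF 0(1)] by blast
      have "\<mu>\<^sub>F * (norm c)\<^sup>2 \<le> 0" using A_sum[of c] 0(2) by (simp add: c inner_sum_right)
      then have "c = 0" using \<mu>F by (simp add: mult_le_0_iff)
      then have "x = 0" by (intro block_eqI) (simp add: c)
      then show False using x by simp
    qed
  qed
  obtain h where h: "0 < h" "\<And>x. h * (norm x)\<^sup>2 \<le> x \<bullet> H x"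
    using quadratic_form_bounded_below[OF linH H_pos] by blast

  \<comment> \<open>The stacked Hessian and its inverse near the equilibrium\<close>
  define M where "M = (\<lambda>x v :: real^('n \<times> 'd). stacked_hessian X \<phi> (x + xs) *v v)"
  define N where "N = (\<lambda>x v :: real^('n \<times> 'd). matrix_inv (stacked_hessian X \<phi> (x + xs)) *v v)"
  have M_col: "M x v = col (\<lambda>i. hessian X \<phi> (block x i + xstar) *v block v i)" for x v
    by (simp add: M_def stacked_hessian_def block_diag_mult block_xs)
  have linM: "linear (M x)" for x unfolding M_def by (rule matrix_vector_mul_linear)
  have linN: "linear (N x)" for x unfolding N_def by (rule matrix_vector_mul_linear)
  have M_pos: "\<mu>\<^sub>\<phi> * (norm v)\<^sup>2 \<le> v \<bullet> M x v" if "x \<in> cball 0 \<rho>" for x v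
  proof -
    have "\<mu>\<^sub>\<phi> * (norm v)\<^sup>2 = (\<Sum>i\<in>UNIV. \<mu>\<^sub>\<phi> * (norm (block v i))\<^sup>2)"
      by (simp add: norm_stacked sum_distrib_left)
    also have "\<dots> \<le> v \<bullet> M x v"
      unfolding inner_stacked M_col block_col by (intro sum_mono h_pos in_cball that)
    finally show ?thesis .
  qed
  have MN: "M x (N x v) = v" if "x \<in> cball 0 \<rho>" for x v
    using positive_definite_matrix_inv(1)[OF \<mu>, of "stacked_hessian X \<phi> (x + xs)"] M_pos[OF that]
    by (simp add: M_def N_def)
  have M_lip: "norm (M x v - M y v) \<le> lh * norm (x - y) * norm v"
    if xy: "x \<in> cball 0 \<rho>" "y \<in> cball 0 \<rho>" for x y v
  proof (rule power2_le_imp_le)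
    have lh0: "0 \<le> lh" by (rule lipschitz_on_nonneg[OF h_lip])
    then show "0 \<le> lh * norm (x - y) * norm v" by simp
    have "(norm (M x v - M y v))\<^sup>2 = (\<Sum>i\<in>UNIV. (norm ((hessian X \<phi> (block x i + xstar)
        - hessian X \<phi> (block y i + xstar)) *v block v i))\<^sup>2)"
      by (simp add: norm_stacked M_col matrix_vector_mult_diff_rdistrib)
    also have "\<dots> \<le> (\<Sum>i\<in>UNIV. (lh * norm (x - y) * norm (block v i))\<^sup>2)"
    proof (intro sum_mono power_mono)
      fix i
      have "norm ((hessian X \<phi> (block x i + xstar) - hessian X \<phi> (block y i + xstar)) *v block v i)
          \<le> norm (hessian X \<phi> (block x i + xstar) - hessian X \<phi> (block y i + xstar)) * norm (block v i)"
        by (rule norm_matrix_vector_mult_le)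
      also have "\<dots> \<le> lh * norm (x - y) * norm (block v i)"
      proof (rule mult_right_mono)
        have "norm (hessian X \<phi> (block x i + xstar) - hessian X \<phi> (block y i + xstar))
            \<le> lh * norm ((block x i + xstar) - (block y i + xstar))"
          by (rule lipschitz_on_normD[OF h_lip in_cball[OF xy(1)] in_cball[OF xy(2)]])
        also have "\<dots> \<le> lh * norm (x - y)"
          using norm_block_le[of "x - y" i] lh0 by (intro mult_left_mono) simp_all
        finally show "norm (hessian X \<phi> (block x i + xstar) - hessian X \<phi> (block y i + xstar)) \<le> lh * norm (x - y)" .
      qed simp
      finally show "norm ((hessian X \<phi> (block x i + xstar) - hessian X \<phi> (block y i + xstar)) *v block v i)
          \<le> lh * norm (x - y) * norm (block v i)" .
    qed simp
    also have "\<dots> = (lh * norm (x - y) * norm v)\<^sup>2"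
      by (simp add: norm_stacked[of v] power_mult_distrib sum_distrib_left)
    finally show "(norm (M x v - M y v))\<^sup>2 \<le> (lh * norm (x - y) * norm v)\<^sup>2" .
  qed
  have M_sym: "M 0 u \<bullet> v = u \<bullet> M 0 v" for u v
    using M0_sym by (simp add: inner_stacked M_col M0_def)
  have zero: "0 \<in> cball 0 \<rho>" using \<rho> by simp

  \<comment> \<open>Stability of the centred system\<close>
  have part1: "locally_exp_stable (centered_solution X f \<phi> xs L S R k0) (centered_states k0) (0, 0)"
  proof -
    define B where "B = (\<lambda>w. S *v (R *v w))"
    define C where "C = (\<lambda>x. transpose R *v (S *v x))"
    define K where "K = {w :: real^('n \<times> 'd). block w k0 = 0}"
    have K: "subspace K" by (auto simp: subspace_def K_def)
    have linB: "linear B"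
      using linear_compose[OF matrix_vector_mul_linear matrix_vector_mul_linear] by (simp add: B_def comp_def)
    have linC: "linear C"
      using linear_compose[OF matrix_vector_mul_linear matrix_vector_mul_linear]
      by (simp add: C_def comp_def del: transpose_matrix_vector)
    \<comment> \<open>In finite dimension injectivity on the subspace \<open>K\<close> already
      yields the lower bound \<open>b\<close>.\<close>
    have "\<forall>w\<in>K. B w = 0 \<longrightarrow> w = 0"
      using sqrt_laplacian_reduced_injective[OF graph Q S_sqrt[unfolded L_eq]]
      by (auto simp: K_def B_def R_eq)
    then obtain b where b: "0 < b" "\<And>w. w \<in> K \<Longrightarrow> b * norm w \<le> norm (B w)"
      using injective_imp_isometric[OF closed_subspace[OF K] K linear_conv_bounded_linear[THEN iffD1, OF linB]] by auto
    define F where "F = (\<lambda>v. (- N (fst v) (g (fst v) + B (snd v)), C (fst v)))"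
    have stable: "locally_exp_stable (\<lambda>J v. \<forall>t\<in>J. v t \<in> {v. snd v \<in> K} \<and>
        (v has_vector_derivative F (v t)) (at t within J)) {v. snd v \<in> K} 0"
      unfolding F_def
    proof (rule implicit_saddle_system_stable[where M = M and m = \<mu>\<^sub>\<phi> and k = lh and h = h and H = H and b = b
          and r = \<rho> and l = "l + lL"])
      show "w \<bullet> C x = B w \<bullet> x" for w x
        using inner_transpose_mult[of R "S *v x" w] S_L(3)[of "R *v w" x]
        by (simp add: B_def C_def inner_commute del: transpose_matrix_vector)
      show "C x \<in> K" for x
        unfolding K_def C_def R_eq using block_transpose_drop_column by blast
    qed (use \<rho> K linM \<mu> M_pos M_lip M_sym MN linN g_lip g0 g_deriv h linB linC b in blast)+
    \<comment> \<open>The two solution relations coincide for every interval and every curve, so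
      stability passes over by rewriting, without a change of variables.\<close>
    have "centered_solution X f \<phi> xs L S R k0 J s \<longleftrightarrow> (\<forall>t\<in>J. s t \<in> {v. snd v \<in> K} \<and>
        (s has_vector_derivative F (s t)) (at t within J))" for J s
    proof -
      have pair: "(s has_vector_derivative d) (at t within J) \<longleftrightarrow>
          ((\<lambda>t. fst (s t)) has_vector_derivative fst d) (at t within J) \<and>
          ((\<lambda>t. snd (s t)) has_vector_derivative snd d) (at t within J)" for d t
        by (rule has_vector_derivative_pair_iff)
      have Fs: "F (s t) = (- (matrix_inv (stacked_hessian X \<phi> (fst (s t) + xs)) *v (stacked_gradient X f (fst (s t) + xs) - stacked_gradient X f xs
          + L *v fst (s t) + S *v (R *v snd (s t)))), transpose R *v (S *v fst (s t)))" for t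
        using Gf[of 0] by (simp add: F_def N_def g_def B_def C_def Gf del: transpose_matrix_vector)
      have mem: "(fst (s t), snd (s t)) \<in> centered_states k0 \<longleftrightarrow> s t \<in> {v. snd v \<in> K}" for t
        by (simp add: centered_states_def K_def split_beta)
      show ?thesis
        unfolding centered_solution_def ex_pair_components pair Fs fst_conv snd_conv mem ..
    qed
    then have "centered_solution X f \<phi> xs L S R k0 = (\<lambda>J v. \<forall>t\<in>J. v t \<in> {v. snd v \<in> K} \<and>
        (v has_vector_derivative F (v t)) (at t within J))"
      by (intro ext) (simp only:)
    moreover have "centered_states k0 = {v. snd v \<in> K}" by (auto simp: centered_states_def K_def)
    ultimately show ?thesis using stable by (simp only: zero_prod_def)
  qed

  \<comment> \<open>The mirror map near the equilibrium\<close>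
  define gm where "gm = gradient UNIV (conjugate X \<phi>)"
  define z0 where "z0 = gradient X \<phi> xstar"
  have block_zs: "block zs i = z0" for i by (simp add: zs_eq z0_def)
  define mm where "mm = (mirror_map X \<phi> :: real^('n \<times> 'd) \<Rightarrow> real^('n \<times> 'd))"
  have mm: "mm z = col (\<lambda>i. gm (block z i))" for z by (simp add: mm_def mirror_map_def gm_def)
  have gm0: "gm z0 = xstar"
    unfolding gm_def z0_def by (rule gradient_conjugate_gradient[OF X(1) ne phi_diff phi_strong xs_int])
  have mm_zs: "mm zs = xs" by (simp add: mm block_zs gm0 xs_eq)
  define q where "q = (\<lambda>\<zeta>. mm (\<zeta> + zs) - xs)"
  have q_lip: "norm (q u - q v) \<le> 2 / \<mu>\<^sub>\<phi> * norm (u - v)" for u v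
  proof -
    have "(2 / \<mu>\<^sub>\<phi>)-lipschitz_on UNIV gm"
      using gradient_conjugate_lipschitz[OF X(1) ne phi_cont phi_strong] \<mu>
      by (intro lipschitz_onI) (auto simp: dist_norm gm_def)
    then have "(2 / \<mu>\<^sub>\<phi>)-lipschitz_on {x. \<forall>i. block x i \<in> UNIV} mm"
      unfolding mm by (rule stacked_lipschitz)
    then have "norm (mm (u + zs) - mm (v + zs)) \<le> 2 / \<mu>\<^sub>\<phi> * norm ((u + zs) - (v + zs))"
      by (rule lipschitz_on_normD) auto
    then show ?thesis by (simp add: q_def)
  qed
  have q0: "q 0 = 0" by (simp add: q_def mm_zs)
  have q_deriv: "(q has_derivative N 0) (at 0)"
  proof -
    have z_ball: "xstar \<in> cball xstar \<rho>" using \<rho> by simp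
    have inv: "matrix_inv M0 *v (M0 *v v) = v" for v
      unfolding M0_def by (rule positive_definite_matrix_inv(2)[OF \<mu> h_pos[OF z_ball]])
    have gm_d: "(gm has_derivative (\<lambda>h. matrix_inv M0 *v h)) (at z0)"
      unfolding gm_def z0_def
      by (rule gradient_conjugate_has_derivative[OF X(1) ne phi_diff phi_strong xs_int h_deriv[OF z_ball]
            matrix_vector_mul_linear]) (use inv M0_def in simp)
    have shift: "((\<lambda>y. y + z0) has_derivative (\<lambda>h. h)) (at 0)"
      by (auto intro!: derivative_eq_intros)
    have "((\<lambda>x. col (\<lambda>i. gm (block x i + z0))) has_derivative
        (\<lambda>h. col (\<lambda>i. matrix_inv M0 *v block h i))) (at (0 :: real^('n \<times> 'd)))"
    proof (rule stacked_has_derivative)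
      show "((\<lambda>y. gm (y + z0)) has_derivative (*v) (matrix_inv M0)) (at (block 0 i))" for i :: 'n
        using has_derivative_compose[OF shift, of gm "(*v) (matrix_inv M0)"] gm_d by simp
    qed
    moreover have "(\<lambda>x. col (\<lambda>i. gm (block x i + z0))) = (\<lambda>x. mm (x + zs))"
      by (simp add: mm block_zs)
    ultimately have "(q has_derivative (\<lambda>h. col (\<lambda>i. matrix_inv M0 *v block h i) - 0)) (at 0)"
      unfolding q_def by (intro has_derivative_diff has_derivative_const) simp
    \<comment> \<open>The inverse of the block-diagonal matrix is recognised blockwise, by applying
      \<open>matrix_inv M0\<close> to each block of \<open>M 0 (N 0 v) = v\<close>.\<close>
    moreover have "col (\<lambda>i. matrix_inv M0 *v block v i) = N 0 v" for v
    proof -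
      have "N 0 v = col (\<lambda>i. matrix_inv M0 *v block (M 0 (N 0 v)) i)"
        by (intro block_eqI) (simp add: M_col M0_def[symmetric] inv)
      then show ?thesis by (simp add: MN[OF zero])
    qed
    ultimately show ?thesis by simp
  qed

  \<comment> \<open>Invariance of the states with block sum zero\<close>
  define K where "K = {y :: real^('n \<times> 'd). (\<Sum>i\<in>UNIV. block y i) = 0}"
  have K: "subspace K"
    by (auto simp: subspace_def K_def sum.distrib scaleR_sum_right[symmetric])
  have LK: "L *v x \<in> K" for x by (simp add: K_def L_sum)
  have ysK: "ys \<in> K" using grad_sum by (simp add: K_def ys Gf_def sum_negf)
  have states: "mirror_descent_states X \<phi> = {(x :: real^('n \<times> 'd), y, z). x = mm z \<and> y \<in> K}"
    by (simp add: mirror_descent_states_def mm_def K_def)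
  have solution: "mirror_descent_solution X f \<phi> L J s \<longleftrightarrow> (\<exists>x y z. s = (\<lambda>t. (x t, y t, z t)) \<and> (\<forall>t\<in>J. x t = mm (z t) \<and>
        (z has_vector_derivative - (stacked_gradient X f (x t) + L *v x t + y t)) (at t within J) \<and>
        (y has_vector_derivative L *v x t) (at t within J)))" for J s
    by (simp add: mirror_descent_solution_def mm_def)

  have invariant: "s t \<in> mirror_descent_states X \<phi>"
    if J: "time_interval J" and s: "mirror_descent_solution X f \<phi> L J s"
      and s0: "s 0 \<in> mirror_descent_states X \<phi>" and t: "t \<in> J" for J t and s :: "real \<Rightarrow> (real^('n \<times> 'd)) \<times> (real^('n \<times> 'd)) \<times> (real^('n \<times> 'd))"
  proof -
    obtain x y z where xyz: "s = (\<lambda>t. (x t, y t, z t))" "\<And>t. t \<in> J \<Longrightarrow> x t = mm (z t)"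
      "\<And>t. t \<in> J \<Longrightarrow> (y has_vector_derivative L *v x t) (at t within J)"
      using s unfolding solution by blast
    have "y t \<in> K"
      by (rule solution_in_subspace[where s' = "\<lambda>t. L *v x t", OF J K _ xyz(3) LK t])
        (use s0 in \<open>simp_all add: states xyz(1)\<close>)
    then show ?thesis using xyz(2)[OF t] by (simp add: states xyz(1))
  qed

  \<comment> \<open>Stability of the mirror descent dynamics\<close>
  have part2: "locally_exp_stable (mirror_descent_solution X f \<phi> L) (mirror_descent_states X \<phi>) (xs, ys, zs)"
  proof -
    \<comment> \<open>As \<open>y\<close> moves with velocity \<open>L *v x\<close> and enters the
      force directly, the weight of its energy has to cancel \<open>L\<close> on vectors with block
      sum 0.\<close>
    obtain T \<tau> where T: "linear T" "\<And>u v. T u \<bullet> v = u \<bullet> T v" "0 < \<tau>"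
      "\<And>w. \<tau> * (norm w)\<^sup>2 \<le> w \<bullet> T w"
      "\<And>w x. (\<Sum>i\<in>UNIV. block w i) = 0 \<Longrightarrow> T w \<bullet> (L *v x) = w \<bullet> x"
      using symmetric_inverse_on_zero_sum[OF linL L_sym L_psd L_null L_sum] by blast
    define F where "F = (\<lambda>v. (- (g (q (fst v)) + snd v), L *v q (fst v)))"
    \<comment> \<open>The centred mirror map \<open>q\<close> has Lipschitz constant
      \<open>2 / \<mu>\<^sub>\<phi>\<close>, so it maps the ball of radius \<open>r\<close> into the
      ball of radius \<open>\<rho>\<close> on which \<open>g\<close> is controlled.\<close>
    define r where "r = \<rho> * \<mu>\<^sub>\<phi> / 2"
    have r: "0 < r" using \<rho> \<mu> by (simp add: r_def)
    have q_on: "(2 / \<mu>\<^sub>\<phi>)-lipschitz_on U q" for U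
      using q_lip \<mu> by (intro lipschitz_onI) (auto simp: dist_norm)
    have q_in: "q \<zeta> \<in> cball 0 \<rho>" if "\<zeta> \<in> cball 0 r" for \<zeta>
    proof -
      have "norm (q \<zeta>) \<le> 2 / \<mu>\<^sub>\<phi> * norm \<zeta>" using q_lip[of \<zeta> 0] q0 by simp
      also have "\<dots> \<le> 2 / \<mu>\<^sub>\<phi> * r" using that \<mu> by (intro mult_left_mono) auto
      also have "\<dots> = \<rho>" using \<mu> by (simp add: r_def)
      finally show ?thesis by simp
    qed
    have gq_lip: "((l + lL) * (2 / \<mu>\<^sub>\<phi>))-lipschitz_on (cball 0 r) (\<lambda>\<zeta>. g (q \<zeta>))"
    proof (rule lipschitz_on_compose2[OF q_on])
      show "(l + lL)-lipschitz_on (q ` cball 0 r) g"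
        by (rule lipschitz_on_subset[OF g_lip]) (use q_in in auto)
    qed
    have gq_deriv: "((\<lambda>\<zeta>. g (q \<zeta>)) has_derivative (\<lambda>v. H (N 0 v))) (at 0)"
      by (rule has_derivative_compose[OF q_deriv]) (simp add: q0 g_deriv)
    have stable: "locally_exp_stable (\<lambda>J v. \<forall>t\<in>J. v t \<in> {v. snd v \<in> K} \<and>
        (v has_vector_derivative F (v t)) (at t within J)) {v. snd v \<in> K} 0"
      unfolding F_def
    proof (rule mirrored_saddle_system_stable[where g = "\<lambda>\<zeta>. g (q \<zeta>)" and q = q and C = "(*v) L" and K = K and M = "M 0" and N = "N 0" and m = \<mu>\<^sub>\<phi> and H = H and h = h
          and T = T and \<tau> = \<tau> and r = r and l = "(l + lL) * (2 / \<mu>\<^sub>\<phi>)" and l' = "2 / \<mu>\<^sub>\<phi>"])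
      show "g (q 0) = 0" by (simp add: q0 g0)
      show "T w \<bullet> (L *v x) = w \<bullet> x" if "w \<in> K" for w x using T(5) that by (simp add: K_def)
      show "M 0 (N 0 v) = v" for v by (rule MN[OF zero])
      show "\<mu>\<^sub>\<phi> * (norm v)\<^sup>2 \<le> v \<bullet> M 0 v" for v by (rule M_pos[OF zero])
    qed (use r K linM M_sym \<mu> linN gq_lip gq_deriv q_on q0 q_deriv linH h T(1-4) linL LK in blast)+
    \<comment> \<open>The state is reduced to the centred pair of \<open>z\<close> and
      \<open>y\<close>; \<open>\<Psi>\<close> recovers \<open>x\<close> from \<open>z\<close>
      through the mirror map.\<close>
    define \<Phi> where "\<Phi> = (\<lambda>u :: (real^('n \<times> 'd)) \<times> (real^('n \<times> 'd)) \<times> (real^('n \<times> 'd)).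
        (snd (snd u) - zs, fst (snd u) - ys))"
    define \<Psi> where "\<Psi> = (\<lambda>v :: (real^('n \<times> 'd)) \<times> (real^('n \<times> 'd)).
        (mm (fst v + zs), snd v + ys, fst v + zs))"
    \<comment> \<open>Centring leaves no constants behind, because \<open>L *v xs = 0\<close> and
      \<open>ys\<close> is the negated gradient at \<open>xs\<close>.\<close>
    have F_field: "F (z - zs, y - ys) = (- (stacked_gradient X f (mm z) + L *v mm z + y), L *v mm z)" for z y
    proof -
      have "mm z = q (z - zs) + xs" by (simp add: q_def)
      then have "stacked_gradient X f (mm z) = Gf (q (z - zs))" "L *v mm z = L *v q (z - zs)"
        using L_xs by (simp_all add: Gf matrix_vector_right_distrib)
      then show ?thesis by (simp add: F_def g_def ys)
    qed
    have "locally_exp_stable (mirror_descent_solution X f \<phi> L) (mirror_descent_states X \<phi>) (\<Psi> 0)"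
    proof (rule locally_exp_stable_transfer[where \<Phi> = \<Phi> and \<Psi> = \<Psi> and k = "2 / \<mu>\<^sub>\<phi> + 1", OF stable])
      fix J and s :: "real \<Rightarrow> (real^('n \<times> 'd)) \<times> (real^('n \<times> 'd)) \<times> (real^('n \<times> 'd))" assume J: "time_interval J" and s: "mirror_descent_solution X f \<phi> L J s"
        and s0: "s 0 \<in> mirror_descent_states X \<phi>"
      obtain x y z where xyz: "s = (\<lambda>t. (x t, y t, z t))" "\<And>t. t \<in> J \<Longrightarrow> x t = mm (z t)"
        "\<And>t. t \<in> J \<Longrightarrow> (z has_vector_derivative - (stacked_gradient X f (x t) + L *v x t + y t)) (at t within J)"
        "\<And>t. t \<in> J \<Longrightarrow> (y has_vector_derivative L *v x t) (at t within J)"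
        using s unfolding solution by blast
      have \<Phi>s: "\<Phi> (s t) = (z t - zs, y t - ys)" for t by (simp add: \<Phi>_def xyz(1))
      show "\<forall>t\<in>J. \<Phi> (s t) \<in> {v. snd v \<in> K} \<and>
          ((\<lambda>t. \<Phi> (s t)) has_vector_derivative F (\<Phi> (s t))) (at t within J)"
      proof
        fix t assume t: "t \<in> J"
        have "y t \<in> K" using invariant[OF J s s0 t] by (simp add: states xyz(1))
        then have "\<Phi> (s t) \<in> {v. snd v \<in> K}" using subspace_diff[OF K _ ysK] by (simp add: \<Phi>s)
        moreover have "((\<lambda>t. \<Phi> (s t)) has_vector_derivative F (\<Phi> (s t))) (at t within J)"
          unfolding \<Phi>s F_field has_vector_derivative_pair_iff fst_conv snd_conv
          using xyz(3,4)[OF t] by (auto simp: xyz(2)[OF t] intro!: derivative_eq_intros)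
        ultimately show "\<Phi> (s t) \<in> {v. snd v \<in> K} \<and>
          ((\<lambda>t. \<Phi> (s t)) has_vector_derivative F (\<Phi> (s t))) (at t within J)" by blast
      qed
    next
      fix J v assume v: "\<forall>t\<in>J. v t \<in> {v. snd v \<in> K} \<and> (v has_vector_derivative F (v t)) (at t within J)"
      define z where "z = (\<lambda>t. fst (v t) + zs)"
      define y where "y = (\<lambda>t. snd (v t) + ys)"
      have vt: "v t = (z t - zs, y t - ys)" for t by (simp add: z_def y_def)
      have "(z has_vector_derivative - (stacked_gradient X f (mm (z t)) + L *v mm (z t) + y t)) (at t within J) \<and>
          (y has_vector_derivative L *v mm (z t)) (at t within J)" if t: "t \<in> J" for t
      proof -
        have "(v has_vector_derivative F (v t)) (at t within J)" using v t by blast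
        then have "((\<lambda>t. fst (v t)) has_vector_derivative - (stacked_gradient X f (mm (z t)) + L *v mm (z t) + y t)) (at t within J)"
          "((\<lambda>t. snd (v t)) has_vector_derivative L *v mm (z t)) (at t within J)"
          unfolding has_vector_derivative_pair_iff by (simp_all only: vt[of t] F_field fst_conv snd_conv)
        then show ?thesis unfolding z_def y_def by (auto intro!: derivative_eq_intros)
      qed
      then show "mirror_descent_solution X f \<phi> L J (\<lambda>t. \<Psi> (v t))"
        unfolding solution
        by (intro exI[of _ "\<lambda>t. mm (z t)"] exI[of _ y] exI[of _ z]) (auto simp: \<Psi>_def z_def y_def)
    next
      fix J t and s :: "real \<Rightarrow> (real^('n \<times> 'd)) \<times> (real^('n \<times> 'd)) \<times> (real^('n \<times> 'd))" assume s: "mirror_descent_solution X f \<phi> L J s" and t: "t \<in> J"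
      then show "\<Psi> (\<Phi> (s t)) = s t" unfolding solution by (auto simp: \<Psi>_def \<Phi>_def)
    next
      fix u :: "(real^('n \<times> 'd)) \<times> (real^('n \<times> 'd)) \<times> (real^('n \<times> 'd))" assume "u \<in> mirror_descent_states X \<phi>"
      then obtain y z where u: "u = (mm z, y, z)" "y \<in> K" by (auto simp: states)
      show "\<Phi> u \<in> {v. snd v \<in> K}" using subspace_diff[OF K u(2) ysK] by (simp add: u(1) \<Phi>_def)
      show "\<Psi> (\<Phi> u) = u" by (simp add: u(1) \<Psi>_def \<Phi>_def)
    next
      fix u :: "(real^('n \<times> 'd)) \<times> (real^('n \<times> 'd)) \<times> (real^('n \<times> 'd))"
      have "norm (\<Phi> u - 0) = norm (snd (u - \<Psi> 0))"
        by (cases u) (simp add: \<Phi>_def \<Psi>_def norm_Pair add.commute)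
      also have "\<dots> \<le> norm (u - \<Psi> 0)" by (rule norm_fst_snd_le)
      finally show "norm (\<Phi> u - 0) \<le> norm (u - \<Psi> 0)" .
    next
      show "0 < 2 / \<mu>\<^sub>\<phi> + 1" using \<mu> by (simp add: add_pos_pos)
    next
      fix v :: "(real^('n \<times> 'd)) \<times> (real^('n \<times> 'd))"
      \<comment> \<open>The rebuilt component contributes the Lipschitz constant
        \<open>2 / \<mu>\<^sub>\<phi>\<close> of the mirror map, and the other two components
        together contribute 1.\<close>
      have "norm (\<Psi> v - \<Psi> 0) = norm (q (fst v), (snd v, fst v))"
        by (simp add: \<Psi>_def q_def mm_zs)
      also have "\<dots> \<le> norm (q (fst v)) + norm (snd v, fst v)" by (rule norm_Pair_le)
      also have "norm (snd v, fst v) = norm v" by (cases v) (simp add: norm_Pair add.commute)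
      also have "norm (q (fst v)) \<le> 2 / \<mu>\<^sub>\<phi> * norm (fst v)" using q_lip[of "fst v" 0] q0 by simp
      also have "\<dots> \<le> 2 / \<mu>\<^sub>\<phi> * norm v" using \<mu> by (intro mult_left_mono norm_fst_snd_le) auto
      finally show "norm (\<Psi> v - \<Psi> 0) \<le> (2 / \<mu>\<^sub>\<phi> + 1) * norm (v - 0)" by (simp add: distrib_right)
    next
      show "\<Psi> 0 \<in> mirror_descent_states X \<phi>" using ysK by (simp add: states \<Psi>_def)
    qed
    then show ?thesis by (simp add: \<Psi>_def mm_zs)
  qed

  show ?thesis using part1 part2 invariant by blast
qed

end
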